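(* Let $\omega\in C^\infty(\mathbb{R})$ be a strictly convex superlinear function for which $\omega(p)\ge\omega(0)=0$ for all $p$, and let $S\subset\mathbb{R}^2$ be a purely unrectifiable compact set. Then there is a Lagrangian $L$ of the form $L(x,y,p)=\omega(p)+F(x,y,p)$, where 1. $F\in C^\infty(\mathbb{R}^3)$; 2. $F\ge0$ and $F(x,y,0)=0$ for all $x,y\in\mathbb{R}$; 3. $p\mapsto F(x,y,p)$ is convex for each fixed $(x,y)$, whose universal singular set contains $S$.
   Context: A function $\omega\colon\mathbb{R}\to\mathbb{R}$ is superlinear if $\lim_{|p|\to\infty}\omega(p)/|p|=\infty$. A Lagrangian is a function $L\colon\mathbb{R}^3\to\mathbb{R}$ that is Borel measurable, bounded from below, locally bounded from above, and for which there is a superlinear function $\omega\colon\mathbb{R}\to\mathbb{R}$ with $L(x,y,p)\ge\omega(p)$ for all $(x,y,p)\in\mathbb{R}^3$. $AC[a,b]$ denotes the absolutely continuous real-valued functions on $[a,b]$. For $a<b$ and $u\in AC[a,b]$ put $\mathcal{L}(u;a,b)=\int_a^b L(x,u(x),u'(x))\,dx\in(-\infty,\infty]$ and $\mathcal{L}(a,A;b,B)=\inf\{\mathcal{L}(v;a,b):v\in AC[a,b],\ v(a)=A,\ v(b)=B\}$. A function $u\in AC[a,b]$ is a minimizer for $L$ on $[a,b]$ if $\mathcal{L}(u;a,b)=\mathcal{L}(a,u(a);b,u(b))$. For Lagrangians of the form in the claim (smooth, superlinear, convex in $p$), the universal singular set of $L$ is the set of all $(x_0,y_0)\in\mathbb{R}^2$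 for which there are $a\le x_0\le b$ with $a<b$ and a minimizer $u$ for $L$ on $[a,b]$ such that $u(x_0)=y_0$ and $u$ has infinite derivative ($+\infty$ or $-\infty$; one-sided if $x_0$ is an endpoint) at $x_0$. A set $E\subset\mathbb{R}^2$ is purely unrectifiable if $\mathcal{H}^1(E\cap\{\gamma(t):t\in\mathbb{R}\})=0$ for every Lipschitz curve $\gamma\colon\mathbb{R}\to\mathbb{R}^2$, where $\mathcal{H}^1$ is one-dimensional Hausdorff measure. *)

theory Defs
  imports "HOL-Analysis.Analysis"
begin

text \<open>
  \<open>\<real>\<^sup>2\<close> and \<open>\<real>\<^sup>3\<close> are the product types \<open>real \<times> real\<close> and \<open>real \<times> real \<times> real\<close>, which carry
  the Euclidean norm.
\<close>

text \<open>
  On a finite-dimensional domain, \<open>f\<close> is of class \<open>C\<close> to the \<open>k + 1\<close> if and only if it is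
  differentiable and each of its directional derivatives is of class \<open>C\<close> to the \<open>k\<close>.
\<close>

fun C_k :: "nat \<Rightarrow> ('a::euclidean_space \<Rightarrow> 'b::real_normed_vector) \<Rightarrow> bool" where
  "C_k 0 f \<longleftrightarrow> continuous_on UNIV f"
| "C_k (Suc k) f \<longleftrightarrow>
     (\<forall>x. f differentiable (at x)) \<and> (\<forall>v. C_k k (\<lambda>x. frechet_derivative f (at x) v))"

definition C_infinity :: "('a::euclidean_space \<Rightarrow> 'b::real_normed_vector) \<Rightarrow> bool" where
  "C_infinity f \<longleftrightarrow> (\<forall>k. C_k k f)"

definition strictly_convex :: "(real \<Rightarrow> real) \<Rightarrow> bool" where
  "strictly_convex f \<longleftrightarrow>
     (\<forall>x y t. x \<noteq> y \<longrightarrow> 0 < t \<longrightarrow> t < 1 \<longrightarrow> f ((1 - t) * x + t * y) < (1 - t) * f x + t * f y)"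

definition superlinear :: "(real \<Rightarrow> real) \<Rightarrow> bool" where
  "superlinear \<omega> \<longleftrightarrow> filterlim (\<lambda>p. \<omega> p / \<bar>p\<bar>) at_top at_infinity"

definition lagrangian :: "(real \<times> real \<times> real \<Rightarrow> real) \<Rightarrow> bool" where
  "lagrangian L \<longleftrightarrow>
     L \<in> borel_measurable borel \<and>
     bdd_below (range L) \<and>
     (\<forall>z. \<exists>U. open U \<and> z \<in> U \<and> bdd_above (L ` U)) \<and>
     (\<exists>\<omega>. superlinear \<omega> \<and> (\<forall>x y p. L (x, y, p) \<ge> \<omega> p))"

definition abs_continuous_on :: "real \<Rightarrow> real \<Rightarrow> (real \<Rightarrow> real) \<Rightarrow> bool" where
  "abs_continuous_on a b u \<longleftrightarrow>
     (\<forall>\<epsilon>>0. \<exists>\<delta>>0. \<forall>(n::nat) l r.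
        (\<forall>i<n. a \<le> l i \<and> l i \<le> r i \<and> r i \<le> b) \<longrightarrow>
        disjoint_family_on (\<lambda>i. {l i<..<r i}) {..<n} \<longrightarrow>
        (\<Sum>i<n. r i - l i) < \<delta> \<longrightarrow>
        (\<Sum>i<n. \<bar>u (r i) - u (l i)\<bar>) < \<epsilon>)"

text \<open>
  The integral of \<open>L (x, u x, u' x)\<close> over \<open>[a, b]\<close>, as the integral of the positive part minus that
  of the negative part. For a Lagrangian, which is bounded from below, the latter is finite, so the
  value lies in \<open>(-\<infinity>, \<infinity>]\<close>. Only the restriction of \<open>u\<close> to \<open>[a, b]\<close> matters: \<open>deriv\<close> depends on
  values outside \<open>[a, b]\<close> only at the two endpoints, and for absolutely continuous \<open>u\<close> its arbitrary
  value where \<open>u\<close> is not differentiable is used only on a null set.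
\<close>

definition action :: "(real \<times> real \<times> real \<Rightarrow> real) \<Rightarrow> (real \<Rightarrow> real) \<Rightarrow> real \<Rightarrow> real \<Rightarrow> ereal" where
  "action L u a b =
     enn2ereal (\<integral>\<^sup>+x\<in>{a..b}. ennreal (L (x, u x, deriv u x)) \<partial>lebesgue) -
     enn2ereal (\<integral>\<^sup>+x\<in>{a..b}. ennreal (- L (x, u x, deriv u x)) \<partial>lebesgue)"

definition min_action ::
    "(real \<times> real \<times> real \<Rightarrow> real) \<Rightarrow> real \<Rightarrow> real \<Rightarrow> real \<Rightarrow> real \<Rightarrow> ereal" where
  "min_action L a A b B = (INF v\<in>{v. abs_continuous_on a b v \<and> v a = A \<and> v b = B}. action L v a b)"

definition minimizer :: "(real \<times> real \<times> real \<Rightarrow> real) \<Rightarrow> real \<Rightarrow> real \<Rightarrow> (real \<Rightarrow> real) \<Rightarrow> bool" where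
  "minimizer L a b u \<longleftrightarrow>
     abs_continuous_on a b u \<and> action L u a b = min_action L a (u a) b (u b)"

text \<open>The limit is taken within \<open>[a, b]\<close>, so it is one-sided at an endpoint and two-sided otherwise.\<close>

definition has_infinite_derivative :: "(real \<Rightarrow> real) \<Rightarrow> real \<Rightarrow> real \<Rightarrow> real \<Rightarrow> bool" where
  "has_infinite_derivative u a b x0 \<longleftrightarrow>
     filterlim (\<lambda>x. (u x - u x0) / (x - x0)) at_top (at x0 within {a..b}) \<or>
     filterlim (\<lambda>x. (u x - u x0) / (x - x0)) at_bot (at x0 within {a..b})"

definition universal_singular_set :: "(real \<times> real \<times> real \<Rightarrow> real) \<Rightarrow> (real \<times> real) set" where
  "universal_singular_set L =
     {(x0, y0). \<exists>a b u. a < b \<and> a \<le> x0 \<and> x0 \<le> b \<and> minimizer L a b u \<and> u x0 = y0 \<and>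
        has_infinite_derivative u a b x0}"

text \<open>
  One-dimensional Hausdorff measure by Caratheodory's construction from countable covers by sets of
  small diameter. The covering sets are required to be bounded because \<open>diameter\<close> is a real number
  and says nothing about unbounded sets.
\<close>

definition hausdorff1_delta :: "real \<Rightarrow> 'a::metric_space set \<Rightarrow> ennreal" where
  "hausdorff1_delta \<delta> E =
     (INF C\<in>{C :: nat \<Rightarrow> 'a set. E \<subseteq> (\<Union>n. C n) \<and> (\<forall>n. bounded (C n) \<and> diameter (C n) \<le> \<delta>)}.
        \<Sum>n. ennreal (diameter (C n)))"

definition hausdorff1 :: "'a::metric_space set \<Rightarrow> ennreal" where
  "hausdorff1 E = (SUP \<delta>\<in>{0<..}. hausdorff1_delta \<delta> E)"

definition purely_unrectifiable :: "(real \<times> real) set \<Rightarrow> bool" where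
  "purely_unrectifiable E \<longleftrightarrow>
     (\<forall>\<gamma> :: real \<Rightarrow> real \<times> real. (\<exists>C. C-lipschitz_on UNIV \<gamma>) \<longrightarrow> hausdorff1 (E \<inter> range \<gamma>) = 0)"

end

theory Submission
  imports Defs "HOL-Complex_Analysis.Great_Picard"
begin

text \<open>
  The Lagrangian is built around a calibration. Let \<open>\<Phi>\<close> be a continuous function on the plane whose
  gradient off \<open>S\<close> is \<open>(- A, B)\<close> with \<open>A, B > 0\<close>, and suppose that \<open>L (x, y, p) \<ge> B p - A\<close>, with equality
  for the single slope \<open>p = 3 A / (2 B)\<close>. Along a curve \<open>y = v x\<close> the right-hand side is the
  derivative of \<open>\<Phi> (x, v x)\<close>, so the action of \<open>v\<close> is at least the increment of \<open>\<Phi>\<close>, and it is equal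
  to the increment for solutions of \<open>u' = 3 A / (2 B)\<close>: these are minimizers. If \<open>A / B\<close> tends to
  infinity at \<open>S\<close>, a solution that meets \<open>S\<close> has infinite derivative there.

  Why such a \<open>\<Phi>\<close> exists. Pure unrectifiability says that every Lipschitz curve meets \<open>S\<close> in a null
  set. Consider chains of horizontal and vertical segments that are rewarded for horizontal travel
  in a neighbourhood of \<open>S\<close> and pay \<open>\<delta>\<close> times their vertical length. By compactness
  (\<open>gain_small\<close>) the best reward is arbitrarily small when the neighbourhood is small enough, while, as a
  function of the end point, it has slope \<open>1\<close> in the horizontal direction on the neighbourhood and slope at
  most \<open>\<delta>\<close> in the vertical direction. After cutting off, mollifying and a linear change of
  coordinates this becomes \<open>directed_bump\<close>: a uniformly small smooth function, supported near \<open>S\<close>,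
  whose gradient is nearly a multiple \<open>s (- a, b)\<close> of a prescribed vector, with \<open>s = 1\<close> around \<open>S\<close>.
  Now \<open>\<Phi>\<close> is a linear function plus a series of such bumps over neighbourhoods shrinking to \<open>S\<close>;
  each one lifts the ratio \<open>A / B\<close> by about \<open>1\<close>.

  Why \<open>F\<close> is smooth. For fixed \<open>(x, y)\<close> the function \<open>F\<close> is a smooth convex ramp in \<open>p\<close> that bends
  \<open>\<omega>\<close> up to the line \<open>B p - A\<close>. If \<open>B\<close> is large compared with \<open>\<omega>'\<close> at the touching slope, the ramp
  vanishes for \<open>p \<le> 5 A / (14 B)\<close> (\<open>bend_eq_0\<close>). Since \<open>A / B\<close> tends to infinity at \<open>S\<close>, locally in
  \<open>p\<close> the function \<open>F\<close> is zero near \<open>S\<close>.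

  Why competitors cannot gain by running along \<open>S\<close>. There \<open>\<Phi>\<close> has no gradient to compare with. To the
  partial sums of \<open>\<Phi>\<close> one adds a further small bump that lowers the \<open>x\<close>-derivative around \<open>S\<close> so much
  that superlinearity of \<open>\<omega>\<close> alone gives the inequality (\<open>\<Psi>_calibrates\<close>). The modified
  functions are smooth, calibrate up to a small error everywhere and converge to \<open>\<Phi>\<close>.

  Why there is a trajectory through each point of \<open>S\<close>. Written as \<open>dx/dy = 2 B / (3 A)\<close>, the equation
  has a right-hand side that extends continuously by \<open>0\<close> to \<open>S\<close>, so Peano's theorem applies. A piece
  on which \<open>x\<close> is constant would lie in \<open>S\<close>, and the trajectory meets \<open>S\<close> only at a null set of
  heights; hence \<open>x\<close> is strictly increasing in \<open>y\<close>, and its inverse is absolutely continuous.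
\<close>

section \<open>Smooth functions\<close>

text \<open>
  Smoothness relative to an open set, so that it can be checked locally: the Lagrangian is given by
  one formula near the singular set and by another one away from it.
\<close>

fun Ck_on :: "nat \<Rightarrow> 'a::euclidean_space set \<Rightarrow> ('a \<Rightarrow> real) \<Rightarrow> bool" where
  "Ck_on 0 U f \<longleftrightarrow> continuous_on U f"
| "Ck_on (Suc k) U f \<longleftrightarrow>
     (\<forall>x\<in>U. f differentiable (at x)) \<and> (\<forall>v. Ck_on k U (\<lambda>x. frechet_derivative f (at x) v))"

definition smooth_on :: "'a::euclidean_space set \<Rightarrow> ('a \<Rightarrow> real) \<Rightarrow> bool" where
  "smooth_on U f \<longleftrightarrow> (\<forall>k. Ck_on k U f)"

lemma C_k_iff_Ck_on: "C_k k f \<longleftrightarrow> Ck_on k UNIV f" for f :: "'a::euclidean_space \<Rightarrow> real"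
  by (induction k arbitrary: f) auto

lemma C_infinity_iff_smooth_on: "C_infinity f \<longleftrightarrow> smooth_on UNIV f"
  for f :: "'a::euclidean_space \<Rightarrow> real"
  by (simp add: C_infinity_def smooth_on_def C_k_iff_Ck_on)

lemma Ck_on_cong:
  assumes "open U" "\<And>x. x \<in> U \<Longrightarrow> f x = g x" "Ck_on k U f"
  shows "Ck_on k U g"
  using assms(2,3)
proof (induction k arbitrary: f g)
  case 0
  then show ?case using continuous_on_cong by (metis Ck_on.simps(1))
next
  case (Suc k)
  have d: "(g has_derivative frechet_derivative f (at x)) (at x)" if "x \<in> U" for x
  proof -
    have "(f has_derivative frechet_derivative f (at x)) (at x)"
      using Suc.prems that frechet_derivative_works by auto
    then show ?thesis
      by (rule has_derivative_transform_within_open[OF _ \<open>open U\<close> that]) (use Suc.prems in auto)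
  qed
  then have e: "frechet_derivative g (at x) = frechet_derivative f (at x)" if "x \<in> U" for x
    using that frechet_derivative_at by metis
  have "Ck_on k U (\<lambda>x. frechet_derivative g (at x) v)" for v
    by (rule Suc.IH[of "\<lambda>x. frechet_derivative f (at x) v"]) (use Suc.prems e in auto)
  then show ?case using d by (auto simp: differentiable_def)
qed

lemma Ck_on_SucI:
  assumes "open U" "\<And>x. x \<in> U \<Longrightarrow> (f has_derivative f' x) (at x)" "\<And>v. Ck_on k U (\<lambda>x. f' x v)"
  shows "Ck_on (Suc k) U f"
proof -
  have "Ck_on k U (\<lambda>x. frechet_derivative f (at x) v)" for v
    by (rule Ck_on_cong[OF assms(1) _ assms(3)[of v]]) (use assms(2) frechet_derivative_at in metis)
  then show ?thesis using assms(2) by (auto simp: differentiable_def)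
qed

lemma Ck_on_has_derivative:
  assumes "Ck_on (Suc k) U f" "x \<in> U"
  shows "(f has_derivative frechet_derivative f (at x)) (at x)"
  using assms frechet_derivative_works by auto

lemma Ck_on_Suc_imp: "Ck_on (Suc k) U f \<Longrightarrow> Ck_on k U f"
proof (induction k arbitrary: f)
  case 0
  then show ?case
    by (metis Ck_on.simps continuous_at_imp_continuous_on differentiable_imp_continuous_within)
next
  case (Suc k)
  then show ?case by (metis Ck_on.simps(2))
qed

lemma Ck_on_imp_continuous_on: "Ck_on k U f \<Longrightarrow> continuous_on U f"
proof (induction k)
  case (Suc k)
  then show ?case using Ck_on_Suc_imp by blast
qed simp

lemma Ck_on_local:
  assumes "\<And>x. x \<in> U \<Longrightarrow> \<exists>V. open V \<and> x \<in> V \<and> Ck_on k V f"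
  shows "Ck_on k U f"
  using assms
proof (induction k arbitrary: f)
  case 0
  then have "isCont f x" if "x \<in> U" for x
    using that by (metis Ck_on.simps(1) continuous_on_eq_continuous_at)
  then show ?case by (simp add: continuous_at_imp_continuous_on)
next
  case (Suc k)
  then have "Ck_on k U (\<lambda>x. frechet_derivative f (at x) v)" for v
    by (metis Ck_on.simps(2))
  then show ?case using Suc.prems by (metis Ck_on.simps(2))
qed

lemma Ck_on_const [simp]: "open U \<Longrightarrow> Ck_on k U (\<lambda>x. c)"
proof (induction k arbitrary: c)
  case (Suc k)
  then show ?case by (intro Ck_on_SucI[where f' = "\<lambda>x v. 0"]) auto
qed simp

lemma Ck_on_bounded_linear:
  assumes "open U" "bounded_linear f"
  shows "Ck_on k U f"
proof (cases k)
  case 0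
  then show ?thesis using assms by (simp add: linear_continuous_on)
next
  case (Suc j)
  show ?thesis unfolding Suc
    by (rule Ck_on_SucI[where f' = "\<lambda>x. f"])
      (use assms in \<open>auto intro: bounded_linear_imp_has_derivative\<close>)
qed

lemma Ck_on_add:
  assumes "open U" "Ck_on k U f" "Ck_on k U g"
  shows "Ck_on k U (\<lambda>x. f x + g x)"
  using assms(2,3)
proof (induction k arbitrary: f g)
  case 0
  then show ?case by (auto intro: continuous_intros)
next
  case (Suc k)
  show ?case
    by (rule Ck_on_SucI[OF assms(1) has_derivative_add, OF Ck_on_has_derivative[OF Suc.prems(1)]
          Ck_on_has_derivative[OF Suc.prems(2)]]) (use Suc in auto)
qed

lemma Ck_on_mult:
  assumes "open U" "Ck_on k U f" "Ck_on k U g"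
  shows "Ck_on k U (\<lambda>x. f x * g x)"
  using assms(2,3)
proof (induction k arbitrary: f g)
  case 0
  then show ?case by (auto intro: continuous_intros)
next
  case (Suc k)
  have "Ck_on k U (\<lambda>x. f x * frechet_derivative g (at x) v + frechet_derivative f (at x) v * g x)" for v
    by (intro Ck_on_add assms(1) Suc.IH) (use Suc.prems Ck_on_Suc_imp in auto)
  note d = this
  show ?case
    by (rule Ck_on_SucI[OF assms(1) has_derivative_mult, OF Ck_on_has_derivative[OF Suc.prems(1)]
          Ck_on_has_derivative[OF Suc.prems(2)] d])
qed

text \<open>
  By the chain rule every directional derivative of \<open>g \<circ> f\<close> is a product of \<open>g' \<circ> f\<close>, to which the
  induction hypothesis applies, and a directional derivative of \<open>f\<close>.
\<close>

lemma Ck_on_compose_real: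
  fixes g :: "real \<Rightarrow> real"
  assumes "open U" "Ck_on k V g" "Ck_on k U f" "\<And>x. x \<in> U \<Longrightarrow> f x \<in> V"
  shows "Ck_on k U (\<lambda>x. g (f x))"
  using assms(2,3)
proof (induction k arbitrary: g)
  case 0
  then show ?case using assms(4)
    by (auto intro: continuous_on_compose2)
next
  case (Suc k)
  have "((\<lambda>x. g (f x)) has_derivative
      (\<lambda>v. frechet_derivative g (at (f x)) 1 * frechet_derivative f (at x) v)) (at x)" if "x \<in> U" for x
  proof -
    have l: "linear (frechet_derivative g (at (f x)))"
      using Suc.prems assms(4)[OF that] linear_frechet_derivative by auto
    have "frechet_derivative g (at (f x)) r = frechet_derivative g (at (f x)) 1 * r" for r
      using linear_scale[OF l, of r 1] by simp
    then show ?thesis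
      using has_derivative_compose[OF Ck_on_has_derivative[OF Suc.prems(2) that]
          Ck_on_has_derivative[OF Suc.prems(1) assms(4)[OF that]]] by (metis (no_types, lifting) ext)
  qed
  moreover have "Ck_on k U (\<lambda>x. frechet_derivative g (at (f x)) 1 * frechet_derivative f (at x) v)" for v
    by (intro Ck_on_mult[OF assms(1)] Suc.IH[of "\<lambda>t. frechet_derivative g (at t) 1"])
      (use Suc.prems Ck_on_Suc_imp in auto)
  ultimately show ?case by (rule Ck_on_SucI[OF assms(1)])
qed

lemma Ck_on_compose_linear:
  fixes g :: "'b::euclidean_space \<Rightarrow> real" and M :: "'a::euclidean_space \<Rightarrow> 'b"
  assumes "open U" "bounded_linear M" "Ck_on k V g" "\<And>x. x \<in> U \<Longrightarrow> M x \<in> V"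
  shows "Ck_on k U (\<lambda>x. g (M x))"
  using assms(3)
proof (induction k arbitrary: g)
  case 0
  then show ?case using assms(4) linear_continuous_on[OF assms(2)]
    by (auto intro: continuous_on_compose2)
next
  case (Suc k)
  show ?case
    by (rule Ck_on_SucI[OF assms(1) has_derivative_compose,
          OF bounded_linear_imp_has_derivative[OF assms(2)] Ck_on_has_derivative[OF Suc.prems]])
      (use assms(4) Suc in auto)
qed

lemma smooth_on_cong: "open U \<Longrightarrow> (\<And>x. x \<in> U \<Longrightarrow> f x = g x) \<Longrightarrow> smooth_on U f \<Longrightarrow> smooth_on U g"
  unfolding smooth_on_def by (metis Ck_on_cong)

lemma smooth_on_local:
  assumes "\<And>x. x \<in> U \<Longrightarrow> \<exists>V. open V \<and> x \<in> V \<and> smooth_on V f"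
  shows "smooth_on U f"
  using assms Ck_on_local unfolding smooth_on_def by metis

lemma smooth_on_const [simp]: "open U \<Longrightarrow> smooth_on U (\<lambda>x. c)"
  by (simp add: smooth_on_def)

lemma smooth_on_bounded_linear: "open U \<Longrightarrow> bounded_linear f \<Longrightarrow> smooth_on U f"
  by (simp add: smooth_on_def Ck_on_bounded_linear)

lemma smooth_on_add: "open U \<Longrightarrow> smooth_on U f \<Longrightarrow> smooth_on U g \<Longrightarrow> smooth_on U (\<lambda>x. f x + g x)"
  by (simp add: smooth_on_def Ck_on_add)

lemma smooth_on_mult: "open U \<Longrightarrow> smooth_on U f \<Longrightarrow> smooth_on U g \<Longrightarrow> smooth_on U (\<lambda>x. f x * g x)"
  by (simp add: smooth_on_def Ck_on_mult)

lemma smooth_on_cmult: "open U \<Longrightarrow> smooth_on U f \<Longrightarrow> smooth_on U (\<lambda>x. c * f x)"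
  by (simp add: smooth_on_mult)

lemma smooth_on_minus: "open U \<Longrightarrow> smooth_on U f \<Longrightarrow> smooth_on U (\<lambda>x. - f x)"
  using smooth_on_cmult[of U f "-1"] by simp

lemma smooth_on_diff: "open U \<Longrightarrow> smooth_on U f \<Longrightarrow> smooth_on U g \<Longrightarrow> smooth_on U (\<lambda>x. f x - g x)"
  using smooth_on_add[of U f "\<lambda>x. - g x"] by (simp add: smooth_on_minus)

lemma smooth_on_sum:
  "open U \<Longrightarrow> (\<And>i. i \<in> I \<Longrightarrow> smooth_on U (f i)) \<Longrightarrow> smooth_on U (\<lambda>x. \<Sum>i\<in>I. f i x)"
  by (induction I rule: infinite_finite_induct) (simp_all add: smooth_on_add)

lemma smooth_on_compose_real:
  fixes g :: "real \<Rightarrow> real"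
  shows "open U \<Longrightarrow> smooth_on V g \<Longrightarrow> smooth_on U f \<Longrightarrow> (\<And>x. x \<in> U \<Longrightarrow> f x \<in> V)
    \<Longrightarrow> smooth_on U (\<lambda>x. g (f x))"
  unfolding smooth_on_def by (metis Ck_on_compose_real)

lemma smooth_on_compose_linear:
  "open U \<Longrightarrow> bounded_linear M \<Longrightarrow> smooth_on V g \<Longrightarrow> (\<And>x. x \<in> U \<Longrightarrow> M x \<in> V)
    \<Longrightarrow> smooth_on U (\<lambda>x. g (M x))"
  unfolding smooth_on_def by (metis Ck_on_compose_linear)

lemma smooth_on_directional_derivative:
  "smooth_on U f \<Longrightarrow> smooth_on U (\<lambda>x. frechet_derivative f (at x) v)"
  unfolding smooth_on_def using Ck_on.simps(2) by blast

lemma smooth_on_has_derivative: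
  "smooth_on U f \<Longrightarrow> x \<in> U \<Longrightarrow> (f has_derivative frechet_derivative f (at x)) (at x)"
  unfolding smooth_on_def using Ck_on_has_derivative by blast

lemma smooth_on_imp_continuous_on: "smooth_on U f \<Longrightarrow> continuous_on U f"
  unfolding smooth_on_def using Ck_on.simps(1) by blast

lemma smooth_on_inverse_pos: "smooth_on {0<..} (inverse :: real \<Rightarrow> real)"
  unfolding smooth_on_def
proof
  show "Ck_on k {0<..} (inverse :: real \<Rightarrow> real)" for k
  proof (induction k)
    case 0
    then show ?case by (auto intro!: continuous_intros)
  next
    case (Suc k)
    have "Ck_on k {0<..} (\<lambda>x::real. (-v) * (inverse x * inverse x))" for v
      by (intro Ck_on_mult Suc Ck_on_const) auto
    then show ?case
      by (intro Ck_on_SucI[where f' = "\<lambda>x v. (-v) * (inverse x * inverse x)"])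
        (auto intro!: derivative_eq_intros simp: field_simps)
  qed
qed

lemma smooth_on_divide:
  assumes "open U" "smooth_on U f" "smooth_on U g" "\<And>x. x \<in> U \<Longrightarrow> 0 < g x"
  shows "smooth_on U (\<lambda>x. f x / g x)"
proof -
  have "smooth_on U (\<lambda>x. f x * inverse (g x))"
    by (intro smooth_on_mult smooth_on_compose_real[OF _ smooth_on_inverse_pos] assms) (use assms in auto)
  then show ?thesis by (simp add: divide_inverse)
qed

text \<open>
  The functions \<open>exp (- 1 / t) / t ^ j\<close>, extended by zero to \<open>t \<le> 0\<close>. The span of this family is closed under
  differentiation, which turns the smoothness of \<open>exp (- 1 / t)\<close> into an induction.
\<close>

definition flat :: "nat \<Rightarrow> real \<Rightarrow> real" where
  "flat j t = (if t \<le> 0 then 0 else exp (- 1 / t) / t ^ j)"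

lemma flat_tendsto: "((\<lambda>t. exp (- 1 / t) / t ^ j) \<longlongrightarrow> (0::real)) (at_right 0)"
proof -
  have "((\<lambda>x. x ^ j / exp x) \<longlongrightarrow> (0::real)) at_top"
    by (rule tendsto_power_div_exp_0)
  then have "((\<lambda>t. (inverse t) ^ j / exp (inverse t)) \<longlongrightarrow> (0::real)) (at_right 0)"
    by (rule filterlim_compose[OF _ filterlim_inverse_at_top_right])
  then show ?thesis
    by (simp add: exp_minus divide_inverse power_inverse mult.commute)
qed

lemma flat_has_derivative:
  "(flat j has_real_derivative (flat (j + 2) t - of_nat j * flat (j + 1) t)) (at t)"
proof -
  consider "t < 0" | "t > 0" | "t = 0" by linarith
  then show ?thesis
  proof cases
    case 1
    have "((\<lambda>t. 0) has_real_derivative 0) (at t)" by simp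
    then show ?thesis using 1
      by (auto simp: flat_def intro: has_field_derivative_transform_within_open[where S = "{..<0}" and f = "\<lambda>t. 0"])
  next
    case 2
    have "((\<lambda>t. exp (- 1 / t) / t ^ j) has_real_derivative (flat (j + 2) t - of_nat j * flat (j + 1) t)) (at t)"
      using 2
      apply (auto intro!: derivative_eq_intros simp: flat_def)
      apply (cases j)
       apply (auto simp: divide_simps power2_eq_square)
      apply (auto simp: algebra_simps)
      done
    then show ?thesis
      by (rule has_field_derivative_transform_within_open[where S = "{0<..}"]) (use 2 in \<open>auto simp: flat_def\<close>)
  next
    case 3
    have "((\<lambda>h. (flat j (0 + h) - flat j 0) / h) \<longlongrightarrow> 0) (at_left 0)"
      by (rule tendsto_eventually) (auto simp: eventually_at_filter flat_def)
    moreover have "((\<lambda>h. (flat j (0 + h) - flat j 0) / h) \<longlongrightarrow> 0) (at_right 0)"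
      by (rule Lim_transform_eventually[OF flat_tendsto[of "Suc j"]])
        (auto simp: eventually_at_filter flat_def)
    ultimately show ?thesis
      using 3 by (simp add: DERIV_def filterlim_split_at flat_def)
  qed
qed

lemma smooth_on_flat: "smooth_on UNIV (flat j)"
  unfolding smooth_on_def
proof
  show "Ck_on k UNIV (flat j)" for k
  proof (induction k arbitrary: j)
    case 0
    have "isCont (flat j) t" for t using flat_has_derivative DERIV_isCont by blast
    then show ?case by (simp add: continuous_at_imp_continuous_on)
  next
    case (Suc k)
    have "Ck_on k UNIV (\<lambda>t. v * (flat (j + 2) t + (- of_nat j) * flat (j + 1) t))" for v
      by (intro Ck_on_mult Ck_on_add Suc Ck_on_const) auto
    then show ?case
      by (intro Ck_on_SucI[where f' = "\<lambda>t v. v * (flat (j + 2) t + (- of_nat j) * flat (j + 1) t)"])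
        (use flat_has_derivative[of j] in \<open>auto simp: has_field_derivative_def mult_commute_abs\<close>)
  qed
qed

text \<open>
  A smooth convex function that vanishes on the negative half line. The factor \<open>exp 1\<close> makes its
  value at \<open>1\<close> equal to \<open>1\<close> and its slope there equal to \<open>2\<close>, so that \<open>2 t - 1\<close> is a tangent.
\<close>

definition ramp :: "real \<Rightarrow> real" where
  "ramp t = exp 1 * (t * flat 0 t)"

lemma ramp_nonpos: "t \<le> 0 \<Longrightarrow> ramp t = 0"
  by (simp add: ramp_def flat_def)

lemma ramp_nonneg: "0 \<le> ramp t"
  by (simp add: ramp_def flat_def)

lemma smooth_on_ramp: "smooth_on UNIV ramp"
  unfolding ramp_def[abs_def]
  by (intro smooth_on_cmult smooth_on_mult smooth_on_flat smooth_on_bounded_linear) (auto intro: bounded_linear_ident)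

lemma ramp_has_derivative: "(ramp has_real_derivative exp 1 * (flat 0 t + flat 1 t)) (at t)"
proof -
  have "((\<lambda>t. exp 1 * (t * flat 0 t)) has_real_derivative exp 1 * (1 * flat 0 t + (flat 2 t - 0) * t)) (at t)"
    using flat_has_derivative[of 0 t] by (intro DERIV_cmult DERIV_mult) (auto simp: numeral_2_eq_2)
  moreover have "flat 2 t * t = flat 1 t" by (simp add: flat_def power2_eq_square)
  ultimately show ?thesis by (simp add: ramp_def[abs_def])
qed

lemma convex_on_ramp: "convex_on UNIV ramp"
proof (rule f''_ge0_imp_convex[OF convex_UNIV ramp_has_derivative])
  show "((\<lambda>t. exp 1 * (flat 0 t + flat 1 t)) has_real_derivative exp 1 * flat 3 t) (at t)" for t
    using flat_has_derivative[of 0 t] flat_has_derivative[of 1 t]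
    by (auto intro!: derivative_eq_intros simp: numeral_2_eq_2 numeral_3_eq_3)
qed (simp add: flat_def)

lemma ramp_ge_tangent: "ramp t \<ge> 2 * t - 1"
proof -
  have "ramp t \<ge> ramp 1 + (exp 1 * (flat 0 1 + flat 1 1)) * (t - 1)"
    using convex_on_imp_above_tangent[OF convex_on_ramp, of 1 t "exp 1 * (flat 0 1 + flat 1 1)"]
      ramp_has_derivative[of 1] by (simp add: algebra_simps)
  moreover have "exp 1 * (flat 0 1 + flat 1 1) = 2" "ramp 1 = 1"
    by (simp_all add: ramp_def flat_def exp_minus field_simps)
  ultimately show ?thesis by simp
qed

lemma ramp_1 [simp]: "ramp 1 = 1"
  by (simp add: ramp_def flat_def exp_minus)

text \<open>
  A convolution is as smooth as its kernel, because Leibniz' rule puts each derivative on the kernel.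
\<close>

lemma Ck_on_integral_translates:
  fixes f \<rho> :: "'a::euclidean_space \<Rightarrow> real"
  assumes "continuous_on UNIV f" "Ck_on k UNIV \<rho>"
  shows "Ck_on k UNIV (\<lambda>z. integral (cbox a b) (\<lambda>y. f y * \<rho> (z - y)))"
  using assms(2)
proof (induction k arbitrary: \<rho>)
  case 0
  have "continuous_on (UNIV \<times> cbox a b) (\<lambda>(z, y). f y * \<rho> (z - y))"
    using 0 assms(1) unfolding case_prod_beta
    by (auto intro!: continuous_intros intro: continuous_on_compose2[of UNIV])
  then show ?case by (auto intro: integral_continuous_on_param)
next
  case (Suc k)
  have d: "(\<rho> has_derivative frechet_derivative \<rho> (at z)) (at z)" for z
    using Ck_on_has_derivative[OF Suc.prems] by blast
  have bl: "bounded_linear (frechet_derivative \<rho> (at z))" for z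
    using d has_derivative_bounded_linear by blast
  define D where "D z y = f y *\<^sub>R Blinfun (frechet_derivative \<rho> (at (z - y)))" for z y
  have D: "blinfun_apply (D z y) v = f y * frechet_derivative \<rho> (at (z - y)) v" for z y v
    by (simp add: D_def scaleR_blinfun.rep_eq bounded_linear_Blinfun_apply[OF bl])
  have cv: "continuous_on UNIV (\<lambda>z. frechet_derivative \<rho> (at z) v)" for v
    using Suc.prems by (intro Ck_on_imp_continuous_on[of k]) auto
  have contD: "continuous_on (UNIV \<times> cbox a b) (\<lambda>(z, y). D z y)"
    unfolding case_prod_beta
  proof (rule continuous_on_blinfun_componentwise)
    fix i :: 'a
    show "continuous_on (UNIV \<times> cbox a b) (\<lambda>p. blinfun_apply (D (fst p) (snd p)) i)"
      unfolding D using assms(1)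
      by (auto intro!: continuous_intros intro: continuous_on_compose2[of UNIV] continuous_on_compose2[OF cv[of i]])
  qed
  have cr: "continuous_on UNIV \<rho>"
    using d by (meson has_derivative_continuous continuous_at_imp_continuous_on)
  have ci: "continuous_on (cbox a b) (\<lambda>y. f y * \<rho> (z - y))" for z
    using assms(1) cr by (auto intro!: continuous_intros intro: continuous_on_compose2[of UNIV])
  have L: "((\<lambda>z. integral (cbox a b) (\<lambda>y. f y * \<rho> (z - y))) has_derivative
     blinfun_apply (integral (cbox a b) (D z))) (at z)" for z
  proof (rule leibniz_rule[where U = UNIV, simplified])
    show "((\<lambda>z. f y * \<rho> (z - y)) has_derivative blinfun_apply (D z y)) (at z)" for z y
    proof -
      have "((\<lambda>z. \<rho> (z - y)) has_derivative (\<lambda>v. frechet_derivative \<rho> (at (z - y)) (v - 0))) (at z)"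
        by (rule has_derivative_compose[OF _ d]) (auto intro!: derivative_eq_intros)
      then have "((\<lambda>z. f y * \<rho> (z - y)) has_derivative (\<lambda>v. f y * frechet_derivative \<rho> (at (z - y)) v)) (at z)"
        using has_derivative_mult_right by force
      then show ?thesis by (simp add: D[abs_def, symmetric] fun_eq_iff[symmetric])
    qed
    show "(\<lambda>y. f y * \<rho> (z - y)) integrable_on cbox a b" for z
      by (rule integrable_continuous[OF ci])
    show "continuous_on (UNIV \<times> cbox a b) (\<lambda>(x, y). D x y)" by (rule contD)
  qed
  have eq: "blinfun_apply (integral (cbox a b) (D z)) v
      = integral (cbox a b) (\<lambda>y. f y * frechet_derivative \<rho> (at (z - y)) v)" for z v
  proof -
    have "continuous_on (cbox a b) (D z)"
      using continuous_on_compose2[OF contD, of "cbox a b" "\<lambda>y. (z, y)"]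
      by (simp add: continuous_on_Pair image_subset_iff)
    then have "D z integrable_on cbox a b" by (rule integrable_continuous)
    then have "integral (cbox a b) (\<lambda>y. blinfun_apply (D z y) v) = blinfun_apply (integral (cbox a b) (D z)) v"
      by (rule blinfun_apply_integral[symmetric])
    then show ?thesis by (simp add: D)
  qed
  show ?case
  proof (rule Ck_on_SucI[OF open_UNIV L])
    show "Ck_on k UNIV (\<lambda>z. blinfun_apply (integral (cbox a b) (D z)) v)" for v
      unfolding eq by (rule Suc.IH) (use Suc.prems in simp)
  qed
qed

text \<open>
  The function \<open>h\<close> is a weighted average of \<open>f\<close> over balls of radius \<open>r\<close>. Two-sided bounds for \<open>f\<close>, and for
  differences of values of \<open>f\<close>, are inherited by averages; in this form bounds for the gradient of \<open>h\<close> follow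
  from bounds for difference quotients of a function \<open>f\<close> that need not be differentiable.
\<close>

lemma mollify:
  fixes f :: "'a::euclidean_space \<Rightarrow> real"
  assumes f: "continuous_on UNIV f" "\<And>x. x \<notin> cbox a b \<Longrightarrow> f x = 0" and "0 < r"
  obtains h where "smooth_on UNIV h"
    "\<And>z lo hi. (\<And>w. w \<in> ball z r \<Longrightarrow> lo \<le> f w \<and> f w \<le> hi) \<Longrightarrow> lo \<le> h z \<and> h z \<le> hi"
    "\<And>z v lo hi. (\<And>w. w \<in> ball z r \<Longrightarrow> lo \<le> f (w + v) - f w \<and> f (w + v) - f w \<le> hi)
       \<Longrightarrow> lo \<le> h (z + v) - h z \<and> h (z + v) - h z \<le> hi"
proof -
  define \<rho>0 :: "'a \<Rightarrow> real" where "\<rho>0 w = flat 0 (r\<^sup>2 - w \<bullet> w)" for w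
  have flat_pos: "flat 0 t > 0 \<longleftrightarrow> t > 0" "flat 0 t \<ge> 0" for t by (auto simp: flat_def)
  have lt: "r\<^sup>2 - w \<bullet> w > 0 \<longleftrightarrow> norm w < r" for w :: 'a
    using \<open>0 < r\<close> by (simp add: norm_lt_square)
  have \<rho>0_nonneg: "\<rho>0 w \<ge> 0" for w by (simp add: \<rho>0_def flat_pos)
  have \<rho>0_pos: "\<rho>0 w > 0 \<longleftrightarrow> norm w < r" for w using flat_pos lt by (simp add: \<rho>0_def)
  have sq: "smooth_on UNIV (\<lambda>w::'a. w \<bullet> w)"
    unfolding smooth_on_def
  proof
    fix k
    have "Ck_on (Suc k) UNIV (\<lambda>w::'a. w \<bullet> w)"
    proof (rule Ck_on_SucI[where f' = "\<lambda>w v. 2 * (w \<bullet> v)"])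
      show "((\<lambda>w. w \<bullet> w) has_derivative (\<lambda>v. 2 * (w \<bullet> v))) (at w)" for w :: 'a
        by (auto intro!: derivative_eq_intros simp: inner_commute)
      show "Ck_on k UNIV (\<lambda>w::'a. 2 * (w \<bullet> v))" for v
        by (intro Ck_on_mult Ck_on_const Ck_on_bounded_linear bounded_linear_inner_left) auto
    qed simp
    then show "Ck_on k UNIV (\<lambda>w::'a. w \<bullet> w)" by (rule Ck_on_Suc_imp)
  qed
  have smooth0: "smooth_on UNIV \<rho>0"
    unfolding \<rho>0_def[abs_def]
    by (rule smooth_on_compose_real[OF _ smooth_on_flat]) (auto intro: smooth_on_diff sq)
  have int: "integrable lborel (\<lambda>w. g w * \<rho>0 w)" if "continuous_on UNIV g" for g :: "'a \<Rightarrow> real"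
  proof -
    have "continuous_on (cball 0 r) (\<lambda>w. g w * \<rho>0 w)"
      using that smooth_on_imp_continuous_on[OF smooth0]
      by (auto intro!: continuous_intros intro: continuous_on_subset)
    then have "integrable lborel (\<lambda>w. indicator (cball 0 r) w *\<^sub>R (g w * \<rho>0 w))"
      by (intro borel_integrable_compact) auto
    moreover have "indicator (cball 0 r) w *\<^sub>R (g w * \<rho>0 w) = g w * \<rho>0 w" for w
      using \<rho>0_pos[of w] \<rho>0_nonneg[of w] by (auto simp: indicator_def order.order_iff_strict)
    ultimately show ?thesis by (simp only:)
  qed
  define c where "c = (LINT w|lborel. \<rho>0 w)"
  have "c > 0"
  proof -
    define m where "m = flat 0 (r\<^sup>2 - (r/2)\<^sup>2)"
    have "m > 0" using \<open>0 < r\<close> by (auto simp: m_def flat_pos power2_eq_square)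
    have mono: "flat 0 s \<le> flat 0 t" if "s \<le> t" for s t :: real
      using that by (auto simp: flat_def frac_le)
    have "m * indicator (ball 0 (r/2)) w \<le> \<rho>0 w" for w
    proof (cases "norm w < r/2")
      case True
      then have "w \<bullet> w \<le> (r/2)\<^sup>2" using power_mono[of "norm w" "r/2" 2] by (simp add: power2_norm_eq_inner)
      then show ?thesis using True by (auto simp: m_def \<rho>0_def intro!: mono)
    qed (use \<rho>0_nonneg in auto)
    moreover have "integrable lborel \<rho>0" using int[of "\<lambda>_. 1"] by simp
    ultimately have "(LINT w|lborel. m * indicator (ball (0::'a) (r/2)) w) \<le> c"
      unfolding c_def using emeasure_bounded_finite[OF bounded_ball, of "0::'a" "r/2"]
      by (intro integral_mono) (auto intro!: integrable_mult_right integrable_real_indicator)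
    moreover have "(LINT w|lborel. m * indicator (ball (0::'a) (r/2)) w) > 0"
      using \<open>m > 0\<close> content_ball_pos[of "r/2" "0::'a"] \<open>0 < r\<close> by simp
    ultimately show ?thesis by linarith
  qed
  define \<rho> where "\<rho> w = (1/c) * \<rho>0 w" for w
  have \<rho>: "\<rho> w \<ge> 0" "norm w \<ge> r \<Longrightarrow> \<rho> w = 0" for w
    using \<rho>0_nonneg[of w] \<rho>0_pos[of w] \<open>c > 0\<close> by (auto simp: \<rho>_def)
  have smooth: "smooth_on UNIV \<rho>" unfolding \<rho>_def[abs_def] by (intro smooth_on_cmult smooth0) auto
  have int\<rho>: "integrable lborel (\<lambda>w. g w * \<rho> w)" if "continuous_on UNIV g" for g :: "'a \<Rightarrow> real"
    using integrable_mult_right[OF int[OF that], of "1/c"] by (simp add: \<rho>_def mult.left_commute)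
  have one: "(LINT w|lborel. \<rho> w) = 1" using \<open>c > 0\<close> by (simp add: \<rho>_def c_def)
  define h where "h z = integral (cbox a b) (\<lambda>y. f y * \<rho> (z - y))" for z
  have "smooth_on UNIV h"
    using Ck_on_integral_translates[OF f(1)] smooth by (simp add: smooth_on_def h_def[abs_def])
  have cf: "continuous_on UNIV (\<lambda>w. f (z - w))" for z
    by (rule continuous_on_compose2[OF f(1)]) (auto intro!: continuous_intros)
  have h: "h z = (LINT w|lborel. f (z - w) * \<rho> w)" for z
  proof -
    have i: "integrable lborel (\<lambda>w. f (z - w) * \<rho> w)" by (rule int\<rho>[OF cf])
    have T: "distr lborel borel (\<lambda>y. z - y) = (lborel :: 'a measure)"
      using lborel_affine[of "-1" z] by (simp add: density_1)
    have m: "(\<lambda>w. f (z - w) * \<rho> w) \<in> borel_measurable borel"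
      using i by auto
    have "(LINT w|lborel. f (z - w) * \<rho> w) = (LINT w|distr lborel borel (\<lambda>y. z - y). f (z - w) * \<rho> w)"
      by (simp add: T)
    also have "\<dots> = (LINT y|lborel. f y * \<rho> (z - y))"
      by (subst integral_distr) (use m in auto)
    also have "\<dots> = integral UNIV (\<lambda>y. f y * \<rho> (z - y))"
    proof -
      have "integrable (distr lborel borel (\<lambda>y. z - y)) (\<lambda>w. f (z - w) * \<rho> w)" using i by (simp add: T)
      then have "integrable lborel (\<lambda>y. f y * \<rho> (z - y))"
        by (subst (asm) integrable_distr_eq) (use m in auto)
      then show ?thesis by (simp add: integral_lborel)
    qed
    also have "\<dots> = h z"
      unfolding h_def integral_restrict_UNIV[of "cbox a b", symmetric]
      by (rule arg_cong[of _ _ "integral UNIV"]) (use f(2) in auto)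
    finally show ?thesis ..
  qed
  \<comment> \<open>The kernel is nonnegative, vanishes outside the ball and has integral 1.\<close>
  have bounds: "lo \<le> (LINT w|lborel. g w * \<rho> w) \<and> (LINT w|lborel. g w * \<rho> w) \<le> hi"
    if "continuous_on UNIV g" "\<And>w. norm w < r \<Longrightarrow> lo \<le> g w \<and> g w \<le> hi" for g lo hi
  proof -
    have "lo * \<rho> w \<le> g w * \<rho> w \<and> g w * \<rho> w \<le> hi * \<rho> w" for w
      using that(2)[of w] \<rho>[of w] by (cases "norm w < r") (auto intro: mult_right_mono)
    note le = this
    have "(LINT w|lborel. lo * \<rho> w) \<le> (LINT w|lborel. g w * \<rho> w)"
      by (rule integral_mono[OF int\<rho>[OF continuous_on_const] int\<rho>[OF that(1)]]) (use le in blast)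
    moreover have "(LINT w|lborel. g w * \<rho> w) \<le> (LINT w|lborel. hi * \<rho> w)"
      by (rule integral_mono[OF int\<rho>[OF that(1)] int\<rho>[OF continuous_on_const]]) (use le in blast)
    ultimately show ?thesis using one by simp
  qed
  show thesis
  proof
    show "smooth_on UNIV h" by fact
    show "lo \<le> h z \<and> h z \<le> hi" if "\<And>w. w \<in> ball z r \<Longrightarrow> lo \<le> f w \<and> f w \<le> hi" for z lo hi
      unfolding h by (rule bounds[OF cf]) (rule that, simp add: dist_norm)
    show "lo \<le> h (z + v) - h z \<and> h (z + v) - h z \<le> hi"
      if H: "\<And>w. w \<in> ball z r \<Longrightarrow> lo \<le> f (w + v) - f w \<and> f (w + v) - f w \<le> hi" for z v lo hi
    proof -
      have "h (z + v) - h z = (LINT w|lborel. (f (z + v - w) - f (z - w)) * \<rho> w)"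
        unfolding h left_diff_distrib by (rule Bochner_Integration.integral_diff[symmetric]; rule int\<rho>[OF cf])
      moreover have "lo \<le> f (z + v - w) - f (z - w) \<and> f (z + v - w) - f (z - w) \<le> hi" if "norm w < r" for w
        using H[of "z - w"] that by (simp add: dist_norm algebra_simps)
      note bounds[OF continuous_on_diff[OF cf cf] this]
      ultimately show ?thesis by simp
    qed
  qed
qed

lemma frechet_derivative_pair:
  fixes f :: "real \<times> real \<Rightarrow> real"
  assumes "smooth_on UNIV f"
  shows "(f has_derivative (\<lambda>v. frechet_derivative f (at z) (1, 0) * fst v + frechet_derivative f (at z) (0, 1) * snd v)) (at z)"
proof -
  have d: "(f has_derivative frechet_derivative f (at z)) (at z)"
    using smooth_on_has_derivative[OF assms] by simp
  interpret bounded_linear "frechet_derivative f (at z)" using d has_derivative_bounded_linear by blast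
  have "frechet_derivative f (at z) v = frechet_derivative f (at z) (1, 0) * fst v + frechet_derivative f (at z) (0, 1) * snd v" for v
  proof -
    have "v = fst v *\<^sub>R (1, 0) + snd v *\<^sub>R (0, 1)" by (simp add: prod_eq_iff)
    then have "frechet_derivative f (at z) v = fst v *\<^sub>R frechet_derivative f (at z) (1, 0) + snd v *\<^sub>R frechet_derivative f (at z) (0, 1)"
      using add scaleR by metis
    then show ?thesis by (simp add: mult.commute)
  qed
  then have "frechet_derivative f (at z) = (\<lambda>v. frechet_derivative f (at z) (1, 0) * fst v + frechet_derivative f (at z) (0, 1) * snd v)"
    by (rule ext)
  with d show ?thesis by metis
qed

section \<open>Absolutely continuous functions\<close>

text \<open>
  Outer regularity of Lebesgue measure.
\<close>

lemma negligible_imp_small_open: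
  fixes N :: "real set"
  assumes "negligible N" "0 < e"
  obtains U where "open U" "N \<subseteq> U" "U \<in> lmeasurable" "measure lebesgue U < e"
proof -
  have "N \<in> sets lebesgue" using assms(1) negligible_imp_sets by blast
  then obtain T where T: "open T" "N \<subseteq> T" "T - N \<in> lmeasurable" "emeasure lebesgue (T - N) < ennreal e"
    using sets_lebesgue_outer_open[OF _ assms(2)] by metis
  have N: "N \<in> lmeasurable" "measure lebesgue N = 0" using assms(1) by (auto simp: negligible_iff_measure)
  have eq: "T = (T - N) \<union> N" using T by auto
  have "T \<in> lmeasurable" using T(3) N(1) eq by (metis fmeasurable.Un)
  moreover have "measure lebesgue T \<le> measure lebesgue (T - N) + measure lebesgue N"
    using T(3) N(1) eq measure_Un_le by (metis fmeasurableD)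
  moreover have "measure lebesgue (T - N) < e"
    using T(3,4) assms(2) by (simp add: emeasure_eq_measure2 ennreal_less_iff)
  ultimately show ?thesis using that T N(2) by force
qed

text \<open>
  The inverse \<open>X\<close> of \<open>s\<close> does not increase distances. Therefore the image of Lebesgue measure under \<open>s\<close>
  is absolutely continuous, \<open>X\<close> is an indefinite integral of its density \<open>g\<close>, and \<open>X\<close> is
  differentiable almost everywhere with derivative \<open>g\<close>. Null sets are mapped to null sets by \<open>X\<close>, so
  \<open>s\<close> is differentiable almost everywhere among the points \<open>x\<close> with \<open>g (s x) \<noteq> 0\<close>; the remaining points
  form a null set because its measure is the integral of \<open>g\<close> over the zeros of \<open>g\<close>.
\<close>

lemma expanding_imp_differentiable_ae:
  fixes s :: "real \<Rightarrow> real"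
  assumes cont: "continuous_on UNIV s" and expd: "\<And>x y. x \<le> y \<Longrightarrow> y - x \<le> s y - s x"
  shows "\<exists>N. negligible N \<and> (\<forall>x. x \<notin> N \<longrightarrow> s differentiable (at x))"
proof -
  have smono: "s x < s y" if "x < y" for x y using expd[of x y] that by linarith
  then have inj: "inj s" by (metis injI linorder_less_linear order_less_irrefl)
  have surj: "surj s"
    unfolding surj_def
  proof
    fix t
    define R where "R = \<bar>t - s 0\<bar>"
    have "s (- R) \<le> t" "t \<le> s R" using expd[of "-R" 0] expd[of 0 R] by (auto simp: R_def)
    then show "\<exists>x. t = s x" using IVT'[of s "-R" t R] cont
      by (metis R_def abs_ge_zero continuous_on_subset neg_le_0_iff_le order_trans top_greatest)
  qed
  define X where "X = inv s"
  have sX: "s (X t) = t" and Xs: "X (s x) = x" for t x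
    using surj inj by (auto simp: X_def surj_f_inv_f)
  have Xmono: "X p \<le> X q" if "p \<le> q" for p q
    using smono[of "X q" "X p"] sX that by (metis leI not_le)
  have Xlip: "X q - X p \<le> q - p" if "p \<le> q" for p q
    using expd[OF Xmono[OF that]] by (simp add: sX)
  have Xlip': "\<bar>X q - X p\<bar> \<le> \<bar>q - p\<bar>" for p q
    using Xlip[of p q] Xlip[of q p] Xmono[of p q] Xmono[of q p] by linarith
  have Xneg: "negligible (X ` M)" if "negligible M" for M
    by (rule negligible_locally_Lipschitz_image[OF _ that])
      (use Xlip' in \<open>auto intro!: exI[of _ "UNIV::real set"] exI[of _ "1::real"]\<close>)
  have vimage: "s -` A = X ` A" for A
    by (auto simp: image_iff sX) (metis Xs)
  have sm: "s \<in> borel_measurable borel" using cont by (rule borel_measurable_continuous_onI)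
  define \<nu> where "\<nu> = distr lborel borel s"
  have \<nu>: "emeasure \<nu> A = emeasure lborel (s -` A)" if "A \<in> sets borel" for A
    using that sm by (simp add: \<nu>_def emeasure_distr)
  have svb: "s -` A \<in> sets borel" if "A \<in> sets borel" for A
    using measurable_sets[OF sm that] by simp
  have ac: "absolutely_continuous lborel \<nu>"
    unfolding absolutely_continuous_def
  proof
    fix A :: "real set" assume A: "A \<in> null_sets lborel"
    then have "negligible A" by (meson negligible_iff_null_sets null_sets_completionI)
    then have "negligible (s -` A)" unfolding vimage by (rule Xneg)
    then have "emeasure lebesgue (s -` A) = 0" by (simp add: negligible_iff_null_sets null_setsD1)
    moreover have "s -` A \<in> sets lborel" using svb[of A] A by auto
    ultimately have "emeasure lborel (s -` A) = 0" by simp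
    then show "A \<in> null_sets \<nu>" using \<nu>[of A] A by (auto simp: null_sets_def \<nu>_def)
  qed
  obtain g where g [measurable]: "g \<in> borel_measurable lborel" and dg: "density lborel g = \<nu>"
    using sigma_finite_measure.Radon_Nikodym[OF sigma_finite_lborel ac] by (auto simp: \<nu>_def)
  have int_g: "(\<integral>\<^sup>+x. g x * indicator A x \<partial>lborel) = emeasure lborel (s -` A)" if "A \<in> sets borel" for A
    using that \<nu>[OF that] by (simp add: dg[symmetric] emeasure_density)
  have smono': "s x \<le> s y" if "x \<le> y" for x y using expd[OF that] that by linarith
  have "p \<le> s x \<longleftrightarrow> X p \<le> x" "s x \<le> q \<longleftrightarrow> x \<le> X q" for p q x
    using Xmono[of p "s x"] smono'[of "X p" x] Xmono[of "s x" q] smono'[of x "X q"] by (auto simp: sX Xs)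
  then have "s -` {p..q} = {X p..X q}" for p q by auto
  then have int_Icc: "(\<integral>\<^sup>+x. g x * indicator {p..q} x \<partial>lborel) = ennreal (X q - X p)" if "p \<le> q" for p q
    using int_g[of "{p..q}"] Xmono[OF that] by simp
  have fin: "AE x in lborel. g x \<noteq> \<infinity>"
  proof -
    have "AE x in lborel. g x * indicator {- real n..real n} x \<noteq> \<infinity>" for n
      by (rule nn_integral_PInf_AE) (simp_all add: int_Icc)
    then have "AE x in lborel. \<forall>n. g x * indicator {- real n..real n} x \<noteq> \<infinity>"
      by (simp add: AE_all_countable)
    then show ?thesis
    proof (rule AE_mp, intro AE_I2 impI)
      fix x assume H: "\<forall>n. g x * indicator {- real n..real n} x \<noteq> \<infinity>"
      obtain n where "\<bar>x\<bar> \<le> real n" using real_arch_simple by blast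
      then have "x \<in> {- real n..real n}" by auto
      with H show "g x \<noteq> \<infinity>" by (metis indicator_simps(1) mult.right_neutral)
    qed
  qed
  define g' where "g' x = enn2real (g x)" for x
  have g'm [measurable]: "g' \<in> borel_measurable borel" using g by (simp add: g'_def[abs_def])
  have hi: "(g' has_integral (X q - X p)) {p..q}" if "p \<le> q" for p q
  proof -
    have "(\<integral>\<^sup>+x. ennreal (g' x * indicator {p..q} x) \<partial>lborel) = (\<integral>\<^sup>+x. g x * indicator {p..q} x \<partial>lborel)"
      by (rule nn_integral_cong_AE, rule AE_mp[OF fin])
        (auto simp: g'_def indicator_def less_top intro!: AE_I2)
    then have "((\<lambda>x. g' x * indicator {p..q} x) has_integral (X q - X p)) UNIV"
      using int_Icc[OF that] Xmono[OF that]
      by (intro nn_integral_has_integral) (auto simp: g'_def)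
    then have "((\<lambda>x. if x \<in> {p..q} then g' x else 0) has_integral (X q - X p)) UNIV"
      by (rule has_integral_eq[rotated]) auto
    then show ?thesis by (simp only: has_integral_restrict_UNIV)
  qed
  then have io: "g' integrable_on cbox p q" for p q
    by (cases "p \<le> q") (auto simp: integrable_on_def)
  \<comment> \<open>The differentiation theorem for indefinite integrals is one-sided; applied to the
    reflected density it gives the derivative from the left.\<close>
  have hir: "((\<lambda>x. g' (- x)) has_integral (X (- p) - X (- q))) {p..q}" if "p \<le> q" for p q
  proof -
    have "(g' has_integral (X (- p) - X (- q))) {- q..- p}" using hi[of "-q" "-p"] that by simp
    then have "((\<lambda>x. g' (- x)) has_integral (X (- p) - X (- q))) {- (- p)..- (- q)}"
      by (simp only: has_integral_reflect_real)
    then show ?thesis by simp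
  qed
  then have ior: "(\<lambda>x. g' (- x)) integrable_on cbox p q" for p q
    by (cases "p \<le> q") (auto simp: integrable_on_def)
  obtain N1 where N1: "negligible N1"
    "\<And>x e. \<lbrakk>x \<notin> N1; 0 < e\<rbrakk> \<Longrightarrow> \<exists>d>0. \<forall>h. 0 < h \<and> h < d \<longrightarrow>
        norm (integral (cbox x (x + h *\<^sub>R One)) g' /\<^sub>R h ^ DIM(real) - g' x) < e"
    using integrable_ccontinuous_explicit[OF io] by metis
  obtain N2 where N2: "negligible N2"
    "\<And>x e. \<lbrakk>x \<notin> N2; 0 < e\<rbrakk> \<Longrightarrow> \<exists>d>0. \<forall>h. 0 < h \<and> h < d \<longrightarrow>
        norm (integral (cbox x (x + h *\<^sub>R One)) (\<lambda>x. g' (- x)) /\<^sub>R h ^ DIM(real) - g' (- x)) < e"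
    using integrable_ccontinuous_explicit[OF ior] by metis
  define M where "M = N1 \<union> uminus ` N2"
  have M: "negligible M"
    unfolding M_def
  proof (rule negligible_Un[OF N1(1)])
    show "negligible (uminus ` N2)"
      by (rule negligible_locally_Lipschitz_image[OF _ N2(1)])
        (auto simp: abs_minus_commute intro!: exI[of _ "UNIV::real set"] exI[of _ "1::real"])
  qed
  have Xd: "(X has_real_derivative g' t) (at t)" if "t \<notin> M" for t
    unfolding DERIV_def LIM_eq
  proof (intro allI impI)
    fix e :: real assume "0 < e"
    have "t \<notin> N1" "- t \<notin> N2" using that by (force simp: M_def)+
    obtain d1 where d1: "d1 > 0" "\<And>h::real. 0 < h \<Longrightarrow> h < d1 \<Longrightarrow> \<bar>integral {t..t + h} g' / h - g' t\<bar> < e"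
      using N1(2)[OF \<open>t \<notin> N1\<close> \<open>0 < e\<close>] by (auto simp: divide_inverse mult.commute)
    obtain d2 where d2: "d2 > 0"
      "\<And>h::real. 0 < h \<Longrightarrow> h < d2 \<Longrightarrow> \<bar>integral {- t..- t + h} (\<lambda>x. g' (- x)) / h - g' t\<bar> < e"
      using N2(2)[OF \<open>- t \<notin> N2\<close> \<open>0 < e\<close>] by (auto simp: divide_inverse mult.commute)
    have i1: "integral {t..t + h} g' = X (t + h) - X t" if "h > 0" for h :: real
      using hi[of t "t + h"] that by (simp add: integral_unique)
    have i2: "integral {- t..- t + h} (\<lambda>x. g' (- x)) = X t - X (t - h)" if "h > 0" for h :: real
      using hir[of "- t" "- t + h"] that by (simp add: integral_unique)
    show "\<exists>d>0. \<forall>h::real. h \<noteq> 0 \<and> norm (h - 0) < d \<longrightarrow> norm ((X (t + h) - X t) / h - g' t) < e"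
    proof (intro exI[of _ "min d1 d2"] conjI allI impI)
      fix h :: real assume h: "h \<noteq> 0 \<and> norm (h - 0) < min d1 d2"
      show "norm ((X (t + h) - X t) / h - g' t) < e"
      proof (cases "h > 0")
        case True
        then show ?thesis using d1(2)[of h] i1[of h] h by simp
      next
        case False
        then have "- h > 0" using h by simp
        then have "\<bar>(X t - X (t + h)) / (- h) - g' t\<bar> < e" using d2(2)[of "- h"] i2[of "- h"] h by simp
        moreover have "(X t - X (t + h)) / (- h) = (X (t + h) - X t) / h" by (metis minus_diff_eq minus_divide_divide)
        ultimately show ?thesis by simp
      qed
    qed (use d1 d2 in auto)
  qed
  define Z where "Z = {t. g' t = 0}"
  have Zb: "Z \<in> sets borel" unfolding Z_def by measurable
  have "(\<integral>\<^sup>+x. g x * indicator Z x \<partial>lborel) = (\<integral>\<^sup>+x. 0 \<partial>(lborel::real measure))"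
    by (rule nn_integral_cong_AE, rule AE_mp[OF fin])
      (auto simp: Z_def g'_def enn2real_eq_0_iff indicator_def intro!: AE_I2)
  then have "emeasure lborel (s -` Z) = 0" using int_g[OF Zb] by simp
  then have Zneg: "negligible (s -` Z)"
    using svb[OF Zb] by (auto simp: negligible_iff_null_sets intro!: null_sets_completionI null_setsI)
  show ?thesis
  proof (intro exI[of _ "X ` M \<union> s -` Z"] conjI allI impI)
    show "negligible (X ` M \<union> s -` Z)" using Xneg[OF M] Zneg by simp
    fix x assume "x \<notin> X ` M \<union> s -` Z"
    then have "X (s x) \<notin> X ` M" "g' (s x) \<noteq> 0" by (auto simp: Xs Z_def)
    then have "s x \<notin> M" by blast
    note \<open>s x \<notin> M\<close> \<open>g' (s x) \<noteq> 0\<close>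
    then have "DERIV s x :> inverse (g' (s x))"
      using Xs cont by (intro DERIV_inverse_function[where f = X and a = "x - 1" and b = "x + 1"] Xd)
        (auto simp: continuous_on_eq_continuous_at Xd)
    then show "s differentiable (at x)" using real_differentiable_def by blast
  qed
qed

lemma sum_lengths_le_measure:
  fixes l r :: "'i \<Rightarrow> real"
  assumes "finite I" "disjoint_family_on (\<lambda>i. {l i<..<r i}) I" "\<And>i. i \<in> I \<Longrightarrow> l i \<le> r i"
    "\<And>i. i \<in> I \<Longrightarrow> {l i<..<r i} \<subseteq> U" "U \<in> lmeasurable"
  shows "(\<Sum>i\<in>I. r i - l i) \<le> measure lebesgue U"
proof -
  have "(\<Sum>i\<in>I. r i - l i) = (\<Sum>i\<in>I. measure lebesgue {l i<..<r i})"
    using assms(3) by (intro sum.cong) auto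
  also have "\<dots> = measure lebesgue (\<Union>i\<in>I. {l i<..<r i})"
    by (rule measure_finite_Union[symmetric]) (use assms in auto)
  also have "\<dots> \<le> measure lebesgue U"
    by (rule measure_mono_fmeasurable) (use assms in auto)
  finally show ?thesis .
qed

lemma abs_continuous_onE:
  assumes "abs_continuous_on a b u" "0 < \<epsilon>"
  obtains \<delta> where "\<delta> > 0" "\<And>(n::nat) l r. (\<forall>i<n. a \<le> l i \<and> l i \<le> r i \<and> r i \<le> b) \<Longrightarrow>
      disjoint_family_on (\<lambda>i. {l i<..<r i}) {..<n} \<Longrightarrow>
      (\<Sum>i<n. r i - l i) < \<delta> \<Longrightarrow> (\<Sum>i<n. \<bar>u (r i) - u (l i)\<bar>) < \<epsilon>"
proof -
  note spec[OF assms(1)[unfolded abs_continuous_on_def], of \<epsilon>]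
  from mp[OF this assms(2)] show thesis
    by (elim exE conjE) (rule that, assumption, blast)
qed

text \<open>
  With \<open>V\<close> the total variation of \<open>f\<close> from \<open>a\<close>, the function \<open>f\<close> is the difference of the two
  continuous expanding functions \<open>x + V x\<close> and \<open>x + V x - f x\<close>.
\<close>

lemma abs_continuous_on_differentiable_ae:
  assumes ac: "abs_continuous_on a b f" and "a \<le> b"
  shows "\<exists>N. negligible N \<and> (\<forall>x\<in>{a<..<b} - N. f differentiable (at x))"
proof -
  \<comment> \<open>The sums whose supremum is the variation of f between x and y.\<close>
  define W where "W x y = {(\<Sum>i<n. \<bar>f (r i) - f (l i)\<bar>) | (n::nat) l r.
      (\<forall>i<n. x \<le> l i \<and> l i \<le> r i \<and> r i \<le> y) \<and> disjoint_family_on (\<lambda>i. {l i<..<r i}) {..<n}}" for x y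
  have zero: "0 \<in> W x y" for x y
    unfolding W_def by (intro CollectI exI[of _ 0] exI[of _ "\<lambda>_. 0"]) (auto simp: disjoint_family_on_def)
  have small: "\<exists>\<delta>>0. \<forall>x y w. a \<le> x \<longrightarrow> x \<le> y \<longrightarrow> y \<le> b \<longrightarrow> y - x < \<delta> \<longrightarrow> w \<in> W x y \<longrightarrow> w < \<epsilon>" if eps: "\<epsilon> > 0" for \<epsilon>
  proof -
    obtain \<delta> where \<delta>: "\<delta> > 0" "\<And>(n::nat) l r. (\<forall>i<n. a \<le> l i \<and> l i \<le> r i \<and> r i \<le> b) \<Longrightarrow>
        disjoint_family_on (\<lambda>i. {l i<..<r i}) {..<n} \<Longrightarrow>
        (\<Sum>i<n. r i - l i) < \<delta> \<Longrightarrow> (\<Sum>i<n. \<bar>f (r i) - f (l i)\<bar>) < \<epsilon>"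
      by (rule abs_continuous_onE[OF ac eps]) (erule that, blast)
    show ?thesis
    proof (intro exI[of _ \<delta>] conjI allI impI \<delta>(1))
      fix x y w assume H: "a \<le> x" "x \<le> y" "y \<le> b" "y - x < \<delta>" "w \<in> W x y"
      obtain n :: nat and l r where w: "w = (\<Sum>i<n. \<bar>f (r i) - f (l i)\<bar>)"
        "\<forall>i<n. x \<le> l i \<and> l i \<le> r i \<and> r i \<le> y" "disjoint_family_on (\<lambda>i. {l i<..<r i}) {..<n}"
        using H(5) unfolding W_def by blast
      have "(\<Sum>i<n. r i - l i) \<le> measure lebesgue {x..y}"
        by (rule sum_lengths_le_measure) (use w in force)+
      then have "(\<Sum>i<n. r i - l i) < \<delta>" using H by simp
      then show "w < \<epsilon>" unfolding w(1) using w H by (intro \<delta>(2)) force+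
    qed
  qed
  have split: "\<exists>w1\<in>W a x. \<exists>w2\<in>W x y. w \<le> w1 + w2" if "a \<le> x" "x \<le> y" and wW: "w \<in> W a y" for x y w
  proof -
    obtain n :: nat and l r where w: "w = (\<Sum>i<n. \<bar>f (r i) - f (l i)\<bar>)"
      "\<forall>i<n. a \<le> l i \<and> l i \<le> r i \<and> r i \<le> y" "disjoint_family_on (\<lambda>i. {l i<..<r i}) {..<n}"
      using wW unfolding W_def by blast
    define w1 where "w1 = (\<Sum>i<n. \<bar>f (min (r i) x) - f (min (l i) x)\<bar>)"
    define w2 where "w2 = (\<Sum>i<n. \<bar>f (max (r i) x) - f (max (l i) x)\<bar>)"
    have "w1 \<in> W a x"
      unfolding W_def w1_def
    proof (intro CollectI exI conjI)
      show "disjoint_family_on (\<lambda>i. {min (l i) x<..<min (r i) x}) {..<n}"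
        using w(3) by (fastforce simp: disjoint_family_on_def)
    qed (use w(2) that(1) in \<open>auto simp: min_def\<close>)
    moreover have "w2 \<in> W x y"
      unfolding W_def w2_def
    proof (intro CollectI exI conjI)
      show "disjoint_family_on (\<lambda>i. {max (l i) x<..<max (r i) x}) {..<n}"
        using w(3) by (fastforce simp: disjoint_family_on_def)
    qed (use w(2) that(2) in \<open>auto simp: max_def\<close>)
    moreover have "w \<le> w1 + w2"
      unfolding w(1) w1_def w2_def sum.distrib[symmetric]
    proof (rule sum_mono)
      fix i assume "i \<in> {..<n}"
      then have "l i \<le> r i" using w by auto
      then show "\<bar>f (r i) - f (l i)\<bar> \<le> \<bar>f (min (r i) x) - f (min (l i) x)\<bar> + \<bar>f (max (r i) x) - f (max (l i) x)\<bar>"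
        by (auto simp: min_def max_def)
    qed
    ultimately show ?thesis by blast
  qed
  have append: "w + \<bar>f y - f x\<bar> \<in> W a y" if "a \<le> x" "x \<le> y" and wW: "w \<in> W a x" for x y w
  proof -
    obtain n :: nat and l r where w: "w = (\<Sum>i<n. \<bar>f (r i) - f (l i)\<bar>)"
      "\<forall>i<n. a \<le> l i \<and> l i \<le> r i \<and> r i \<le> x" "disjoint_family_on (\<lambda>i. {l i<..<r i}) {..<n}"
      using wW unfolding W_def by blast
    show ?thesis
      unfolding W_def
    proof (intro CollectI exI conjI)
      show "w + \<bar>f y - f x\<bar> = (\<Sum>i<Suc n. \<bar>f ((r(n := y)) i) - f ((l(n := x)) i)\<bar>)"
        by (simp add: w(1))
      show "\<forall>i<Suc n. a \<le> (l(n := x)) i \<and> (l(n := x)) i \<le> (r(n := y)) i \<and> (r(n := y)) i \<le> y"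
        using w(2) that by (auto simp: less_Suc_eq)
      show "disjoint_family_on (\<lambda>i. {(l(n := x)) i<..<(r(n := y)) i}) {..<Suc n}"
        using w(2,3) by (fastforce simp: disjoint_family_on_def less_Suc_eq)
    qed
  qed
  \<comment> \<open>Absolute continuity bounds the variation by 1 on intervals of some fixed length; the
    interval from a to x is exhausted by finitely many of them.\<close>
  have bdd: "bdd_above (W a x)" if "a \<le> x" "x \<le> b" for x
  proof -
    obtain \<delta> where \<delta>: "\<delta> > 0" "\<And>x y w. a \<le> x \<Longrightarrow> x \<le> y \<Longrightarrow> y \<le> b \<Longrightarrow> y - x < \<delta> \<Longrightarrow> w \<in> W x y \<Longrightarrow> w < 1"
      using small[of 1] by auto
    have "\<forall>x. a \<le> x \<and> x \<le> b \<and> x \<le> a + real n * (\<delta> / 2) \<longrightarrow> (\<forall>w\<in>W a x. w \<le> real n + 1)" for n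
    proof (induction n)
      case 0
      then show ?case using \<delta> by force
    next
      case (Suc n)
      show ?case
      proof (intro allI impI ballI)
        fix x w assume x: "a \<le> x \<and> x \<le> b \<and> x \<le> a + real (Suc n) * (\<delta> / 2)" and w: "w \<in> W a x"
        define z where "z = max a (x - \<delta> / 2)"
        have z: "a \<le> z" "z \<le> x" "z \<le> b" "x - z < \<delta>" "z \<le> a + real n * (\<delta> / 2)"
          using x \<delta>(1) by (auto simp: z_def max_def field_simps)
        obtain w1 w2 where "w1 \<in> W a z" "w2 \<in> W z x" "w \<le> w1 + w2" using split z w by blast
        moreover have "w1 \<le> real n + 1" using Suc z \<open>w1 \<in> W a z\<close> by blast
        moreover have "w2 < 1" using \<delta>(2)[of z x w2] z x \<open>w2 \<in> W z x\<close> by blast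
        ultimately show "w \<le> real (Suc n) + 1" by simp
      qed
    qed
    moreover obtain n where "(x - a) / (\<delta> / 2) \<le> real n" using real_arch_simple by blast
    ultimately show ?thesis using that \<delta>(1)
      by (intro bdd_aboveI[of _ "real n + 1"]) (auto simp: field_simps)
  qed
  define V where "V x = Sup (W a x)" for x
  have V1: "V x + \<bar>f y - f x\<bar> \<le> V y" if "a \<le> x" "x \<le> y" "y \<le> b" for x y
  proof -
    have "V x \<le> V y - \<bar>f y - f x\<bar>"
      unfolding V_def
    proof (rule cSup_least)
      show "W a x \<noteq> {}" using zero by blast
      show "w \<le> Sup (W a y) - \<bar>f y - f x\<bar>" if "w \<in> W a x" for w
        using cSup_upper[OF append[OF \<open>a \<le> x\<close> \<open>x \<le> y\<close> that] bdd] \<open>a \<le> x\<close> \<open>x \<le> y\<close> \<open>y \<le> b\<close> by simp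
    qed
    then show ?thesis by simp
  qed
  have V2: "\<exists>\<delta>>0. \<forall>x y. a \<le> x \<longrightarrow> x \<le> y \<longrightarrow> y \<le> b \<longrightarrow> y - x < \<delta> \<longrightarrow> V y \<le> V x + \<epsilon>" if eps: "\<epsilon> > 0" for \<epsilon>
  proof -
    obtain \<delta> where \<delta>: "\<delta> > 0" "\<And>x y w. a \<le> x \<Longrightarrow> x \<le> y \<Longrightarrow> y \<le> b \<Longrightarrow> y - x < \<delta> \<Longrightarrow> w \<in> W x y \<Longrightarrow> w < \<epsilon>"
      using small[OF eps] by auto
    have "V y \<le> V x + \<epsilon>" if H: "a \<le> x" "x \<le> y" "y \<le> b" "y - x < \<delta>" for x y
      unfolding V_def[of y]
    proof (rule cSup_least)
      show "W a y \<noteq> {}" using zero by blast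
      fix w assume "w \<in> W a y"
      then obtain w1 w2 where "w1 \<in> W a x" "w2 \<in> W x y" "w \<le> w1 + w2" using split H by blast
      moreover have "w1 \<le> V x" unfolding V_def using \<open>w1 \<in> W a x\<close> bdd H by (intro cSup_upper) auto
      moreover have "w2 < \<epsilon>" using \<delta>(2)[OF H] \<open>w2 \<in> W x y\<close> by blast
      ultimately show "w \<le> V x + \<epsilon>" by linarith
    qed
    then show ?thesis using \<delta>(1) by blast
  qed
  define c where "c x = max a (min b x)" for x
  have c: "a \<le> c x" "c x \<le> b" "x \<le> y \<Longrightarrow> c x \<le> c y" "\<bar>c x - c y\<bar> \<le> \<bar>x - y\<bar>" for x y
    using \<open>a \<le> b\<close> by (auto simp: c_def)
  have Vc: "\<exists>\<delta>>0. \<forall>x y. \<bar>x - y\<bar> < \<delta> \<longrightarrow> \<bar>V (c x) - V (c y)\<bar> \<le> \<epsilon>" if eps: "\<epsilon> > 0" for \<epsilon>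
  proof -
    obtain \<delta> where \<delta>: "\<delta> > 0" "\<And>x y. a \<le> x \<Longrightarrow> x \<le> y \<Longrightarrow> y \<le> b \<Longrightarrow> y - x < \<delta> \<Longrightarrow> V y \<le> V x + \<epsilon>"
      using V2[OF eps] by auto
    have "\<bar>V (c x) - V (c y)\<bar> \<le> \<epsilon>" if "\<bar>x - y\<bar> < \<delta>" for x y
    proof (cases "x \<le> y")
      case True
      then show ?thesis using \<delta>(2)[of "c x" "c y"] V1[of "c x" "c y"] c(1,2)[of x] c(1,2)[of y] c(3)[of x y] c(4)[of x y] that
        by linarith
    next
      case False
      then show ?thesis using \<delta>(2)[of "c y" "c x"] V1[of "c y" "c x"] c(1,2)[of x] c(1,2)[of y] c(3)[of y x] c(4)[of x y] that
        by linarith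
    qed
    then show ?thesis using \<delta>(1) by blast
  qed
  have fV: "\<bar>f (c x) - f (c y)\<bar> \<le> \<bar>V (c x) - V (c y)\<bar>" for x y
  proof (cases "x \<le> y")
    case True
    then show ?thesis using V1[of "c x" "c y"] c(1,2)[of x] c(1,2)[of y] c(3)[of x y] by linarith
  next
    case False
    then show ?thesis using V1[of "c y" "c x"] c(1,2)[of x] c(1,2)[of y] c(3)[of y x] by linarith
  qed
  have cont: "continuous_on UNIV h" if "\<And>x y. \<bar>h x - h y\<bar> \<le> \<bar>V (c x) - V (c y)\<bar>" for h :: "real \<Rightarrow> real"
    unfolding continuous_on_iff dist_real_def
  proof (intro ballI allI impI)
    fix x e :: real assume "0 < e"
    then obtain \<delta> where \<delta>: "\<delta> > 0" "\<forall>x y. \<bar>x - y\<bar> < \<delta> \<longrightarrow> \<bar>V (c x) - V (c y)\<bar> \<le> e / 2" using Vc[of "e / 2"] by auto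
    have "\<bar>h x' - h x\<bar> < e" if "\<bar>x' - x\<bar> < \<delta>" for x'
    proof -
      have "\<bar>V (c x') - V (c x)\<bar> \<le> e / 2" using that \<delta>(2) by blast
      then show ?thesis using \<open>0 < e\<close> \<open>\<And>x y. \<bar>h x - h y\<bar> \<le> \<bar>V (c x) - V (c y)\<bar>\<close>[of x' x] by linarith
    qed
    then show "\<exists>d>0. \<forall>x'\<in>UNIV. \<bar>x' - x\<bar> < d \<longrightarrow> \<bar>h x' - h x\<bar> < e" using \<delta>(1) by blast
  qed
  have contV: "continuous_on UNIV (\<lambda>x. V (c x))" by (rule cont) simp
  have contf: "continuous_on UNIV (\<lambda>x. f (c x))" by (rule cont[OF fV])
  have e: "\<bar>f (c y) - f (c x)\<bar> \<le> V (c y) - V (c x)" if "x \<le> y" for x y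
    using V1[of "c x" "c y"] c(1,2)[of x] c(1,2)[of y] c(3)[OF that] by linarith
  define s1 where "s1 x = x + V (c x)" for x
  define s2 where "s2 x = x + V (c x) - f (c x)" for x
  have "continuous_on UNIV s1" "continuous_on UNIV s2"
    unfolding s1_def[abs_def] s2_def[abs_def] by (intro continuous_intros contV contf)+
  moreover have "y - x \<le> s1 y - s1 x" "y - x \<le> s2 y - s2 x" if "x \<le> y" for x y
    using e[OF that] by (auto simp: s1_def s2_def)
  ultimately obtain N1 N2 where N: "negligible N1" "\<forall>x. x \<notin> N1 \<longrightarrow> s1 differentiable (at x)"
      "negligible N2" "\<forall>x. x \<notin> N2 \<longrightarrow> s2 differentiable (at x)"
    using expanding_imp_differentiable_ae by metis
  show ?thesis
  proof (intro exI[of _ "N1 \<union> N2"] conjI ballI)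
    fix x assume x: "x \<in> {a<..<b} - (N1 \<union> N2)"
    then have "(\<lambda>x. s1 x - s2 x) differentiable (at x)" using N by (intro differentiable_diff) auto
    then obtain D where "((\<lambda>x. s1 x - s2 x) has_derivative D) (at x)" by (auto simp: differentiable_def)
    then have "(f has_derivative D) (at x)"
      by (rule has_derivative_transform_within_open[of _ _ _ _ "{a<..<b}"])
        (use x in \<open>auto simp: s1_def s2_def c_def\<close>)
    then show "f differentiable (at x)" by (auto simp: differentiable_def)
  qed (use N in auto)
qed

text \<open>
  A proof with gauges. Intervals tagged outside \<open>N\<close> are made so short that the increment of \<open>f\<close> is at
  most \<open>(g x + \<epsilon>)\<close> times the length; intervals tagged in \<open>N\<close> are kept inside an open set so
  small that, by absolute continuity, the increments of \<open>f\<close> over them sum to less than \<open>\<epsilon>\<close>.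
\<close>

lemma abs_continuous_on_increment_le_integral:
  assumes ac: "abs_continuous_on a b f" and "a \<le> b"
    and I: "(g has_integral I) {a..b}" and N: "negligible N"
    and der: "\<And>x. x \<in> {a..b} - N \<Longrightarrow> \<exists>D. (f has_real_derivative D) (at x within {a..b}) \<and> D \<le> g x"
  shows "f b - f a \<le> I"
proof -
  have "f b - f a \<le> I + \<epsilon> * (2 + (b - a))" if eps: "\<epsilon> > 0" for \<epsilon>
  proof -
    \<comment> \<open>Changing g to 0 on N keeps the integral and removes the tags in N from the Riemann sums.\<close>
    define g0 where "g0 x = (if x \<in> N then 0 else g x)" for x
    have "(g0 has_integral I) {a..b}"
      by (rule has_integral_spike[OF N _ I]) (auto simp: g0_def)
    then have "\<forall>e>0. \<exists>\<gamma>. gauge \<gamma> \<and> (\<forall>p. p tagged_division_of {a..b} \<and> \<gamma> fine p \<longrightarrow>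
        norm ((\<Sum>(x, k)\<in>p. measure lborel k *\<^sub>R g0 x) - I) < e)"
      by (simp only: has_integral_real)
    from mp[OF spec[OF this] eps] obtain \<gamma>1
      where g1: "gauge \<gamma>1 \<and> (\<forall>p. p tagged_division_of {a..b} \<and> \<gamma>1 fine p \<longrightarrow>
        norm ((\<Sum>(x, k)\<in>p. measure lborel k *\<^sub>R g0 x) - I) < \<epsilon>)" ..
    note \<gamma>1g = conjunct1[OF g1]
    have \<gamma>1: "norm ((\<Sum>(x, k)\<in>p. measure lborel k *\<^sub>R g0 x) - I) < \<epsilon>"
      if "p tagged_division_of {a..b}" "\<gamma>1 fine p" for p
      using mp[OF spec[OF conjunct2[OF g1], of p] conjI[OF that]] .
    obtain \<delta> where \<delta>: "\<delta> > 0" "\<And>(n::nat) l r. (\<forall>i<n. a \<le> l i \<and> l i \<le> r i \<and> r i \<le> b) \<Longrightarrow>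
        disjoint_family_on (\<lambda>i. {l i<..<r i}) {..<n} \<Longrightarrow>
        (\<Sum>i<n. r i - l i) < \<delta> \<Longrightarrow> (\<Sum>i<n. \<bar>f (r i) - f (l i)\<bar>) < \<epsilon>"
      by (rule abs_continuous_onE[OF ac eps]) (erule that, blast)
    obtain U where U: "open U" "N \<subseteq> U" "U \<in> lmeasurable" "measure lebesgue U < \<delta>"
      by (rule negligible_imp_small_open[OF N \<delta>(1)])
    have "\<exists>d>0. \<forall>y\<in>{a..b}. \<bar>y - x\<bar> < d \<longrightarrow>
        (x \<le> y \<longrightarrow> f y - f x \<le> (g x + \<epsilon>) * (y - x)) \<and> (y \<le> x \<longrightarrow> f x - f y \<le> (g x + \<epsilon>) * (x - y))"
      if "x \<in> {a..b} - N" for x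
    proof -
      obtain D where D: "(f has_real_derivative D) (at x within {a..b})" "D \<le> g x" using der[OF \<open>x \<in> {a..b} - N\<close>] by blast
      obtain d where d: "d > 0" "\<And>y. y \<in> {a..b} \<Longrightarrow> \<bar>y - x\<bar> < d \<Longrightarrow> \<bar>f y - f x - D * (y - x)\<bar> \<le> \<epsilon> * \<bar>y - x\<bar>"
        using D(1) \<open>\<epsilon> > 0\<close> unfolding has_field_derivative_def has_derivative_within_alt by (auto simp: norm_mult)
      have "(x \<le> y \<longrightarrow> f y - f x \<le> (g x + \<epsilon>) * (y - x)) \<and> (y \<le> x \<longrightarrow> f x - f y \<le> (g x + \<epsilon>) * (x - y))"
        if y: "y \<in> {a..b}" "\<bar>y - x\<bar> < d" for y
      proof (intro conjI impI)
        assume "x \<le> y"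
        have "D * (y - x) \<le> g x * (y - x)" using D(2) \<open>x \<le> y\<close> by (intro mult_right_mono) auto
        then show "f y - f x \<le> (g x + \<epsilon>) * (y - x)" using d(2)[OF y] \<open>x \<le> y\<close> by (simp add: algebra_simps abs_le_iff)
      next
        assume "y \<le> x"
        have "D * (x - y) \<le> g x * (x - y)" using D(2) \<open>y \<le> x\<close> by (intro mult_right_mono) auto
        then show "f x - f y \<le> (g x + \<epsilon>) * (x - y)" using d(2)[OF y] \<open>y \<le> x\<close> by (simp add: algebra_simps abs_le_iff)
      qed
      then show ?thesis using d(1) by blast
    qed
    then obtain d where d: "\<And>x. x \<in> {a..b} - N \<Longrightarrow> d x > 0"
      "\<And>x y. x \<in> {a..b} - N \<Longrightarrow> y \<in> {a..b} \<Longrightarrow> \<bar>y - x\<bar> < d x \<Longrightarrow>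
        (x \<le> y \<longrightarrow> f y - f x \<le> (g x + \<epsilon>) * (y - x)) \<and> (y \<le> x \<longrightarrow> f x - f y \<le> (g x + \<epsilon>) * (x - y))"
      by metis
    define \<gamma> where "\<gamma> x = \<gamma>1 x \<inter> (if x \<in> N then U else if x \<in> {a..b} then ball x (d x) else UNIV)" for x
    have "gauge \<gamma>"
      using \<gamma>1g U(1,2) d(1) unfolding gauge_def \<gamma>_def by auto
    then obtain p where p: "p tagged_division_of {a..b}" "\<gamma> fine p"
      using fine_division_exists_real by blast
    have fin: "finite p" using p(1) by auto
    have k: "x \<in> k \<and> k \<subseteq> {a..b} \<and> k = {Inf k..Sup k} \<and> Inf k \<le> Sup k \<and> measure lborel k = Sup k - Inf k"
      if xk: "(x, k) \<in> p" for x k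
    proof -
      obtain u v where "k = cbox u v" using tagged_division_ofD(4)[OF p(1) xk] by blast
      moreover have "x \<in> k" "k \<subseteq> {a..b}" using tagged_division_ofD(2,3)[OF p(1) xk] by auto
      ultimately show ?thesis by auto
    qed
    define pN where "pN = {(x, k) \<in> p. x \<in> N}"
    have pN: "pN \<subseteq> p" "finite pN" using fin by (auto simp: pN_def intro: finite_subset)
    have lenN: "(\<Sum>i\<in>pN. Sup (snd i) - Inf (snd i)) \<le> measure lebesgue U"
    and disjN: "disjoint_family_on (\<lambda>i. {Inf (snd i)<..<Sup (snd i)}) pN"
    proof -
      show dj: "disjoint_family_on (\<lambda>i. {Inf (snd i)<..<Sup (snd i)}) pN"
        unfolding disjoint_family_on_def
      proof (intro ballI impI)
        fix i j assume ij: "i \<in> pN" "j \<in> pN" "i \<noteq> j"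
        obtain x k x' k' where e: "i = (x, k)" "j = (x', k')" by fastforce
        have "interior k \<inter> interior k' = {}"
          by (rule tagged_division_ofD(5)[OF p(1)]) (use ij e pN in auto)
        moreover have "interior k = {Inf k<..<Sup k}" "interior k' = {Inf k'<..<Sup k'}"
          using k[of x k] k[of x' k'] ij e pN(1) interior_atLeastAtMost_real by (metis subsetD)+
        ultimately show "{Inf (snd i)<..<Sup (snd i)} \<inter> {Inf (snd j)<..<Sup (snd j)} = {}" by (simp add: e)
      qed
      show "(\<Sum>i\<in>pN. Sup (snd i) - Inf (snd i)) \<le> measure lebesgue U"
      proof (rule sum_lengths_le_measure[OF pN(2) dj])
        fix i assume i: "i \<in> pN"
        obtain x y where e: "i = (x, y)" by fastforce
        have "(x, y) \<in> p" "x \<in> N" using i e by (auto simp: pN_def)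
        then have "y \<subseteq> U" using fineD[OF p(2) \<open>(x, y) \<in> p\<close>] by (simp add: \<gamma>_def)
        moreover have "{Inf y<..<Sup y} \<subseteq> y"
          using k[OF \<open>(x, y) \<in> p\<close>] by (metis greaterThanLessThan_subseteq_atLeastAtMost_iff order_refl)
        ultimately show "{Inf (snd i)<..<Sup (snd i)} \<subseteq> U" by (auto simp: e)
        show "Inf (snd i) \<le> Sup (snd i)" using k[OF \<open>(x, y) \<in> p\<close>] by (simp add: e)
      qed (use U in auto)
    qed
    have sN: "(\<Sum>i\<in>pN. \<bar>f (Sup (snd i)) - f (Inf (snd i))\<bar>) < \<epsilon>"
    proof -
      obtain h where h: "bij_betw h {..<card pN} pN"
        using ex_bij_betw_nat_finite[OF pN(2)] by (auto simp: lessThan_atLeast0)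
      have hin: "h i \<in> pN" if "i < card pN" for i using h that by (auto simp: bij_betw_def)
      have "(\<Sum>i<card pN. \<bar>f (Sup (snd (h i))) - f (Inf (snd (h i)))\<bar>) < \<epsilon>"
      proof (rule \<delta>(2))
        show "\<forall>i<card pN. a \<le> Inf (snd (h i)) \<and> Inf (snd (h i)) \<le> Sup (snd (h i)) \<and> Sup (snd (h i)) \<le> b"
        proof (intro allI impI)
          fix i assume "i < card pN"
          then obtain x y where e: "h i = (x, y)" "(x, y) \<in> p" using hin pN(1) by (metis surj_pair subsetD)
          have "Inf y \<in> y" "Sup y \<in> y" using k[OF e(2)] by (metis atLeastAtMost_iff order_refl)+
          then show "a \<le> Inf (snd (h i)) \<and> Inf (snd (h i)) \<le> Sup (snd (h i)) \<and> Sup (snd (h i)) \<le> b"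
            using k[OF e(2)] by (auto simp: e(1))
        qed
        show "disjoint_family_on (\<lambda>i. {Inf (snd (h i))<..<Sup (snd (h i))}) {..<card pN}"
          using disjN h unfolding disjoint_family_on_def bij_betw_def inj_on_def by (metis hin lessThan_iff)
        have "(\<Sum>i<card pN. Sup (snd (h i)) - Inf (snd (h i))) = (\<Sum>i\<in>pN. Sup (snd i) - Inf (snd i))"
          by (rule sum.reindex_bij_betw[OF h])
        then show "(\<Sum>i<card pN. Sup (snd (h i)) - Inf (snd (h i))) < \<delta>" using lenN U(4) by linarith
      qed
      also have "(\<Sum>i<card pN. \<bar>f (Sup (snd (h i))) - f (Inf (snd (h i)))\<bar>)
          = (\<Sum>i\<in>pN. \<bar>f (Sup (snd i)) - f (Inf (snd i))\<bar>)"
        by (rule sum.reindex_bij_betw[OF h])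
      finally show ?thesis .
    qed
    have each: "f (Sup (snd i)) - f (Inf (snd i))
        \<le> measure lborel (snd i) * g0 (fst i) + \<epsilon> * measure lborel (snd i) + (if i \<in> pN then \<bar>f (Sup (snd i)) - f (Inf (snd i))\<bar> else 0)"
      if "i \<in> p" for i
    proof -
      obtain x y where e: "i = (x, y)" by fastforce
      then have xy: "(x, y) \<in> p" using that by simp
      show ?thesis
      proof (cases "x \<in> N")
        case True
        then have "i \<in> pN" using xy e by (auto simp: pN_def)
        moreover have "0 \<le> \<epsilon> * measure lborel y" using \<open>\<epsilon> > 0\<close> by simp
        ultimately show ?thesis using True by (simp add: e g0_def)
      next
        case False
        then have x: "x \<in> {a..b} - N" "i \<notin> pN" using k[OF xy] e by (auto simp: pN_def)
        have yb: "y \<subseteq> ball x (d x)" using fineD[OF p(2) xy] x(1) by (auto simp: \<gamma>_def)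
        have iy: "Inf y \<in> y" "Sup y \<in> y" "Inf y \<le> x" "x \<le> Sup y"
          using k[OF xy] by (metis atLeastAtMost_iff order_refl)+
        then have "\<bar>Inf y - x\<bar> < d x" "\<bar>Sup y - x\<bar> < d x" "Inf y \<in> {a..b}" "Sup y \<in> {a..b}"
          using yb k[OF xy] by (auto simp: dist_real_def subset_eq abs_minus_commute)
        then have "f (Sup y) - f x \<le> (g x + \<epsilon>) * (Sup y - x)" "f x - f (Inf y) \<le> (g x + \<epsilon>) * (x - Inf y)"
          using d(2)[OF x(1)] iy by blast+
        then have "f (Sup y) - f (Inf y) \<le> (g x + \<epsilon>) * (Sup y - Inf y)" by (simp add: algebra_simps)
        also have "Sup y - Inf y = measure lborel y" using k[OF xy] by metis
        finally show ?thesis using False x(2) by (simp add: e g0_def algebra_simps)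
      qed
    qed
    have "f b - f a = (\<Sum>(x, k)\<in>p. f (Sup k) - f (Inf k))"
      using additive_tagged_division_1[OF \<open>a \<le> b\<close> p(1), of f] by simp
    also have "\<dots> = (\<Sum>i\<in>p. f (Sup (snd i)) - f (Inf (snd i)))" by (simp add: case_prod_beta)
    also have "\<dots> \<le> (\<Sum>i\<in>p. measure lborel (snd i) * g0 (fst i) + \<epsilon> * measure lborel (snd i)
        + (if i \<in> pN then \<bar>f (Sup (snd i)) - f (Inf (snd i))\<bar> else 0))"
      by (rule sum_mono[OF each])
    also have "\<dots> = (\<Sum>(x, k)\<in>p. measure lborel k *\<^sub>R g0 x) + \<epsilon> * (\<Sum>(x, k)\<in>p. measure lborel k)
        + (\<Sum>i\<in>pN. \<bar>f (Sup (snd i)) - f (Inf (snd i))\<bar>)"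
    proof -
      have "(\<Sum>i\<in>p. if i \<in> pN then \<bar>f (Sup (snd i)) - f (Inf (snd i))\<bar> else 0)
          = (\<Sum>i\<in>pN. \<bar>f (Sup (snd i)) - f (Inf (snd i))\<bar>)"
        using pN fin by (simp add: sum.inter_restrict[symmetric] Int_absorb1)
      then show ?thesis by (simp add: sum.distrib case_prod_beta sum_distrib_left)
    qed
    also have "(\<Sum>(x, k)\<in>p. measure lborel k) = b - a"
      using additive_content_tagged_division[of p a b] p(1) \<open>a \<le> b\<close> by simp
    also have "(\<Sum>(x, k)\<in>p. measure lborel k *\<^sub>R g0 x) \<le> I + \<epsilon>"
      using \<gamma>1[OF p(1)] p(2) by (force simp: fine_def \<gamma>_def abs_less_iff)
    finally show ?thesis using sN by (simp add: algebra_simps)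
  qed
  note H = this
  show ?thesis
  proof (rule field_le_epsilon)
    fix e :: real assume "e > 0"
    have "e / (2 + (b - a)) > 0" "2 + (b - a) > 0" using \<open>e > 0\<close> \<open>a \<le> b\<close> by auto
    then show "f b - f a \<le> I + e" using H[of "e / (2 + (b - a))"] by simp
  qed
qed

lemma abs_continuous_on_imp_continuous_on:
  assumes ac: "abs_continuous_on a b v"
  shows "continuous_on {a..b} v"
  unfolding continuous_on_iff dist_real_def
proof (intro ballI allI impI)
  fix x e :: real assume x: "x \<in> {a..b}" and e: "0 < e"
  obtain \<delta> where \<delta>: "\<delta> > 0" "\<And>(n::nat) l r. (\<forall>i<n. a \<le> l i \<and> l i \<le> r i \<and> r i \<le> b) \<Longrightarrow>
      disjoint_family_on (\<lambda>i. {l i<..<r i}) {..<n} \<Longrightarrow>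
      (\<Sum>i<n. r i - l i) < \<delta> \<Longrightarrow> (\<Sum>i<n. \<bar>v (r i) - v (l i)\<bar>) < e"
    by (rule abs_continuous_onE[OF ac e]) (erule that, blast)
  have "\<bar>v y - v x\<bar> < e" if "x \<in> {a..b}" "y \<in> {a..b}" "x \<le> y" "y - x < \<delta>" for x y
    using \<delta>(2)[of 1 "\<lambda>_. x" "\<lambda>_. y"] that by (simp add: disjoint_family_on_def)
  then show "\<exists>d>0. \<forall>x'\<in>{a..b}. \<bar>x' - x\<bar> < d \<longrightarrow> \<bar>v x' - v x\<bar> < e"
    using \<delta>(1) x by (intro exI[of _ \<delta>]) (smt (verit, ccfv_SIG))
qed

lemma abs_continuous_on_lipschitz_compose:
  fixes \<Psi> :: "real \<times> real \<Rightarrow> real"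
  assumes ac: "abs_continuous_on a b v" and lip: "C-lipschitz_on UNIV \<Psi>"
  shows "abs_continuous_on a b (\<lambda>x. \<Psi> (x, v x))"
  unfolding abs_continuous_on_def
proof (intro allI impI)
  fix e :: real assume "0 < e"
  have C: "C \<ge> 0" using lip lipschitz_on_nonneg by blast
  define e' where "e' = e / (2 * (C + 1))"
  have e': "e' > 0" using \<open>0 < e\<close> C by (simp add: e'_def)
  obtain \<delta> where \<delta>: "\<delta> > 0" "\<And>(n::nat) l r. (\<forall>i<n. a \<le> l i \<and> l i \<le> r i \<and> r i \<le> b) \<Longrightarrow>
      disjoint_family_on (\<lambda>i. {l i<..<r i}) {..<n} \<Longrightarrow>
      (\<Sum>i<n. r i - l i) < \<delta> \<Longrightarrow> (\<Sum>i<n. \<bar>v (r i) - v (l i)\<bar>) < e'"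
    by (rule abs_continuous_onE[OF ac e']) (erule that, blast)
  show "\<exists>\<delta>>0. \<forall>(n::nat) l r. (\<forall>i<n. a \<le> l i \<and> l i \<le> r i \<and> r i \<le> b) \<longrightarrow>
      disjoint_family_on (\<lambda>i. {l i<..<r i}) {..<n} \<longrightarrow>
      (\<Sum>i<n. r i - l i) < \<delta> \<longrightarrow> (\<Sum>i<n. \<bar>\<Psi> (r i, v (r i)) - \<Psi> (l i, v (l i))\<bar>) < e"
  proof (intro exI[of _ "min \<delta> e'"] conjI allI impI)
    fix n :: nat and l r :: "nat \<Rightarrow> real"
    assume lr: "\<forall>i<n. a \<le> l i \<and> l i \<le> r i \<and> r i \<le> b"
      and dj: "disjoint_family_on (\<lambda>i. {l i<..<r i}) {..<n}"
      and s: "(\<Sum>i<n. r i - l i) < min \<delta> e'"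
    have sv: "(\<Sum>i<n. \<bar>v (r i) - v (l i)\<bar>) < e'" using \<delta>(2)[OF lr dj] s by simp
    have "(\<Sum>i<n. \<bar>\<Psi> (r i, v (r i)) - \<Psi> (l i, v (l i))\<bar>) \<le> (\<Sum>i<n. C * ((r i - l i) + \<bar>v (r i) - v (l i)\<bar>))"
    proof (rule sum_mono)
      fix i assume "i \<in> {..<n}"
      then have i: "l i \<le> r i" using lr by auto
      have "\<bar>\<Psi> (r i, v (r i)) - \<Psi> (l i, v (l i))\<bar> \<le> C * dist (r i, v (r i)) (l i, v (l i))"
        using lip by (auto simp: lipschitz_on_def dist_real_def)
      also have "dist (r i, v (r i)) (l i, v (l i)) \<le> (r i - l i) + \<bar>v (r i) - v (l i)\<bar>"
        using sqrt_sum_squares_le_sum_abs[of "r i - l i" "v (r i) - v (l i)"] i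
        by (simp add: dist_prod_def dist_real_def)
      finally show "\<bar>\<Psi> (r i, v (r i)) - \<Psi> (l i, v (l i))\<bar> \<le> C * ((r i - l i) + \<bar>v (r i) - v (l i)\<bar>)"
        using C by (simp add: mult_left_mono)
    qed
    also have "\<dots> = C * ((\<Sum>i<n. r i - l i) + (\<Sum>i<n. \<bar>v (r i) - v (l i)\<bar>))"
      by (simp only: sum_distrib_left[symmetric] sum.distrib)
    also have "\<dots> \<le> C * (e' + e')" using sv s C by (intro mult_left_mono) auto
    also have "\<dots> = e' * (2 * (C + 1)) - 2 * e'" by (simp add: algebra_simps)
    also have "e' * (2 * (C + 1)) = e" using C by (simp add: e'_def)
    also have "e - 2 * e' < e" using e' by simp
    finally show "(\<Sum>i<n. \<bar>\<Psi> (r i, v (r i)) - \<Psi> (l i, v (l i))\<bar>) < e" .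
  qed (use \<delta>(1) e' in auto)
qed

text \<open>
  The function \<open>\<Psi> (x, v x)\<close> is absolutely continuous, and its derivative \<open>\<Psi>' (x, v x) (1, v' x)\<close> is
  almost everywhere bounded by the integrand. Allowing a factor \<open>c1\<close> and a constant \<open>c2\<close> leaves
  room for functions that calibrate only approximately.
\<close>

lemma calibration_lower_bound:
  fixes L :: "real \<times> real \<times> real \<Rightarrow> real" and \<Psi> :: "real \<times> real \<Rightarrow> real"
  assumes L: "L \<in> borel_measurable borel" "\<And>z. 0 \<le> L z"
    and der: "\<And>z. (\<Psi> has_derivative \<Psi>' z) (at z)" and lip: "C-lipschitz_on UNIV \<Psi>"
    and le: "\<And>x y p. \<Psi>' (x, y) (1, p) \<le> c1 * L (x, y, p) + c2"
    and ac: "abs_continuous_on a b v" and "a \<le> b"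
    and J: "(\<integral>\<^sup>+x\<in>{a..b}. ennreal (L (x, v x, deriv v x)) \<partial>lebesgue) = ennreal J" "0 \<le> J"
  shows "\<Psi> (b, v b) - \<Psi> (a, v a) \<le> c1 * J + c2 * (b - a)"
proof -
  obtain N0 where N0: "negligible N0" "\<forall>x\<in>{a<..<b} - N0. v differentiable (at x)"
    using abs_continuous_on_differentiable_ae[OF ac \<open>a \<le> b\<close>] by blast
  define N where "N = N0 \<union> {a, b}"
  have N: "negligible N" using N0 by (simp add: N_def)
  \<comment> \<open>A Borel function that agrees with the derivative of v almost everywhere: the limit of the
    difference quotients of a continuous extension of v.\<close>
  define c where "c x = max a (min b x)" for x
  define w where "w x = v (c x)" for x
  have "continuous_on UNIV w"
    unfolding w_def[abs_def] c_def
    by (rule continuous_on_compose2[OF abs_continuous_on_imp_continuous_on[OF ac]])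
      (use \<open>a \<le> b\<close> in \<open>auto intro!: continuous_intros\<close>)
  then have wm [measurable]: "w \<in> borel_measurable borel" by (rule borel_measurable_continuous_onI)
  define q where "q n x = (w (x + 1 / real (Suc n)) - w x) * real (Suc n)" for n x
  have [measurable]: "q n \<in> borel_measurable borel" for n unfolding q_def[abs_def] by measurable
  define h where "h x = lim (\<lambda>n. q n x)" for x
  have hm [measurable]: "h \<in> borel_measurable borel" unfolding h_def[abs_def] by (rule borel_measurable_lim_metric) simp
  define G where "G x = L (x, w x, h x)" for x
  have Gm [measurable]: "G \<in> borel_measurable borel"
    unfolding G_def[abs_def] by (rule measurable_compose[OF _ L(1)]) (auto simp: borel_prod[symmetric])
  have wv: "w x = v x" if "x \<in> {a..b}" for x using that by (simp add: w_def c_def)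
  have vd: "(v has_real_derivative deriv v x) (at x)" if "x \<in> {a..b} - N" for x
    using N0(2) that DERIV_deriv_iff_real_differentiable by (force simp: N_def)
  have hd: "h x = deriv v x" if x: "x \<in> {a..b} - N" for x
  proof -
    have xi: "a < x" "x < b" using x by (auto simp: N_def)
    have "(w has_real_derivative deriv v x) (at x)"
      by (rule has_field_derivative_transform_within_open[OF vd[OF x], of "{a<..<b}"]) (use xi wv in auto)
    then have "((\<lambda>t. (w (x + t) - w x) / t) \<longlongrightarrow> deriv v x) (at 0)" by (simp add: DERIV_def)
    moreover have "filterlim (\<lambda>n. 1 / real (Suc n)) (at 0) sequentially"
      unfolding filterlim_at using LIMSEQ_Suc[OF lim_1_over_n] by auto
    ultimately have "(\<lambda>n. (w (x + 1 / real (Suc n)) - w x) / (1 / real (Suc n))) \<longlonglongrightarrow> deriv v x"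
      by (rule filterlim_compose)
    then have "(\<lambda>n. q n x) \<longlonglongrightarrow> deriv v x" by (simp add: q_def)
    then show ?thesis unfolding h_def by (rule limI)
  qed
  have Geq: "G x = L (x, v x, deriv v x)" if "x \<in> {a..b} - N" for x
    using hd[OF that] wv[of x] that by (simp add: G_def)
  have "(\<integral>\<^sup>+x. ennreal (G x * indicator {a..b} x) \<partial>lborel) = (\<integral>\<^sup>+x. ennreal (G x * indicator {a..b} x) \<partial>lebesgue)"
    by (rule nn_integral_completion[symmetric])
  also have "\<dots> = (\<integral>\<^sup>+x\<in>{a..b}. ennreal (L (x, v x, deriv v x)) \<partial>lebesgue)"
  proof (rule nn_integral_cong_AE)
    have "N \<in> null_sets lebesgue" using N by (simp add: negligible_iff_null_sets)
    then have "AE x in lebesgue. x \<notin> N" by (rule AE_not_in)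
    then show "AE x in lebesgue. ennreal (G x * indicator {a..b} x) = ennreal (L (x, v x, deriv v x)) * indicator {a..b} x"
      by (rule AE_mp) (auto intro!: AE_I2 simp: Geq indicator_def)
  qed
  finally have "(\<integral>\<^sup>+x. ennreal (G x * indicator {a..b} x) \<partial>lborel) = ennreal J" using J(1) by simp
  then have "((\<lambda>x. G x * indicator {a..b} x) has_integral J) UNIV"
  proof (intro nn_integral_has_integral)
    show "(\<lambda>x. G x * indicator {a..b} x) \<in> borel_measurable borel" by measurable
    show "0 \<le> G x * indicator {a..b} x" for x by (simp add: G_def L(2))
  qed (use J(2) in auto)
  then have "((\<lambda>x. if x \<in> {a..b} then G x else 0) has_integral J) UNIV"
    by (rule has_integral_eq[rotated]) auto
  then have "(G has_integral J) {a..b}" by (simp only: has_integral_restrict_UNIV)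
  then have I: "((\<lambda>x. c1 * G x + c2) has_integral (c1 * J + c2 * (b - a))) {a..b}"
    using has_integral_const_real[of c2 a b] \<open>a \<le> b\<close>
    by (intro has_integral_add has_integral_mult_right) (auto simp: mult.commute)
  show ?thesis
  proof (rule abs_continuous_on_increment_le_integral[OF abs_continuous_on_lipschitz_compose[OF ac lip] \<open>a \<le> b\<close> I N])
    fix x assume x: "x \<in> {a..b} - N"
    have "(v has_derivative (\<lambda>t. deriv v x * t)) (at x within {a..b})"
      using vd[OF x] by (simp add: has_field_derivative_def has_derivative_at_withinI)
    then have "((\<lambda>x. (x, v x)) has_derivative (\<lambda>t. (t, deriv v x * t))) (at x within {a..b})"
      by (intro has_derivative_Pair has_derivative_ident)
    then have "((\<lambda>x. \<Psi> (x, v x)) has_derivative (\<lambda>t. \<Psi>' (x, v x) (t, deriv v x * t))) (at x within {a..b})"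
      by (rule has_derivative_compose) (rule der)
    moreover have "\<Psi>' (x, v x) (t, deriv v x * t) = \<Psi>' (x, v x) (1, deriv v x) * t" for t
    proof -
      interpret bounded_linear "\<Psi>' (x, v x)" using der has_derivative_bounded_linear by blast
      have "(t, deriv v x * t) = t *\<^sub>R (1, deriv v x)" by (simp add: mult.commute)
      then show ?thesis using scaleR by (metis mult.commute real_scaleR_def)
    qed
    ultimately have "((\<lambda>x. \<Psi> (x, v x)) has_real_derivative \<Psi>' (x, v x) (1, deriv v x)) (at x within {a..b})"
      by (simp add: has_field_derivative_def)
    then show "\<exists>D. ((\<lambda>x. \<Psi> (x, v x)) has_real_derivative D) (at x within {a..b}) \<and> D \<le> c1 * G x + c2"
      using le[of x "v x" "deriv v x"] Geq[OF x] by metis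
  qed
qed

section \<open>Chains near a purely unrectifiable set\<close>

text \<open>
  A Lipschitz map multiplies the diameters of a cover by at most its constant, and a bounded subset of the line is
  contained in an interval of at most twice its diameter.
\<close>

lemma negligible_lipschitz_image_of_unrectifiable:
  fixes S :: "(real \<times> real) set" and pr :: "real \<times> real \<Rightarrow> real" and \<gamma> :: "real \<Rightarrow> real \<times> real"
  assumes "purely_unrectifiable S" "C-lipschitz_on UNIV \<gamma>" "K-lipschitz_on UNIV pr"
  shows "negligible (pr ` (S \<inter> range \<gamma>))"
  unfolding negligible_outer_le
proof (intro allI impI)
  fix e :: real assume "e > 0"
  have K: "K \<ge> 0" using assms(3) lipschitz_on_nonneg by blast
  define E where "E = S \<inter> range \<gamma>"
  have "hausdorff1 E = 0" using assms(1,2) by (auto simp: purely_unrectifiable_def E_def)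
  then have "hausdorff1_delta 1 E = 0"
    unfolding hausdorff1_def
    by (metis SUP_upper greaterThan_iff less_numeral_extra(1) le_zero_eq)
  moreover define \<eta> where "\<eta> = e / (2 * K + 1)"
  have "\<eta> > 0" using \<open>e > 0\<close> K by (simp add: \<eta>_def)
  ultimately have "hausdorff1_delta 1 E < ennreal \<eta>" by simp
  then obtain C :: "nat \<Rightarrow> (real \<times> real) set" where C: "E \<subseteq> (\<Union>n. C n)" "\<And>n. bounded (C n)"
    "(\<Sum>n. ennreal (diameter (C n))) < ennreal \<eta>"
    unfolding hausdorff1_delta_def Inf_less_iff by auto
  define T where "T n = cball (pr (SOME c. c \<in> C n)) (K * diameter (C n))" for n
  have dn: "diameter (C n) \<ge> 0" for n using C(2) diameter_ge_0 by blast
  have sub: "pr ` E \<subseteq> (\<Union>n. T n)"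
  proof
    fix p assume "p \<in> pr ` E"
    then obtain n z where z: "p = pr z" "z \<in> C n" using C(1) by blast
    then have c: "(SOME c. c \<in> C n) \<in> C n" by (metis someI)
    have "dist (pr (SOME c. c \<in> C n)) (pr z) \<le> K * dist (SOME c. c \<in> C n) z"
      by (rule lipschitz_onD[OF assms(3)]) auto
    also have "\<dots> \<le> K * diameter (C n)"
      using diameter_bounded_bound[OF C(2) c z(2)] K by (intro mult_left_mono)
    finally show "p \<in> (\<Union>n. T n)" using z by (auto simp: T_def)
  qed
  have Te: "emeasure lborel (T n) = ennreal (2 * K) * ennreal (diameter (C n))" for n
    using K dn[of n] by (simp add: T_def cball_eq_atLeastAtMost ennreal_mult[symmetric] mult.assoc)
  have "emeasure lborel (\<Union>n. T n) \<le> (\<Sum>n. emeasure lborel (T n))"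
    by (rule emeasure_subadditive_countably) (auto simp: T_def)
  also have "\<dots> = ennreal (2 * K) * (\<Sum>n. ennreal (diameter (C n)))"
    by (simp add: Te)
  also have "\<dots> \<le> ennreal (2 * K) * ennreal \<eta>" using C(3) by (intro mult_left_mono) auto
  also have "\<dots> = ennreal (2 * K * \<eta>)" using K \<open>\<eta> > 0\<close> by (simp add: ennreal_mult)
  also have "\<dots> \<le> ennreal e"
    using K \<open>e > 0\<close> by (intro ennreal_leI) (simp add: \<eta>_def field_simps)
  finally have le: "emeasure lborel (\<Union>n. T n) \<le> ennreal e" .
  have "(\<Union>n. T n) \<in> sets borel" by (auto simp: T_def)
  then have "(\<Union>n. T n) \<in> lmeasurable" "measure lebesgue (\<Union>n. T n) \<le> e"
  proof -
    assume b: "(\<Union>n. T n) \<in> sets borel"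
    have "emeasure lebesgue (\<Union>n. T n) \<le> ennreal e" using le b by simp
    then show "(\<Union>n. T n) \<in> lmeasurable" using b by (auto intro!: fmeasurableI simp: less_top[symmetric] top_unique)
    show "measure lebesgue (\<Union>n. T n) \<le> e"
      using \<open>emeasure lebesgue (\<Union>n. T n) \<le> ennreal e\<close> \<open>e > 0\<close>
      unfolding measure_def by (metis enn2real_leI less_imp_le)
  qed
  then show "\<exists>T. pr ` (S \<inter> range \<gamma>) \<subseteq> T \<and> T \<in> lmeasurable \<and> measure lebesgue T \<le> e"
    using sub unfolding E_def by blast
qed

text \<open>
  The length of a segment in this norm is its length as a path with one horizontal and one vertical
  leg; chains of such segments are parametrised by this length.
\<close>

definition norm1 :: "real \<times> real \<Rightarrow> real" where
  "norm1 z = \<bar>fst z\<bar> + \<bar>snd z\<bar>"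

lemma norm_le_norm1: "norm z \<le> norm1 z"
  using sqrt_sum_squares_le_sum_abs[of "fst z" "snd z"] by (simp add: norm1_def norm_prod_def)

text \<open>
  The new curve follows \<open>\<gamma>\<close>, then runs at unit speed in \<open>norm1\<close> along the segment from \<open>p\<close> to \<open>q\<close> and stays there.
\<close>

lemma extend_curve:
  fixes \<gamma> :: "real \<Rightarrow> real \<times> real"
  assumes lip: "\<And>s t. norm1 (\<gamma> s - \<gamma> t) \<le> \<bar>s - t\<bar>" and "T \<ge> 0"
    and after: "\<And>s. s \<ge> T \<Longrightarrow> \<gamma> s = p" and before: "\<And>s. s \<le> 0 \<Longrightarrow> \<gamma> s = \<gamma> 0"
  shows "\<exists>\<gamma>'. (\<forall>s t. norm1 (\<gamma>' s - \<gamma>' t) \<le> \<bar>s - t\<bar>) \<and> (\<forall>s\<ge>T + norm1 (q - p). \<gamma>' s = q) \<and>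
     (\<forall>s\<le>0. \<gamma>' s = \<gamma>' 0) \<and> range \<gamma> \<subseteq> range \<gamma>' \<and> (\<forall>c\<in>{0..1}. p + c *\<^sub>R (q - p) \<in> range \<gamma>')"
proof (cases "p = q")
  case True
  have "p \<in> range \<gamma>" using after[of T] by (metis order_refl rangeI)
  have n0: "norm1 (q - p) = 0" using True by (simp add: norm1_def)
  have "\<forall>s\<ge>T + norm1 (q - p). \<gamma> s = q"
    unfolding n0 using after True by auto
  moreover have "\<forall>c\<in>{0..1::real}. p + c *\<^sub>R (q - p) \<in> range \<gamma>" using True \<open>p \<in> range \<gamma>\<close> by simp
  ultimately show ?thesis using lip before by blast
next
  case False
  define l where "l = norm1 (q - p)"
  have "l > 0" using False norm_le_norm1[of "q - p"] by (simp add: l_def) (smt (verit) norm_le_zero_iff right_minus_eq)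
  define c where "c s = max 0 (min 1 ((s - T) / l))" for s
  define \<gamma>' where "\<gamma>' s = \<gamma> s + c s *\<^sub>R (q - p)" for s
  have n1s: "norm1 (r *\<^sub>R z) = \<bar>r\<bar> * norm1 z" for r z by (simp add: norm1_def abs_mult algebra_simps)
  have n1t: "norm1 (z + w) \<le> norm1 z + norm1 w" for z w by (simp add: norm1_def)
  have n1m: "norm1 (z - w) = norm1 (w - z)" for z w by (simp add: norm1_def abs_minus_commute)
  have c0: "c s = 0" if "s \<le> T" for s using that \<open>l > 0\<close> by (simp add: c_def divide_nonpos_pos)
  have cl: "\<bar>c s - c t\<bar> * l \<le> \<bar>s - t\<bar>" for s t
  proof -
    have "\<bar>c s - c t\<bar> \<le> \<bar>(s - T) / l - (t - T) / l\<bar>" by (auto simp: c_def)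
    also have "\<dots> = \<bar>s - t\<bar> / l" using \<open>l > 0\<close> by (simp add: diff_divide_distrib[symmetric])
    finally show ?thesis using \<open>l > 0\<close> by (simp add: field_simps)
  qed
  have l1: "norm1 (\<gamma>' s - \<gamma>' t) \<le> \<bar>s - t\<bar>" if "s \<le> T" "t \<le> T" for s t
    using that lip c0 by (simp add: \<gamma>'_def)
  have l2: "norm1 (\<gamma>' s - \<gamma>' t) \<le> \<bar>s - t\<bar>" if "s \<ge> T" "t \<ge> T" for s t
  proof -
    have "\<gamma>' s - \<gamma>' t = (c s - c t) *\<^sub>R (q - p)" using after that by (simp add: \<gamma>'_def algebra_simps)
    then show ?thesis using cl n1s by (simp add: l_def)
  qed
  have l3: "norm1 (\<gamma>' s - \<gamma>' t) \<le> \<bar>s - t\<bar>" if "s \<le> T" "t \<ge> T" for s t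
  proof -
    have "norm1 (\<gamma>' s - \<gamma>' t) \<le> norm1 (\<gamma>' s - \<gamma>' T) + norm1 (\<gamma>' T - \<gamma>' t)"
      using n1t[of "\<gamma>' s - \<gamma>' T" "\<gamma>' T - \<gamma>' t"] by simp
    then show ?thesis using l1[of s T] l2[of T t] that by simp
  qed
  have lip': "norm1 (\<gamma>' s - \<gamma>' t) \<le> \<bar>s - t\<bar>" for s t
    using l1[of s t] l2[of s t] l3[of s t] l3[of t s] n1m[of "\<gamma>' s" "\<gamma>' t"]
    by (metis abs_minus_commute linear)
  have at: "\<gamma>' (T + r * l) = p + r *\<^sub>R (q - p)" if "r \<in> {0..1}" for r
    using that \<open>l > 0\<close> after[of "T + r * l"] by (simp add: \<gamma>'_def c_def)
  show ?thesis
  proof (intro exI[of _ \<gamma>'] conjI allI impI ballI lip')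
    fix s assume "s \<ge> T + norm1 (q - p)"
    then have "(s - T) / l \<ge> 1" "s \<ge> T" using \<open>l > 0\<close> by (auto simp: l_def field_simps)
    then show "\<gamma>' s = q" using after[of s] by (simp add: \<gamma>'_def c_def)
  next
    fix s :: real assume "s \<le> 0"
    then show "\<gamma>' s = \<gamma>' 0" using before[of s] c0 \<open>T \<ge> 0\<close> by (simp add: \<gamma>'_def)
  next
    show "range \<gamma> \<subseteq> range \<gamma>'"
    proof
      fix z assume "z \<in> range \<gamma>"
      then obtain s where s: "z = \<gamma> s" by blast
      have "\<gamma> s = \<gamma>' (min s T)" using after[of s] after[of T] c0[of "min s T"] by (simp add: \<gamma>'_def min_def)
      then show "z \<in> range \<gamma>'" using s by blast
    qed
  next
    fix r :: real assume "r \<in> {0..1}"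
    then show "p + r *\<^sub>R (q - p) \<in> range \<gamma>'" using at[of r] by (metis rangeI)
  qed
qed

text \<open>
  \<open>gain \<delta> G x y v\<close> means that some chain of segments, each horizontal to the right or vertical, ends
  at \<open>(x, y)\<close> with balance \<open>v\<close>: the length of horizontal segments inside \<open>G\<close> is credited, and \<open>\<delta>\<close>
  times the length of vertical segments is charged. The rules are closed under prolonging a
  chain, which gives the bounds on the slopes of the best balance.
\<close>

inductive gain :: "real \<Rightarrow> (real \<times> real) set \<Rightarrow> real \<Rightarrow> real \<Rightarrow> real \<Rightarrow> bool" for \<delta> G where
  start: "gain \<delta> G x y 0"
| right: "gain \<delta> G x y v \<Longrightarrow> x \<le> x' \<Longrightarrow> gain \<delta> G x' y v"
| through: "gain \<delta> G x y v \<Longrightarrow> x \<le> x' \<Longrightarrow> (\<And>t. x \<le> t \<Longrightarrow> t \<le> x' \<Longrightarrow> (t, y) \<in> G)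
    \<Longrightarrow> gain \<delta> G x' y (v + (x' - x))"
| vertical: "gain \<delta> G x y v \<Longrightarrow> gain \<delta> G x y' (v - \<delta> * \<bar>y' - y\<bar>)"

text \<open>
  Since \<open>G\<close> lies in the strip \<open>\<bar>x\<bar> \<le> R\<close>, horizontal coordinates can be clipped to \<open>[- R, R]\<close> without losing credit.
  Chains never move to the left, so the credited segments have essentially disjoint projections; the set \<open>E\<close> is
  the union of these projections, and its measure is the total credit. The number \<open>V\<close> is the vertical length,
  and a clipped chain has length at most \<open>2 R + V\<close>.
\<close>

lemma gain_curve:
  assumes "gain \<delta> G x y v" and G: "\<And>z. z \<in> G \<Longrightarrow> - R \<le> fst z \<and> fst z \<le> R" and "R \<ge> 0" "\<delta> \<ge> 0"
  shows "\<exists>\<gamma> T V E. (\<forall>s t. norm1 (\<gamma> s - \<gamma> t) \<le> \<bar>s - t\<bar>) \<and> T \<ge> 0 \<and>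
     (\<forall>s\<ge>T. \<gamma> s = (max (-R) (min R x), y)) \<and> (\<forall>s\<le>0. \<gamma> s = \<gamma> 0) \<and>
     0 \<le> V \<and> T \<le> max (-R) (min R x) + R + V \<and>
     E \<in> sets borel \<and> E \<subseteq> {-R..max (-R) (min R x)} \<and> E \<subseteq> fst ` (G \<inter> range \<gamma>) \<and> v + \<delta> * V \<le> measure lborel E"
  using assms(1)
proof (induction rule: gain.induct)
  case (start x y)
  show ?case
    by (rule exI[of _ "\<lambda>_. (max (-R) (min R x), y)"], rule exI[of _ 0], rule exI[of _ 0], rule exI[of _ "{}"])
      (use \<open>R \<ge> 0\<close> in \<open>auto simp: norm1_def\<close>)
next
  case (right x y v x')
  define c where "c x = max (-R) (min R x)" for x
  have cc: "c x \<le> c x'" using right by (auto simp: c_def)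
  from right obtain \<gamma> T V E where H: "\<forall>s t. norm1 (\<gamma> s - \<gamma> t) \<le> \<bar>s - t\<bar>" "T \<ge> 0"
     "\<forall>s\<ge>T. \<gamma> s = (c x, y)" "\<forall>s\<le>0. \<gamma> s = \<gamma> 0" "0 \<le> V" "T \<le> c x + R + V"
     "E \<in> sets borel" "E \<subseteq> {-R..c x}" "E \<subseteq> fst ` (G \<inter> range \<gamma>)" "v + \<delta> * V \<le> measure lborel E"
    unfolding c_def by blast
  obtain \<gamma>' where \<gamma>': "\<forall>s t. norm1 (\<gamma>' s - \<gamma>' t) \<le> \<bar>s - t\<bar>"
    "\<forall>s\<ge>T + norm1 ((c x', y) - (c x, y)). \<gamma>' s = (c x', y)" "\<forall>s\<le>0. \<gamma>' s = \<gamma>' 0" "range \<gamma> \<subseteq> range \<gamma>'"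
    using extend_curve[of \<gamma> T "(c x, y)" "(c x', y)"] H by blast
  have n: "norm1 ((c x', y) - (c x, y)) = c x' - c x" using cc by (simp add: norm1_def)
  show ?case
    unfolding c_def[symmetric]
  proof (rule exI[of _ \<gamma>'], rule exI[of _ "T + (c x' - c x)"], rule exI[of _ V], rule exI[of _ E], intro conjI)
    show "\<forall>s\<ge>T + (c x' - c x). \<gamma>' s = (c x', y)" using \<gamma>'(2) n by simp
    show "E \<subseteq> {-R..c x'}" using H(8) cc by fastforce
    show "E \<subseteq> fst ` (G \<inter> range \<gamma>')" using H(9) \<gamma>'(4) by blast
    show "\<forall>s\<le>0. \<gamma>' s = \<gamma>' 0" by fact
    show "0 \<le> T + (c x' - c x)" using H(2) cc by linarith
    show "T + (c x' - c x) \<le> c x' + R + V" using H(6) by linarith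
  qed (rule \<gamma>' H)+
next
  case (through x y v x')
  define c where "c x = max (-R) (min R x)" for x
  have "- R \<le> x" "x \<le> R" "- R \<le> x'" "x' \<le> R"
    using G[OF through.hyps(3)[of x]] G[OF through.hyps(3)[of x']] through.hyps(2) by auto
  then have cc: "c x = x" "c x' = x'" by (simp_all add: c_def)
  from through obtain \<gamma> T V E where H: "\<forall>s t. norm1 (\<gamma> s - \<gamma> t) \<le> \<bar>s - t\<bar>" "T \<ge> 0"
     "\<forall>s\<ge>T. \<gamma> s = (c x, y)" "\<forall>s\<le>0. \<gamma> s = \<gamma> 0" "0 \<le> V" "T \<le> c x + R + V"
     "E \<in> sets borel" "E \<subseteq> {-R..c x}" "E \<subseteq> fst ` (G \<inter> range \<gamma>)" "v + \<delta> * V \<le> measure lborel E"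
    unfolding c_def by blast
  obtain \<gamma>' where \<gamma>': "\<forall>s t. norm1 (\<gamma>' s - \<gamma>' t) \<le> \<bar>s - t\<bar>"
    "\<forall>s\<ge>T + norm1 ((x', y) - (x, y)). \<gamma>' s = (x', y)" "\<forall>s\<le>0. \<gamma>' s = \<gamma>' 0" "range \<gamma> \<subseteq> range \<gamma>'"
    "\<forall>c\<in>{0..1}. (x, y) + c *\<^sub>R ((x', y) - (x, y)) \<in> range \<gamma>'"
    using extend_curve[of \<gamma> T "(x, y)" "(x', y)"] H unfolding cc by blast
  have n: "norm1 ((x', y) - (x, y)) = x' - x" using through.hyps(2) by (simp add: norm1_def)
  have m: "measure lborel (E \<union> {x<..x'}) = measure lborel E + (x' - x)"
  proof -
    have "emeasure lborel E \<noteq> \<infinity>"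
      using H(8) emeasure_bounded_finite[of E] bounded_subset[of "{-R..c x}" E] by auto
    then have "measure lborel (E \<union> {x<..x'}) = measure lborel E + measure lborel {x<..x'}"
      by (intro measure_Union) (use H(7,8) cc through.hyps(2) in auto)
    then show ?thesis using through.hyps(2) by simp
  qed
  have seg: "(t, y) \<in> G \<inter> range \<gamma>'" if "x < t" "t \<le> x'" for t
  proof -
    have "(t - x) / (x' - x) \<in> {0..1}" using that by auto
    then have "(x, y) + ((t - x) / (x' - x)) *\<^sub>R ((x', y) - (x, y)) \<in> range \<gamma>'" using \<gamma>'(5) by blast
    moreover have "(x, y) + ((t - x) / (x' - x)) *\<^sub>R ((x', y) - (x, y)) = (t, y)" using that by simp
    ultimately show ?thesis using through.hyps(3)[of t] that by simp
  qed
  have sub: "E \<union> {x<..x'} \<subseteq> fst ` (G \<inter> range \<gamma>')"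
  proof
    fix t assume "t \<in> E \<union> {x<..x'}"
    then show "t \<in> fst ` (G \<inter> range \<gamma>')"
    proof
      assume "t \<in> E" then show ?thesis using H(9) \<gamma>'(4) by blast
    next
      assume "t \<in> {x<..x'}" then show ?thesis using seg[of t] by (metis fst_conv greaterThanAtMost_iff image_eqI)
    qed
  qed
  show ?case
    unfolding c_def[symmetric]
  proof (rule exI[of _ \<gamma>'], rule exI[of _ "T + (x' - x)"], rule exI[of _ V], rule exI[of _ "E \<union> {x<..x'}"], intro conjI)
    show "\<forall>s\<ge>T + (x' - x). \<gamma>' s = (c x', y)" using \<gamma>'(2) n cc by simp
    show "E \<union> {x<..x'} \<subseteq> {-R..c x'}" using H(2,8) cc through.hyps(2) \<open>- R \<le> x\<close> by fastforce
    show "v + (x' - x) + \<delta> * V \<le> measure lborel (E \<union> {x<..x'})" using H(10) m by simp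
    show "\<forall>s\<le>0. \<gamma>' s = \<gamma>' 0" by fact
    show "0 \<le> T + (x' - x)" using H(2) through.hyps(2) by linarith
    show "T + (x' - x) \<le> c x' + R + V" using H(6) cc by linarith
    show "E \<union> {x<..x'} \<in> sets borel" using H(7) by simp
  qed (rule \<gamma>' H sub)+
next
  case (vertical x y v y')
  define c where "c x = max (-R) (min R x)" for x
  from vertical obtain \<gamma> T V E where H: "\<forall>s t. norm1 (\<gamma> s - \<gamma> t) \<le> \<bar>s - t\<bar>" "T \<ge> 0"
     "\<forall>s\<ge>T. \<gamma> s = (c x, y)" "\<forall>s\<le>0. \<gamma> s = \<gamma> 0" "0 \<le> V" "T \<le> c x + R + V"
     "E \<in> sets borel" "E \<subseteq> {-R..c x}" "E \<subseteq> fst ` (G \<inter> range \<gamma>)" "v + \<delta> * V \<le> measure lborel E"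
    unfolding c_def by blast
  obtain \<gamma>' where \<gamma>': "\<forall>s t. norm1 (\<gamma>' s - \<gamma>' t) \<le> \<bar>s - t\<bar>"
    "\<forall>s\<ge>T + norm1 ((c x, y') - (c x, y)). \<gamma>' s = (c x, y')" "\<forall>s\<le>0. \<gamma>' s = \<gamma>' 0" "range \<gamma> \<subseteq> range \<gamma>'"
    using extend_curve[of \<gamma> T "(c x, y)" "(c x, y')"] H by blast
  have n: "norm1 ((c x, y') - (c x, y)) = \<bar>y' - y\<bar>" by (simp add: norm1_def)
  show ?case
    unfolding c_def[symmetric]
  proof (rule exI[of _ \<gamma>'], rule exI[of _ "T + \<bar>y' - y\<bar>"], rule exI[of _ "V + \<bar>y' - y\<bar>"], rule exI[of _ E], intro conjI)
    show "\<forall>s\<ge>T + \<bar>y' - y\<bar>. \<gamma>' s = (c x, y')" using \<gamma>'(2) n by simp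
    show "E \<subseteq> fst ` (G \<inter> range \<gamma>')" using H(9) \<gamma>'(4) by blast
    show "v - \<delta> * \<bar>y' - y\<bar> + \<delta> * (V + \<bar>y' - y\<bar>) \<le> measure lborel E" using H(10) by (simp add: algebra_simps)
    show "\<forall>s\<le>0. \<gamma>' s = \<gamma>' 0" by fact
    show "0 \<le> T + \<bar>y' - y\<bar>" "0 \<le> V + \<bar>y' - y\<bar>" using H(2,5) by linarith+
    show "T + \<bar>y' - y\<bar> \<le> c x + R + (V + \<bar>y' - y\<bar>)" using H(6) by linarith
  qed (rule \<gamma>' H)+
qed

text \<open>
  Suppose that for neighbourhoods of \<open>S\<close> shrinking to \<open>S\<close> there are chains with balance above \<open>\<epsilon>\<close>. Their credit is at most
  \<open>2 R\<close>, hence their vertical length is at most \<open>2 R / \<delta>\<close>, and the curves are parametrised by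
  one compact interval. A limit curve exists by the theorem of Arzela and Ascoli. It meets \<open>S\<close> in a
  set with null projection, which is contained in an open set \<open>U\<close> of measure below \<open>\<epsilon>\<close>. By compactness the
  credited projections \<open>E n\<close> of suitable curves are contained in \<open>U\<close>, although their measure is at least \<open>\<epsilon>\<close>.
\<close>

lemma gain_small:
  fixes S :: "(real \<times> real) set"
  assumes "compact S" "S \<noteq> {}"
    and proj: "\<And>(\<gamma> :: real \<Rightarrow> real \<times> real) C. C-lipschitz_on UNIV \<gamma> \<Longrightarrow> negligible (fst ` (S \<inter> range \<gamma>))"
    and "0 < \<delta>" "0 < \<epsilon>"
  shows "\<exists>d>0. \<forall>x y v. gain \<delta> {z. infdist z S < d} x y v \<longrightarrow> v \<le> \<epsilon>"
proof (rule ccontr)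
  assume neg: "\<not> ?thesis"
  obtain R0 where R0: "\<And>z. z \<in> S \<Longrightarrow> norm z \<le> R0" using compact_imp_bounded[OF \<open>compact S\<close>] unfolding bounded_iff by blast
  define R where "R = R0 + 1"
  obtain z0 where "z0 \<in> S" using \<open>S \<noteq> {}\<close> by blast
  then have "R \<ge> 0" using R0[of z0] norm_ge_zero[of z0] unfolding R_def by linarith
  define G where "G n = {z. infdist z S < 1 / real (Suc n)}" for n
  have near: "\<exists>a\<in>S. dist z a < d" if "infdist z S < d" for z d
    using infdist_attains_inf[OF compact_imp_closed[OF \<open>compact S\<close>] \<open>S \<noteq> {}\<close>, of z] that by metis
  have GR: "norm z \<le> R" if "z \<in> G n" for z n
  proof -
    have "infdist z S < 1 / real (Suc n)" using that unfolding G_def by blast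
    also have "1 / real (Suc n) \<le> 1" by simp
    finally obtain a where "a \<in> S" "dist z a < 1" using near[of z 1] by blast
    then show ?thesis using R0[of a] norm_triangle_sub[of z a] by (simp add: R_def dist_norm)
  qed
  have ex: "\<exists>x y v. gain \<delta> (G n) x y v \<and> v > \<epsilon>" for n
  proof -
    have "1 / real (Suc n) > 0" by simp
    then show ?thesis using neg unfolding G_def by (meson not_le)
  qed
  define Pr where "Pr n \<gamma> T V E \<longleftrightarrow> (\<forall>s t. norm1 (\<gamma> s - \<gamma> t) \<le> \<bar>s - t\<bar>) \<and> T \<ge> 0 \<and>
     (\<forall>s\<ge>T. \<gamma> s = \<gamma> T) \<and> (\<forall>s\<le>0. \<gamma> s = \<gamma> 0) \<and>
     0 \<le> V \<and> T \<le> 2 * R + V \<and>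
     E \<in> sets borel \<and> E \<subseteq> {-R..R} \<and> E \<subseteq> fst ` (G n \<inter> range \<gamma>) \<and> \<epsilon> + \<delta> * V \<le> measure lborel E"
    for n \<gamma> T V E
  have "\<exists>\<gamma> T V E. Pr n \<gamma> T V E" for n
  proof -
    obtain x y v where xyv: "gain \<delta> (G n) x y v" "v > \<epsilon>" using ex by blast
    have "- R \<le> fst z \<and> fst z \<le> R" if "z \<in> G n" for z
      using GR[OF that] norm_fst_le[of "fst z" "snd z"] by auto
    from gain_curve[OF xyv(1) this \<open>R \<ge> 0\<close> less_imp_le[OF \<open>0 < \<delta>\<close>]]
    obtain \<gamma> T V E where H: "\<forall>s t. norm1 (\<gamma> s - \<gamma> t) \<le> \<bar>s - t\<bar>" "T \<ge> 0"
     "\<forall>s\<ge>T. \<gamma> s = (max (-R) (min R x), y)" "\<forall>s\<le>0. \<gamma> s = \<gamma> 0" "0 \<le> V" "T \<le> max (-R) (min R x) + R + V"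
     "E \<in> sets borel" "E \<subseteq> {-R..max (-R) (min R x)}" "E \<subseteq> fst ` (G n \<inter> range \<gamma>)" "v + \<delta> * V \<le> measure lborel E"
      by blast
    have "Pr n \<gamma> T V E"
      unfolding Pr_def
    proof (intro conjI)
      show "\<forall>s\<le>0. \<gamma> s = \<gamma> 0" by fact
      show "\<forall>s\<ge>T. \<gamma> s = \<gamma> T" using H(3) by simp
      show "E \<subseteq> {-R..R}" using H(8) \<open>R \<ge> 0\<close> by fastforce
      show "\<epsilon> + \<delta> * V \<le> measure lborel E" using H(10) xyv(2) by linarith
      show "T \<le> 2 * R + V" using H(6) \<open>R \<ge> 0\<close> by (auto simp: max_def min_def split: if_splits)
    qed (rule H)+
    then show ?thesis by blast
  qed
  then obtain \<gamma> T V E where "\<And>n. Pr n (\<gamma> n) (T n) (V n) (E n)" by metis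
  then have \<gamma>: "\<And>n s t. norm1 (\<gamma> n s - \<gamma> n t) \<le> \<bar>s - t\<bar>" "\<And>n. T n \<ge> 0"
     "\<And>n s. s \<ge> T n \<Longrightarrow> \<gamma> n s = \<gamma> n (T n)" "\<And>n s. s \<le> 0 \<Longrightarrow> \<gamma> n s = \<gamma> n 0"
     "\<And>n. 0 \<le> V n" "\<And>n. T n \<le> 2 * R + V n"
     "\<And>n. E n \<in> sets borel" "\<And>n. E n \<subseteq> {-R..R}" "\<And>n. E n \<subseteq> fst ` (G n \<inter> range (\<gamma> n))"
     "\<And>n. \<epsilon> + \<delta> * V n \<le> measure lborel (E n)"
    unfolding Pr_def by blast+
  define \<Lambda> where "\<Lambda> = 2 * R + 2 * R / \<delta>"
  have "\<Lambda> \<ge> 0" using \<open>R \<ge> 0\<close> \<open>0 < \<delta>\<close> by (simp add: \<Lambda>_def)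
  have Elm: "E n \<in> lmeasurable" for n
    using \<gamma>(7,8) by (intro bounded_set_imp_lmeasurable) (auto intro: bounded_subset[OF bounded_closed_interval])
  have E2R: "measure lborel (E n) \<le> 2 * R" for n
  proof -
    have "measure lebesgue (E n) \<le> measure lebesgue {-R..R}"
      by (rule measure_mono_fmeasurable) (use Elm[of n] \<gamma>(8)[of n] in auto)
    then show ?thesis using \<open>R \<ge> 0\<close> \<gamma>(7)[of n] by simp
  qed
  have T\<Lambda>: "T n \<le> \<Lambda>" for n
  proof -
    have "\<delta> * V n \<le> 2 * R" using \<gamma>(10)[of n] E2R[of n] \<open>0 < \<epsilon>\<close> by linarith
    then have "V n \<le> 2 * R / \<delta>" using \<open>0 < \<delta>\<close> by (simp add: field_simps)
    then show ?thesis using \<gamma>(6)[of n] by (simp add: \<Lambda>_def)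
  qed
  have clip: "\<exists>t\<in>{0..\<Lambda>}. \<gamma> n s = \<gamma> n t" for n s
  proof -
    consider "s \<le> 0" | "s \<ge> T n" | "0 \<le> s \<and> s \<le> T n" by linarith
    then show ?thesis
    proof cases
      case 1 then show ?thesis using \<gamma>(4) \<open>\<Lambda> \<ge> 0\<close> by (metis atLeastAtMost_iff order_refl)
    next
      case 2 then show ?thesis using \<gamma>(2,3) T\<Lambda> by (metis atLeastAtMost_iff)
    next
      case 3 then show ?thesis using T\<Lambda> by (metis atLeastAtMost_iff order_trans)
    qed
  qed
  have lipn: "norm (\<gamma> n s - \<gamma> n t) \<le> \<bar>s - t\<bar>" for n s t using \<gamma>(1) norm_le_norm1 order_trans by blast
  have bnd: "norm (\<gamma> n s) \<le> R + \<Lambda>" if "s \<in> {0..\<Lambda>}" for n s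
  proof -
    have "E n \<noteq> {}" using \<gamma>(10)[of n] \<open>0 < \<epsilon>\<close> \<open>0 < \<delta>\<close> \<gamma>(5)[of n] by (smt (verit) measure_empty mult_nonneg_nonneg)
    then obtain s0 where "\<gamma> n s0 \<in> G n" using \<gamma>(9)[of n] by blast
    then obtain t where t: "t \<in> {0..\<Lambda>}" "\<gamma> n t \<in> G n" using clip by metis
    have "norm (\<gamma> n s) \<le> norm (\<gamma> n t) + norm (\<gamma> n s - \<gamma> n t)" by (metis norm_triangle_sub)
    then show ?thesis using GR[OF t(2)] lipn[of n s t] t(1) that by auto
  qed
  obtain g k where g: "continuous_on {0..\<Lambda>} g" "strict_mono (k :: nat \<Rightarrow> nat)"
    "\<And>e. 0 < e \<Longrightarrow> \<exists>N. \<forall>n x. n \<ge> N \<and> x \<in> {0..\<Lambda>} \<longrightarrow> norm (\<gamma> (k n) x - g x) < e"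
  proof (rule Arzela_Ascoli[of "{0..\<Lambda>}" \<gamma> "R + \<Lambda>"])
    fix x e :: real assume "0 < e"
    then show "\<exists>d>0. \<forall>n y. y \<in> {0..\<Lambda>} \<and> norm (x - y) < d \<longrightarrow> norm (\<gamma> n x - \<gamma> n y) < e"
      using lipn by (intro exI[of _ e]) (auto intro: le_less_trans)
  qed (use bnd in auto)
  have lim: "(\<lambda>n. \<gamma> (k n) x) \<longlonglongrightarrow> g x" if "x \<in> {0..\<Lambda>}" for x
    unfolding LIMSEQ_iff using g(3) that by blast
  define cl where "cl s = max 0 (min \<Lambda> s)" for s
  have cl: "cl s \<in> {0..\<Lambda>}" "\<bar>cl s - cl t\<bar> \<le> \<bar>s - t\<bar>" for s t using \<open>\<Lambda> \<ge> 0\<close> by (auto simp: cl_def)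
  have "1-lipschitz_on UNIV (\<lambda>s. g (cl s))"
  proof (rule lipschitz_onI)
    fix s t
    have "norm (g (cl s) - g (cl t)) \<le> \<bar>cl s - cl t\<bar>"
      by (rule tendsto_le[OF _ tendsto_const tendsto_norm[OF tendsto_diff[OF lim lim]]])
        (use cl lipn in auto)
    then show "dist (g (cl s)) (g (cl t)) \<le> 1 * dist s t"
      using cl(2)[of s t] by (simp add: dist_norm)
  qed simp
  then have neglP: "negligible (fst ` (S \<inter> range (\<lambda>s. g (cl s))))" by (rule proj)
  obtain U where U: "open U" "fst ` (S \<inter> range (\<lambda>s. g (cl s))) \<subseteq> U" "U \<in> lmeasurable" "measure lebesgue U < \<epsilon>"
    using negligible_imp_small_open[OF neglP \<open>0 < \<epsilon>\<close>] by blast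
  \<comment> \<open>Otherwise points of the curves near S whose projection avoids the open set U would
    accumulate at a point of S on the limit curve with projection outside U.\<close>
  have "\<exists>m. E (k m) \<subseteq> U"
  proof (rule ccontr)
    assume nsub: "\<not> ?thesis"
    have "\<exists>t\<in>{0..\<Lambda>}. \<gamma> (k m) t \<in> G (k m) \<and> fst (\<gamma> (k m) t) \<notin> U" for m
    proof -
      obtain e where "e \<in> E (k m)" "e \<notin> U" using nsub by blast
      then obtain s where "e = fst (\<gamma> (k m) s)" "\<gamma> (k m) s \<in> G (k m)" using \<gamma>(9)[of "k m"] by blast
      then show ?thesis using clip[of "k m" s] \<open>e \<notin> U\<close> by metis
    qed
    then obtain t where t: "\<And>m. t m \<in> {0..\<Lambda>}" "\<And>m. \<gamma> (k m) (t m) \<in> G (k m)" "\<And>m. fst (\<gamma> (k m) (t m)) \<notin> U"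
      by metis
    obtain t0 r where r: "t0 \<in> {0..\<Lambda>}" "strict_mono (r :: nat \<Rightarrow> nat)" "(t \<circ> r) \<longlonglongrightarrow> t0"
      using compact_Icc[of 0 \<Lambda>] t(1) unfolding compact_def by metis
    have "(\<lambda>m. g (t (r m))) \<longlonglongrightarrow> g t0"
      using continuous_on_tendsto_compose[OF g(1) r(3) r(1)] t(1) by (simp add: comp_def)
    moreover have "(\<lambda>m. \<gamma> (k (r m)) (t (r m)) - g (t (r m))) \<longlonglongrightarrow> 0"
      unfolding LIMSEQ_iff
    proof (intro allI impI)
      fix e :: real assume "0 < e"
      then obtain N where "\<forall>n x. n \<ge> N \<and> x \<in> {0..\<Lambda>} \<longrightarrow> norm (\<gamma> (k n) x - g x) < e" using g(3) by blast
      then show "\<exists>no. \<forall>n\<ge>no. norm (\<gamma> (k (r n)) (t (r n)) - g (t (r n)) - 0) < e"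
        using t(1) seq_suble[OF r(2)] by (intro exI[of _ N]) (metis diff_zero order_trans)
    qed
    ultimately have lg: "(\<lambda>m. \<gamma> (k (r m)) (t (r m))) \<longlonglongrightarrow> g t0"
      using tendsto_add by fastforce
    have "infdist (g t0) S \<le> 0"
    proof (rule LIMSEQ_le[OF tendsto_infdist[OF lg]])
      show "(\<lambda>m. 1 / real (Suc m)) \<longlonglongrightarrow> 0" by (rule lim_1_over_n[THEN LIMSEQ_Suc])
      have "infdist (\<gamma> (k (r m)) (t (r m))) S \<le> 1 / real (Suc m)" for m
      proof -
        have "infdist (\<gamma> (k (r m)) (t (r m))) S < 1 / real (Suc (k (r m)))" using t(2)[of "r m"] by (simp add: G_def)
        also have "\<dots> \<le> 1 / real (Suc m)"
          using seq_suble[OF g(2), of "r m"] seq_suble[OF r(2), of m] by (intro divide_left_mono) auto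
        finally show ?thesis by simp
      qed
      then show "\<exists>N. \<forall>n\<ge>N. infdist (\<gamma> (k (r n)) (t (r n))) S \<le> 1 / real (Suc n)" by blast
    qed
    then have "g t0 \<in> S"
      using in_closed_iff_infdist_zero[OF compact_imp_closed[OF \<open>compact S\<close>] \<open>S \<noteq> {}\<close>] infdist_nonneg by (metis antisym)
    moreover have "cl t0 = t0" using r(1) by (simp add: cl_def)
    then have "g t0 \<in> range (\<lambda>s. g (cl s))" by (metis rangeI)
    ultimately have "fst (g t0) \<in> U" using U(2) by blast
    moreover have "fst (g t0) \<in> - U"
      by (rule Lim_in_closed_set[OF _ _ _ tendsto_fst[OF lg]]) (use U(1) t(3) in auto)
    ultimately show False by simp
  qed
  then obtain m where "E (k m) \<subseteq> U" by blast
  then have "measure lebesgue (E (k m)) \<le> measure lebesgue U"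
    by (intro measure_mono_fmeasurable) (use Elm U in auto)
  then have "measure lborel (E (k m)) < \<epsilon>" using U(4) \<gamma>(7)[of "k m"] by simp
  then show False using \<gamma>(5,10)[of "k m"] \<open>0 < \<delta>\<close> by (smt (verit) mult_nonneg_nonneg)
qed

section \<open>Small bumps with prescribed gradient near the set\<close>

definition max_gain :: "real \<Rightarrow> (real \<times> real) set \<Rightarrow> real \<Rightarrow> real \<Rightarrow> real" where
  "max_gain \<delta> G x y = Sup {v. gain \<delta> G x y v}"

context
  fixes \<delta> \<epsilon> :: real and G :: "(real \<times> real) set"
  assumes bound: "\<And>x y v. gain \<delta> G x y v \<Longrightarrow> v \<le> \<epsilon>"
begin

lemma gain_le_max_gain: "gain \<delta> G x y v \<Longrightarrow> v \<le> max_gain \<delta> G x y"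
  unfolding max_gain_def by (rule cSup_upper) (auto intro!: bdd_aboveI bound)

lemma max_gain_least: "(\<And>v. gain \<delta> G x y v \<Longrightarrow> v \<le> c) \<Longrightarrow> max_gain \<delta> G x y \<le> c"
  unfolding max_gain_def by (rule cSup_least) (use gain.start[of \<delta> G x y] in blast, blast)

lemma max_gain_nonneg: "0 \<le> max_gain \<delta> G x y"
  by (rule gain_le_max_gain[OF gain.start])

lemma max_gain_le: "max_gain \<delta> G x y \<le> \<epsilon>"
  by (rule max_gain_least[OF bound])

lemma max_gain_mono: "x \<le> x' \<Longrightarrow> max_gain \<delta> G x y \<le> max_gain \<delta> G x' y"
  by (rule max_gain_least) (rule gain_le_max_gain[OF gain.right])

lemma max_gain_through:
  assumes "x \<le> x'" "\<And>t. x \<le> t \<Longrightarrow> t \<le> x' \<Longrightarrow> (t, y) \<in> G"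
  shows "max_gain \<delta> G x y + (x' - x) \<le> max_gain \<delta> G x' y"
proof -
  have "max_gain \<delta> G x y \<le> max_gain \<delta> G x' y - (x' - x)"
  proof (rule max_gain_least)
    fix v assume "gain \<delta> G x y v"
    then have "gain \<delta> G x' y (v + (x' - x))" by (rule gain.through) (use assms in auto)
    then show "v \<le> max_gain \<delta> G x' y - (x' - x)" using gain_le_max_gain by fastforce
  qed
  then show ?thesis by simp
qed

lemma max_gain_vertical: "\<bar>max_gain \<delta> G x y - max_gain \<delta> G x y'\<bar> \<le> \<delta> * \<bar>y - y'\<bar>"
proof -
  have "max_gain \<delta> G x y \<le> max_gain \<delta> G x y' + \<delta> * \<bar>y - y'\<bar>" for y y'
  proof (rule max_gain_least)
    fix v assume "gain \<delta> G x y v"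
    then have "v - \<delta> * \<bar>y' - y\<bar> \<le> max_gain \<delta> G x y'" by (rule gain_le_max_gain[OF gain.vertical])
    then show "v \<le> max_gain \<delta> G x y' + \<delta> * \<bar>y - y'\<bar>" by (simp add: abs_minus_commute)
  qed
  from this[of y y'] this[of y' y] show ?thesis by (simp add: abs_minus_commute abs_le_iff)
qed

text \<open>
  A chain ending at \<open>(x', y)\<close> is compared with its truncation at the abscissa \<open>x\<close>; what is cut off
  earns at most \<open>x' - x\<close>. The induction has to carry an arbitrary \<open>x\<close> to the left of the current end point.
\<close>

lemma max_gain_upper: "x \<le> x' \<Longrightarrow> max_gain \<delta> G x' y \<le> max_gain \<delta> G x y + (x' - x)"
proof (rule max_gain_least)
  fix v assume "gain \<delta> G x' y v" "x \<le> x'"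
  then show "v \<le> max_gain \<delta> G x y + (x' - x)"
  proof (induction arbitrary: x rule: gain.induct)
    case (start x' y)
    then show ?case using max_gain_nonneg[of x y] by linarith
  next
    case (right x1 y v x')
    show ?case
    proof (cases "x \<le> x1")
      case True
      then show ?thesis using right.IH[OF True] right.hyps by linarith
    next
      case False
      then have "v \<le> max_gain \<delta> G x y" by (intro gain_le_max_gain[OF gain.right[OF right.hyps(1)]]) simp
      then show ?thesis using right.prems by linarith
    qed
  next
    case (through x1 y v x')
    show ?case
    proof (cases "x \<le> x1")
      case True
      then show ?thesis using through.IH[OF True] through.hyps by linarith
    next
      case False
      then have "v + (x - x1) \<le> max_gain \<delta> G x y"
        by (intro gain_le_max_gain[OF gain.through[OF through.hyps(1)]] through.hyps(3)) (use through.prems False in auto)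
      then show ?thesis by linarith
    qed
  next
    case (vertical x1 y v y')
    show ?case using vertical.IH[OF vertical.prems] max_gain_vertical[of x y y'] by (simp add: abs_minus_commute)
  qed
qed

end

lemma derivative_bounds:
  fixes f :: "'a::real_normed_vector \<Rightarrow> real"
  assumes "(f has_derivative D) (at z)" "0 < r"
    and "\<And>t. 0 < t \<Longrightarrow> t < r \<Longrightarrow> lo * t \<le> f (z + t *\<^sub>R v) - f z \<and> f (z + t *\<^sub>R v) - f z \<le> hi * t"
  shows "lo \<le> D v \<and> D v \<le> hi"
proof -
  have "((\<lambda>t. f (z + t *\<^sub>R v)) has_derivative (\<lambda>t. D (t *\<^sub>R v))) (at (0::real))"
  proof (rule has_derivative_compose[of "\<lambda>t. z + t *\<^sub>R v" "\<lambda>t. t *\<^sub>R v"])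
    show "((\<lambda>t. z + t *\<^sub>R v) has_derivative (\<lambda>t. t *\<^sub>R v)) (at 0)" by (auto intro!: derivative_eq_intros)
  qed (use assms(1) in simp)
  moreover have "D (t *\<^sub>R v) = D v * t" for t
    using has_derivative_bounded_linear[OF assms(1)] by (simp add: linear_simps)
  ultimately have "((\<lambda>t. f (z + t *\<^sub>R v)) has_real_derivative D v) (at 0)"
    by (simp add: has_field_derivative_def)
  then have "((\<lambda>t. (f (z + t *\<^sub>R v) - f z) / t) \<longlongrightarrow> D v) (at 0)"
    by (simp add: DERIV_def)
  then have lim: "((\<lambda>t. (f (z + t *\<^sub>R v) - f z) / t) \<longlongrightarrow> D v) (at_right 0)"
    by (rule tendsto_mono[rotated]) (simp add: at_le)
  have ev: "eventually (\<lambda>t. 0 < t \<and> t < r) (at_right 0)"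
    using assms(2) by (auto simp: eventually_at_right intro!: exI[of _ r])
  have "lo \<le> D v"
    by (rule tendsto_lowerbound[OF lim _ trivial_limit_at_right_real])
      (use ev assms(3) in \<open>auto simp: field_simps elim!: eventually_mono\<close>)
  moreover have "D v \<le> hi"
    by (rule tendsto_upperbound[OF lim _ trivial_limit_at_right_real])
      (use ev assms(3) in \<open>auto simp: field_simps elim!: eventually_mono\<close>)
  ultimately show ?thesis by simp
qed

text \<open>
  The best balance of chains for a small neighbourhood of \<open>S\<close>, multiplied by a cut-off function
  and mollified. The balance is at most \<open>\<epsilon>'\<close>, which is chosen so small that multiplication by the
  cut-off function changes the slopes by no more than \<open>\<delta> / 2\<close>.
\<close>

lemma horizontal_bump:
  fixes S :: "(real \<times> real) set"
  assumes "compact S" "S \<noteq> {}"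
    and proj: "\<And>(\<gamma> :: real \<Rightarrow> real \<times> real) C. C-lipschitz_on UNIV \<gamma> \<Longrightarrow> negligible (fst ` (S \<inter> range \<gamma>))"
    and "0 < \<delta>" "0 < \<epsilon>" "open \<Omega>" "S \<subseteq> \<Omega>"
  shows "\<exists>h W K. smooth_on UNIV h \<and> open W \<and> S \<subseteq> W \<and> closed K \<and> K \<subseteq> \<Omega> \<and> (\<forall>z. z \<notin> K \<longrightarrow> h z = 0) \<and>
     (\<forall>z. 0 \<le> h z \<and> h z \<le> \<epsilon>) \<and>
     (\<forall>z. - \<delta> \<le> frechet_derivative h (at z) (1, 0) \<and> frechet_derivative h (at z) (1, 0) \<le> 1 + \<delta> \<and>
        \<bar>frechet_derivative h (at z) (0, 1)\<bar> \<le> \<delta>) \<and>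
     (\<forall>z\<in>W. frechet_derivative h (at z) (1, 0) = 1)"
proof -
  define ds where "ds z = infdist z S" for z
  have ds: "\<bar>ds z - ds w\<bar> \<le> dist z w" "0 \<le> ds z" for z w
    by (auto simp: ds_def infdist_triangle_abs infdist_nonneg)
  have ds0: "ds z = 0" if "z \<in> S" for z using that by (simp add: ds_def)
  have contds: "continuous_on UNIV ds" unfolding ds_def[abs_def] by (intro continuous_intros)
  obtain r where r: "r > 0" "(\<Union>x\<in>S. ball x r) \<subseteq> \<Omega>"
    using compact_subset_open_imp_ball_epsilon_subset[OF \<open>compact S\<close> \<open>open \<Omega>\<close> \<open>S \<subseteq> \<Omega>\<close>] by blast
  have near: "z \<in> \<Omega>" if "ds z < r" for z
  proof -
    obtain a where "a \<in> S" "ds z = dist z a"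
      using infdist_attains_inf[OF compact_imp_closed[OF \<open>compact S\<close>] \<open>S \<noteq> {}\<close>, of z] ds_def by auto
    then have "z \<in> (\<Union>x\<in>S. ball x r)" using that by (auto simp: dist_commute)
    then show ?thesis using r(2) by blast
  qed
  define \<epsilon>' where "\<epsilon>' = min \<epsilon> (\<delta> * r / 8)"
  have "\<epsilon>' > 0" using assms(4,5) r(1) by (simp add: \<epsilon>'_def)
  have \<epsilon>'r: "\<epsilon>' * (4 / r) \<le> \<delta> / 2"
  proof -
    have "\<epsilon>' * (4 / r) \<le> (\<delta> * r / 8) * (4 / r)" using r(1) by (intro mult_right_mono) (auto simp: \<epsilon>'_def)
    then show ?thesis using r(1) by simp
  qed
  have \<delta>2: "\<delta> / 2 > 0" using \<open>0 < \<delta>\<close> by simp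
  obtain d where d: "d > 0" "\<And>x y v. gain (\<delta> / 2) {z. ds z < d} x y v \<Longrightarrow> v \<le> \<epsilon>'"
  proof -
    have "\<exists>d>0. \<forall>x y v. gain (\<delta> / 2) {z. infdist z S < d} x y v \<longrightarrow> v \<le> \<epsilon>'"
      by (rule gain_small[OF assms(1,2) _ \<delta>2 \<open>\<epsilon>' > 0\<close>]) (erule proj)
    then show thesis using that unfolding ds_def by blast
  qed
  define G where "G = {z. ds z < d}"
  have bound: "v \<le> \<epsilon>'" if "gain (\<delta> / 2) G x y v" for x y v using d(2) that unfolding G_def .
  define \<phi> where "\<phi> z = max_gain (\<delta> / 2) G (fst z) (snd z)" for z
  have \<phi>: "0 \<le> \<phi> z" "\<phi> z \<le> \<epsilon>'" for z
    unfolding \<phi>_def by (rule max_gain_nonneg, erule bound) (rule max_gain_le, erule bound)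
  have \<phi>x: "0 \<le> \<phi> (z + (t, 0)) - \<phi> z" "\<phi> (z + (t, 0)) - \<phi> z \<le> t" if "0 \<le> t" for z t
  proof -
    have "max_gain (\<delta> / 2) G (fst z) (snd z) \<le> max_gain (\<delta> / 2) G (fst z + t) (snd z)"
      by (rule max_gain_mono, erule bound) (use that in simp)
    moreover have "max_gain (\<delta> / 2) G (fst z + t) (snd z) \<le> max_gain (\<delta> / 2) G (fst z) (snd z) + (fst z + t - fst z)"
      by (rule max_gain_upper, erule bound) (use that in simp)
    ultimately show "0 \<le> \<phi> (z + (t, 0)) - \<phi> z" "\<phi> (z + (t, 0)) - \<phi> z \<le> t" by (simp_all add: \<phi>_def)
  qed
  have \<phi>y: "\<bar>\<phi> (z + (0, t)) - \<phi> z\<bar> \<le> \<delta> / 2 * \<bar>t\<bar>" for z t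
  proof -
    have "\<bar>max_gain (\<delta> / 2) G (fst z) (snd z + t) - max_gain (\<delta> / 2) G (fst z) (snd z)\<bar> \<le> \<delta> / 2 * \<bar>snd z + t - snd z\<bar>"
      by (rule max_gain_vertical, erule bound)
    then show ?thesis by (simp add: \<phi>_def)
  qed
  have \<phi>G: "\<phi> (z + (t, 0)) - \<phi> z = t" if "0 \<le> t" "\<And>s. 0 \<le> s \<Longrightarrow> s \<le> t \<Longrightarrow> z + (s, 0) \<in> G" for z t
  proof -
    have "(s, snd z) \<in> G" if "fst z \<le> s" "s \<le> fst z + t" for s
      using \<open>\<And>s. 0 \<le> s \<Longrightarrow> s \<le> t \<Longrightarrow> z + (s, 0) \<in> G\<close>[of "s - fst z"] that by (simp add: plus_prod_def)
    note seg = this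
    have "max_gain (\<delta> / 2) G (fst z) (snd z) + (fst z + t - fst z) \<le> max_gain (\<delta> / 2) G (fst z + t) (snd z)"
      by (rule max_gain_through, erule bound) (use that(1) in simp, rule seg)
    then show ?thesis using \<phi>x(2)[OF that(1), of z] by (simp add: \<phi>_def)
  qed
  \<comment> \<open>The cut-off function: 1 within distance r/4 of S, 0 beyond r/2, with Lipschitz constant 4/r.\<close>
  define \<theta> where "\<theta> z = max 0 (min 1 (2 - 4 * ds z / r))" for z
  have \<theta>: "0 \<le> \<theta> z" "\<theta> z \<le> 1" for z by (auto simp: \<theta>_def)
  have \<theta>1: "\<theta> z = 1" if "ds z \<le> r / 4" for z using that r(1) by (simp add: \<theta>_def field_simps)
  have \<theta>0: "\<theta> z = 0" if "r / 2 \<le> ds z" for z using that r(1) by (simp add: \<theta>_def field_simps)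
  have \<theta>l: "\<bar>\<theta> z - \<theta> w\<bar> \<le> 4 / r * dist z w" for z w
  proof -
    have "\<bar>\<theta> z - \<theta> w\<bar> \<le> \<bar>(2 - 4 * ds z / r) - (2 - 4 * ds w / r)\<bar>" by (auto simp: \<theta>_def)
    also have "(2 - 4 * ds z / r) - (2 - 4 * ds w / r) = 4 / r * (ds w - ds z)"
      by (simp add: right_diff_distrib)
    also have "\<bar>4 / r * (ds w - ds z)\<bar> = 4 / r * \<bar>ds z - ds w\<bar>"
      using r(1) by (simp only: abs_mult abs_minus_commute[of "ds w"]) simp
    also have "\<dots> \<le> 4 / r * dist z w" using ds(1) r(1) by (intro mult_left_mono) auto
    finally show ?thesis .
  qed
  define f where "f z = \<theta> z * \<phi> z" for z
  have prodb: "\<bar>\<phi> z * (\<theta> w - \<theta> z)\<bar> \<le> \<delta> / 2 * dist w z" for z w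
  proof -
    have "\<bar>\<phi> z * (\<theta> w - \<theta> z)\<bar> \<le> \<epsilon>' * (4 / r * dist w z)"
      unfolding abs_mult using \<phi>[of z] \<theta>l[of w z] r(1) by (intro mult_mono) auto
    also have "\<dots> \<le> \<delta> / 2 * dist w z" using \<epsilon>'r mult_right_mono[of _ _ "dist w z"] by (metis mult.assoc zero_le_dist)
    finally show ?thesis .
  qed
  have fdec: "f w - f z = \<theta> w * (\<phi> w - \<phi> z) + \<phi> z * (\<theta> w - \<theta> z)" for w z by (simp add: f_def algebra_simps)
  have fx: "- \<delta> * t \<le> f (z + (t, 0)) - f z \<and> f (z + (t, 0)) - f z \<le> (1 + \<delta>) * t" if "0 \<le> t" for z t
  proof -
    have "\<bar>\<phi> z * (\<theta> (z + (t, 0)) - \<theta> z)\<bar> \<le> \<delta> / 2 * t"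
      using prodb[of z "z + (t, 0)"] that by (simp add: dist_norm norm_Pair)
    moreover have "0 \<le> \<theta> (z + (t, 0)) * (\<phi> (z + (t, 0)) - \<phi> z)"
      using \<theta> \<phi>x(1)[OF that] by (intro mult_nonneg_nonneg) auto
    moreover have "\<theta> (z + (t, 0)) * (\<phi> (z + (t, 0)) - \<phi> z) \<le> 1 * t"
      using \<theta> \<phi>x[OF that] that by (intro mult_mono) auto
    moreover have "\<delta> / 2 * t \<le> \<delta> * t" using \<open>0 < \<delta>\<close> that by simp
    moreover have "- \<delta> * t = - (\<delta> * t)" "(1 + \<delta>) * t = t + \<delta> * t" by (simp_all add: algebra_simps)
    ultimately show ?thesis unfolding fdec by linarith
  qed
  have fy: "\<bar>f (z + (0, t)) - f z\<bar> \<le> \<delta> * \<bar>t\<bar>" for z t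
  proof -
    have "\<bar>\<phi> z * (\<theta> (z + (0, t)) - \<theta> z)\<bar> \<le> \<delta> / 2 * \<bar>t\<bar>"
      using prodb[of z "z + (0, t)"] by (simp add: dist_norm norm_Pair)
    moreover have "\<bar>\<theta> (z + (0, t)) * (\<phi> (z + (0, t)) - \<phi> z)\<bar> \<le> 1 * (\<delta> / 2 * \<bar>t\<bar>)"
      unfolding abs_mult[of "\<theta> (z + (0, t))"] using \<theta> \<phi>y by (intro mult_mono) auto
    ultimately show ?thesis unfolding fdec by linarith
  qed
  have flip: "\<bar>f w - f z\<bar> \<le> (1 + 2 * \<delta>) * dist w z" for w z
  proof -
    define p where "p = (fst w, snd z)"
    have h: "\<bar>f q' - f q\<bar> \<le> (1 + \<delta>) * \<bar>fst q' - fst q\<bar>" if "snd q' = snd q" "fst q \<le> fst q'" for q q' :: "real \<times> real"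
    proof -
      have "q' = q + (fst q' - fst q, 0)" using that by (simp add: prod_eq_iff)
      then show ?thesis using fx[of "fst q' - fst q" q] that \<open>0 < \<delta>\<close>
        by (auto simp: abs_le_iff algebra_simps)
    qed
    have "\<bar>f p - f z\<bar> \<le> (1 + \<delta>) * \<bar>fst p - fst z\<bar>"
      using h[of p z] h[of z p] by (cases "fst z \<le> fst p") (auto simp: p_def abs_minus_commute)
    moreover have "w = p + (0, snd w - snd p)" by (simp add: prod_eq_iff p_def)
    then have "\<bar>f w - f p\<bar> \<le> \<delta> * \<bar>snd w - snd z\<bar>" using fy[of p "snd w - snd p"] by (simp add: p_def)
    moreover have "\<bar>fst p - fst z\<bar> \<le> dist w z" "\<bar>snd w - snd z\<bar> \<le> dist w z"
      using dist_fst_le[of w z] dist_snd_le[of w z] by (auto simp: p_def dist_real_def)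
    then have "(1 + \<delta>) * \<bar>fst p - fst z\<bar> \<le> (1 + \<delta>) * dist w z" "\<delta> * \<bar>snd w - snd z\<bar> \<le> \<delta> * dist w z"
      using \<open>0 < \<delta>\<close> by (auto intro!: mult_left_mono)
    ultimately show ?thesis by (simp add: algebra_simps)
  qed
  have contf: "continuous_on UNIV f"
  proof (rule lipschitz_on_continuous_on[of "1 + 2 * \<delta>"], rule lipschitz_onI)
    show "dist (f x) (f y) \<le> (1 + 2 * \<delta>) * dist x y" for x y using flip[of x y] by (simp add: dist_real_def)
  qed (use \<open>0 < \<delta>\<close> in simp)
  have f0: "f z = 0" if "r / 2 \<le> ds z" for z using \<theta>0[OF that] by (simp add: f_def)
  obtain B where B: "\<And>z. z \<in> S \<Longrightarrow> norm z \<le> B" using compact_imp_bounded[OF \<open>compact S\<close>] unfolding bounded_iff by blast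
  have "bounded {z. ds z < r / 2}"
    unfolding bounded_iff
  proof (intro exI[of _ "B + r"] ballI)
    fix z assume z: "z \<in> {z. ds z < r / 2}"
    obtain a where "a \<in> S" "ds z = dist z a"
      using infdist_attains_inf[OF compact_imp_closed[OF \<open>compact S\<close>] \<open>S \<noteq> {}\<close>, of z] ds_def by auto
    then show "norm z \<le> B + r" using B[of a] norm_triangle_sub[of z a] z r(1) by (simp add: dist_norm)
  qed
  then obtain a where a: "{z. ds z < r / 2} \<subseteq> cbox (- a) a" using bounded_subset_cbox_symmetric by metis
  \<comment> \<open>Balls of radius tau around points of W, and their shifts by less than tau, stay in the
    region where the balance has slope 1 and the cut-off function is 1.\<close>
  define \<tau> where "\<tau> = min (r / 12) (d / 4)"
  have "\<tau> > 0" using r(1) d(1) by (simp add: \<tau>_def)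
  have \<tau>: "\<tau> \<le> r / 12" "\<tau> \<le> d / 4" by (simp_all add: \<tau>_def)
  have dsb: "ds w < ds z + \<tau>" "ds z < ds w + \<tau>" if "w \<in> ball z \<tau>" for w z
    using ds(1)[of w z] that by (auto simp: dist_commute)
  have supp: "f z = 0" if "z \<notin> cbox (- a) a" for z using a f0[of z] that by force
  obtain h where h: "smooth_on UNIV h"
    "\<And>z lo hi. (\<And>w. w \<in> ball z \<tau> \<Longrightarrow> lo \<le> f w \<and> f w \<le> hi) \<Longrightarrow> lo \<le> h z \<and> h z \<le> hi"
    "\<And>z v lo hi. (\<And>w. w \<in> ball z \<tau> \<Longrightarrow> lo \<le> f (w + v) - f w \<and> f (w + v) - f w \<le> hi)
       \<Longrightarrow> lo \<le> h (z + v) - h z \<and> h (z + v) - h z \<le> hi"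
    using mollify[OF contf supp \<open>\<tau> > 0\<close>] by blast
  have hd: "(h has_derivative frechet_derivative h (at z)) (at z)" for z
    using smooth_on_has_derivative[OF h(1)] by simp
  define W where "W = {z. ds z < \<tau>}"
  define K where "K = {z. ds z \<le> 3 * r / 4}"
  show ?thesis
  proof (rule exI[of _ h], rule exI[of _ W], rule exI[of _ K], intro conjI allI ballI impI)
    show "smooth_on UNIV h" by fact
    show "open W" unfolding W_def using contds by (intro open_Collect_less) (auto intro: continuous_intros)
    show "closed K" unfolding K_def using contds by (intro closed_Collect_le) (auto intro: continuous_intros)
    show "S \<subseteq> W" using ds0 \<open>\<tau> > 0\<close> by (auto simp: W_def)
    show "K \<subseteq> \<Omega>" using near r(1) by (auto simp: K_def)
    show "h z = 0" if "z \<notin> K" for z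
    proof -
      have "0 \<le> h z \<and> h z \<le> 0"
      proof (rule h(2))
        fix w assume "w \<in> ball z \<tau>"
        then have "r / 2 \<le> ds w" using dsb[of w z] that r(1) \<tau>(1) by (simp add: K_def)
        then show "0 \<le> f w \<and> f w \<le> 0" using f0 by simp
      qed
      then show ?thesis by simp
    qed
    have f01: "0 \<le> f w \<and> f w \<le> \<epsilon>" for w
      using mult_mono[of "\<theta> w" 1 "\<phi> w" \<epsilon>'] \<theta>[of w] \<phi>[of w] by (auto simp: f_def \<epsilon>'_def)
    show "0 \<le> h z" "h z \<le> \<epsilon>" for z using h(2)[of z 0 \<epsilon>] f01 by auto
    have "- \<delta> \<le> frechet_derivative h (at z) (1, 0) \<and> frechet_derivative h (at z) (1, 0) \<le> 1 + \<delta>" for z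
    proof (rule derivative_bounds[OF hd, of 1])
      fix t :: real assume "0 < t"
      then have "- \<delta> * t \<le> f (w + (t, 0)) - f w \<and> f (w + (t, 0)) - f w \<le> (1 + \<delta>) * t" for w
        by (intro fx) simp
      then show "- \<delta> * t \<le> h (z + t *\<^sub>R (1, 0)) - h z \<and> h (z + t *\<^sub>R (1, 0)) - h z \<le> (1 + \<delta>) * t"
        using h(3)[of z "- \<delta> * t" "(t, 0)" "(1 + \<delta>) * t"] by simp
    qed simp
    then show "- \<delta> \<le> frechet_derivative h (at z) (1, 0)" "frechet_derivative h (at z) (1, 0) \<le> 1 + \<delta>" for z
      by auto
    have "- \<delta> \<le> frechet_derivative h (at z) (0, 1) \<and> frechet_derivative h (at z) (0, 1) \<le> \<delta>" for z
    proof (rule derivative_bounds[OF hd, of 1])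
      fix t :: real assume "0 < t"
      then have "- \<delta> * t \<le> f (w + (0, t)) - f w \<and> f (w + (0, t)) - f w \<le> \<delta> * t" for w
        using fy[of w t] by (simp add: abs_le_iff)
      then show "- \<delta> * t \<le> h (z + t *\<^sub>R (0, 1)) - h z \<and> h (z + t *\<^sub>R (0, 1)) - h z \<le> \<delta> * t"
        using h(3)[of z "- \<delta> * t" "(0, t)" "\<delta> * t"] by simp
    qed simp
    then show "\<bar>frechet_derivative h (at z) (0, 1)\<bar> \<le> \<delta>" for z by (simp add: abs_le_iff minus_le_iff)
    show "frechet_derivative h (at z) (1, 0) = 1" if "z \<in> W" for z
    proof -
      have "1 \<le> frechet_derivative h (at z) (1, 0) \<and> frechet_derivative h (at z) (1, 0) \<le> 1"
      proof (rule derivative_bounds[OF hd \<open>\<tau> > 0\<close>])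
        fix t assume t: "0 < t" "t < \<tau>"
        have "f (w + (t, 0)) - f w = t" if w: "w \<in> ball z \<tau>" for w
        proof -
          have s: "ds (w + (s, 0)) < 3 * \<tau>" if "0 \<le> s" "s \<le> t" for s
            using dsb(1)[OF w] ds(1)[of "w + (s, 0)" w] \<open>z \<in> W\<close> that t by (simp add: W_def dist_norm norm_Pair)
          have "w + (s, 0) \<in> G" if "0 \<le> s" "s \<le> t" for s
            using s[OF that] d(1) \<tau>(2) by (simp add: G_def)
          then have "\<phi> (w + (t, 0)) - \<phi> w = t" using t by (intro \<phi>G) auto
          moreover have "\<theta> w = 1" using dsb(1)[OF w] \<open>z \<in> W\<close> \<tau>(1) r(1) by (intro \<theta>1) (simp add: W_def)
          moreover have "\<theta> (w + (t, 0)) = 1"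
          proof (rule \<theta>1)
            show "ds (w + (t, 0)) \<le> r / 4"
              using dsb(1)[OF w] ds(1)[of "w + (t, 0)" w] \<open>z \<in> W\<close> t \<tau>(1)
              by (simp add: W_def dist_norm norm_Pair)
          qed
          ultimately show ?thesis by (simp add: f_def)
        qed
        then show "1 * t \<le> h (z + t *\<^sub>R (1, 0)) - h z \<and> h (z + t *\<^sub>R (1, 0)) - h z \<le> 1 * t"
          using h(3)[of z t "(t, 0)" t] by simp
      qed
      then show ?thesis by simp
    qed
  qed
qed

text \<open>
  In the coordinates \<open>M (x, y) = (- a x + b y, y)\<close> the gradient \<open>(- a, b)\<close> becomes horizontal, and pure
  unrectifiability of \<open>S\<close> passes to \<open>M ` S\<close> in the form that \<open>horizontal_bump\<close> needs.
\<close>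

lemma directed_bump:
  fixes S :: "(real \<times> real) set"
  assumes "compact S" "purely_unrectifiable S" "0 < a" "0 < \<delta>" "0 < \<epsilon>" "open \<Omega>" "S \<subseteq> \<Omega>"
  shows "\<exists>g s W K. smooth_on UNIV g \<and> open W \<and> S \<subseteq> W \<and> closed K \<and> K \<subseteq> \<Omega> \<and> (\<forall>z. z \<notin> K \<longrightarrow> g z = 0) \<and>
     (\<forall>z. \<bar>g z\<bar> \<le> \<epsilon>) \<and>
     (\<forall>z. 0 \<le> s z \<and> s z \<le> 1 \<and> \<bar>frechet_derivative g (at z) (1, 0) + a * s z\<bar> \<le> \<delta> \<and>
        \<bar>frechet_derivative g (at z) (0, 1) - b * s z\<bar> \<le> \<delta>) \<and>
     (\<forall>z\<in>W. s z = (1::real))"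
proof (cases "S = {}")
  case True
  show ?thesis
    by (intro exI[of _ "\<lambda>_::real \<times> real. 0::real"] exI[of _ "{}::(real \<times> real) set"])
      (simp add: True less_imp_le[OF assms(4)] less_imp_le[OF assms(5)])
next
  case False
  define M where "M = (\<lambda>z::real \<times> real. (- a * fst z + b * snd z, snd z))"
  define M' where "M' = (\<lambda>z::real \<times> real. ((b * snd z - fst z) / a, snd z))"
  have MM': "M (M' z) = z" "M' (M z) = z" for z using \<open>0 < a\<close> by (auto simp: M_def M'_def prod_eq_iff)
  have blM: "bounded_linear M" unfolding M_def
    by (intro bounded_linear_Pair bounded_linear_add bounded_linear_const_mult bounded_linear_fst bounded_linear_snd)
  have blM': "bounded_linear M'" unfolding M'_def divide_inverse mult.commute[of _ "inverse a"]
    by (intro bounded_linear_Pair bounded_linear_sub bounded_linear_const_mult bounded_linear_fst bounded_linear_snd)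
  have contM: "continuous_on A M" "continuous_on A M'" for A
    using blM blM' by (auto intro: linear_continuous_on)
  have cS: "compact (M ` S)" using compact_continuous_image[OF contM(1) assms(1)] .
  have o\<Omega>: "open (M' -` \<Omega>)" using continuous_on_open_vimage[of UNIV M'] contM(2) assms(6) by auto
  have s\<Omega>: "M ` S \<subseteq> M' -` \<Omega>" using assms(7) MM' by auto
  have null: "negligible (fst ` (M ` S \<inter> range \<gamma>))" if lip\<gamma>: "C-lipschitz_on UNIV \<gamma>" for \<gamma> :: "real \<Rightarrow> real \<times> real" and C
  proof -
    obtain C' where C': "C'-lipschitz_on UNIV M'" using bounded_linear.lipschitz_boundE[OF blM'] by metis
    have "bounded_linear (\<lambda>z. fst (M z))" using blM by (rule bounded_linear_fst_comp)
    then obtain C'' where C'': "C''-lipschitz_on UNIV (\<lambda>z. fst (M z))" using bounded_linear.lipschitz_boundE by metis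
    have "(C' * C)-lipschitz_on UNIV (M' \<circ> \<gamma>)"
      using lipschitz_on_compose[OF lip\<gamma> lipschitz_on_subset[OF C' subset_UNIV]] .
    then have "negligible ((\<lambda>z. fst (M z)) ` (S \<inter> range (M' \<circ> \<gamma>)))"
      by (rule negligible_lipschitz_image_of_unrectifiable[OF assms(2) _ C''])
    moreover have "fst ` (M ` S \<inter> range \<gamma>) \<subseteq> (\<lambda>z. fst (M z)) ` (S \<inter> range (M' \<circ> \<gamma>))"
    proof
      fix x assume "x \<in> fst ` (M ` S \<inter> range \<gamma>)"
      then obtain p where p: "p \<in> M ` S" "p \<in> range \<gamma>" "x = fst p" by blast
      then obtain z t where z: "z \<in> S" "M z = \<gamma> t" "x = fst (M z)" by blast
      then have "z = (M' \<circ> \<gamma>) t" using MM'(2)[of z] by simp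
      then show "x \<in> (\<lambda>z. fst (M z)) ` (S \<inter> range (M' \<circ> \<gamma>))" using z by blast
    qed
    ultimately show ?thesis by (rule negligible_subset)
  qed
  define \<delta>' where "\<delta>' = \<delta> / (a + \<bar>b\<bar> + 1)"
  have "\<delta>' > 0" using assms(3,4) by (simp add: \<delta>'_def)
  have "\<exists>h W K. smooth_on UNIV h \<and> open W \<and> M ` S \<subseteq> W \<and> closed K \<and> K \<subseteq> M' -` \<Omega> \<and>
     (\<forall>z. z \<notin> K \<longrightarrow> h z = 0) \<and> (\<forall>z. 0 \<le> h z \<and> h z \<le> \<epsilon>) \<and>
     (\<forall>z. - \<delta>' \<le> frechet_derivative h (at z) (1, 0) \<and> frechet_derivative h (at z) (1, 0) \<le> 1 + \<delta>' \<and>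
        \<bar>frechet_derivative h (at z) (0, 1)\<bar> \<le> \<delta>') \<and>
     (\<forall>z\<in>W. frechet_derivative h (at z) (1, 0) = 1)"
    by (rule horizontal_bump[OF cS _ _ \<open>\<delta>' > 0\<close> assms(5) o\<Omega> s\<Omega>]) (use False in simp, erule null)
  then obtain h W K where H: "smooth_on UNIV h" "open W" "M ` S \<subseteq> W" "closed K" "K \<subseteq> M' -` \<Omega>"
    "\<forall>z. z \<notin> K \<longrightarrow> h z = 0" "\<forall>z. 0 \<le> h z \<and> h z \<le> \<epsilon>"
    "\<forall>z. - \<delta>' \<le> frechet_derivative h (at z) (1, 0) \<and> frechet_derivative h (at z) (1, 0) \<le> 1 + \<delta>' \<and>
        \<bar>frechet_derivative h (at z) (0, 1)\<bar> \<le> \<delta>'"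
    "\<forall>z\<in>W. frechet_derivative h (at z) (1, 0) = 1"
    by (elim exE conjE) (rule that; assumption)
  note h = H[rule_format]
  define g where "g z = h (M z)" for z
  define s where "s z = max 0 (min 1 (frechet_derivative h (at (M z)) (1, 0)))" for z
  have hd: "(h has_derivative frechet_derivative h (at z)) (at z)" for z
    using smooth_on_has_derivative[OF h(1)] by simp
  have gd: "frechet_derivative g (at z) v = frechet_derivative h (at (M z)) (M v)" for z v
  proof -
    have "(g has_derivative (\<lambda>v. frechet_derivative h (at (M z)) (M v))) (at z)"
      unfolding g_def[abs_def]
      by (rule has_derivative_compose[OF bounded_linear_imp_has_derivative[OF blM] hd])
    then show ?thesis using frechet_derivative_at by metis
  qed
  have lin: "frechet_derivative h (at z) (p, q) = p * frechet_derivative h (at z) (1, 0) + q * frechet_derivative h (at z) (0, 1)" for z p q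
  proof -
    interpret bounded_linear "frechet_derivative h (at z)" using hd has_derivative_bounded_linear by blast
    have "(p, q) = p *\<^sub>R (1, 0) + q *\<^sub>R (0, 1)" by simp
    then show ?thesis using add scaleR by (metis real_scaleR_def)
  qed
  have bnd: "(a + \<bar>b\<bar> + 1) * \<delta>' = \<delta>" using assms(3) by (simp add: \<delta>'_def)
  show ?thesis
  proof (rule exI[of _ g], rule exI[of _ s], rule exI[of _ "M -` W"], rule exI[of _ "M -` K"], intro conjI allI ballI impI)
    show "smooth_on UNIV g" unfolding g_def[abs_def] by (rule smooth_on_compose_linear[OF _ blM h(1)]) auto
    show "open (M -` W)" using continuous_on_open_vimage[of UNIV M] contM(1) h(2) by auto
    show "closed (M -` K)" using continuous_on_closed_vimage[of UNIV M] contM(1) h(4) by auto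
    show "S \<subseteq> M -` W" using h(3) by auto
    show "M -` K \<subseteq> \<Omega>" using h(5) MM'(2) by (metis subsetD subsetI vimageE vimageI2)
    show "g z = 0" if "z \<notin> M -` K" for z using h(6) that by (simp add: g_def)
    show "\<bar>g z\<bar> \<le> \<epsilon>" for z using h(7)[of "M z"] by (simp add: g_def)
    show "0 \<le> s z" "s z \<le> 1" for z by (auto simp: s_def)
    fix z
    define H where "H = frechet_derivative h (at (M z)) (1, 0)"
    define J where "J = frechet_derivative h (at (M z)) (0, 1)"
    have Hs: "\<bar>H - s z\<bar> \<le> \<delta>'" "\<bar>J\<bar> \<le> \<delta>'"
      using h(8)[of "M z"] \<open>\<delta>' > 0\<close> by (auto simp: s_def H_def J_def)
    have "frechet_derivative g (at z) (1, 0) = - a * H"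
      unfolding gd by (simp add: lin[of _ "- a"] M_def H_def)
    then have "frechet_derivative g (at z) (1, 0) + a * s z = a * (s z - H)" by (simp add: algebra_simps)
    then have "\<bar>frechet_derivative g (at z) (1, 0) + a * s z\<bar> = a * \<bar>H - s z\<bar>"
      using assms(3) by (simp add: abs_mult abs_minus_commute)
    also have "\<dots> \<le> a * \<delta>'" using Hs assms(3) by (intro mult_left_mono) auto
    also have "\<dots> \<le> \<delta>" unfolding bnd[symmetric] using \<open>\<delta>' > 0\<close> by (intro mult_right_mono) auto
    finally show "\<bar>frechet_derivative g (at z) (1, 0) + a * s z\<bar> \<le> \<delta>" .
    have "frechet_derivative g (at z) (0, 1) = b * H + J"
      unfolding gd by (simp add: lin[of _ b] M_def H_def J_def)
    then have "frechet_derivative g (at z) (0, 1) - b * s z = b * (H - s z) + J" by (simp add: algebra_simps)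
    then have "\<bar>frechet_derivative g (at z) (0, 1) - b * s z\<bar> \<le> \<bar>b\<bar> * \<bar>H - s z\<bar> + \<bar>J\<bar>"
      by (metis abs_mult abs_triangle_ineq)
    also have "\<dots> \<le> \<bar>b\<bar> * \<delta>' + \<delta>'" using Hs by (intro add_mono mult_left_mono) auto
    also have "\<dots> \<le> \<delta>" unfolding bnd[symmetric] using \<open>\<delta>' > 0\<close> assms(3) by (simp add: algebra_simps)
    finally show "\<bar>frechet_derivative g (at z) (0, 1) - b * s z\<bar> \<le> \<delta>" .
  next
    fix z assume "z \<in> M -` W"
    then show "s z = 1" using h(9)[of "M z"] by (simp add: s_def)
  qed
qed

section \<open>Peano's existence theorem\<close>

text \<open>
  Tonelli's approximation. With the delay \<open>h = 1 / (n + 1)\<close> in the argument, Picard iteration becomes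
  stationary: the \<open>k\<close>-th iterate already solves the equation up to time \<open>k h\<close>. For negative times all iterates are
  constant, as integrals over empty intervals vanish.
\<close>

lemma delayed_solution:
  fixes \<kappa> :: "real \<times> real \<Rightarrow> real"
  assumes cont: "continuous_on UNIV \<kappa>" and bnd: "\<And>z. \<bar>\<kappa> z\<bar> \<le> B"
  obtains X where "\<And>s t. \<bar>X s - X t\<bar> \<le> B * \<bar>s - t\<bar>" "X 0 = x0"
    "\<And>t. t \<le> 1 \<Longrightarrow> X t = x0 + integral {0..t} (\<lambda>s. \<kappa> (X (s - 1 / real (Suc n)), y0 + s))"
proof -
  define h where "h = 1 / real (Suc n)"
  define \<T> where "\<T> X t = x0 + integral {0..t} (\<lambda>s. \<kappa> (X (s - h), y0 + s))" for X :: "real \<Rightarrow> real" and t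
  have B: "B \<ge> 0" using bnd[of "(0, 0)"] by linarith
  have cti: "continuous_on {s..t} (\<lambda>s. \<kappa> (X (s - h), y0 + s))" if "continuous_on UNIV X" for X s t
    by (intro continuous_on_compose2[OF cont] continuous_intros continuous_on_compose2[OF that]) auto
  have int: "(\<lambda>s. \<kappa> (X (s - h), y0 + s)) integrable_on {s..t}" if "continuous_on UNIV X" for X s t
    by (rule integrable_continuous_interval[OF cti[OF that]])
  have lip: "\<bar>\<T> X s - \<T> X t\<bar> \<le> B * \<bar>s - t\<bar>" if X: "continuous_on UNIV X" for X s t
  proof -
    have pos: "\<bar>\<T> X t - \<T> X s\<bar> \<le> B * (t - s)" if "0 \<le> s" "s \<le> t" for s t
    proof -
      have "\<T> X t - \<T> X s = integral {s..t} (\<lambda>s. \<kappa> (X (s - h), y0 + s))"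
        using Henstock_Kurzweil_Integration.integral_combine[OF that int[OF X]] by (simp add: \<T>_def)
      moreover have "norm (integral {s..t} (\<lambda>s. \<kappa> (X (s - h), y0 + s))) \<le> B * (t - s)"
        by (rule integral_bound[OF that(2) cti[OF X]]) (use bnd in simp)
      ultimately show ?thesis by simp
    qed
    have neg: "\<T> X t = \<T> X (max 0 t)" for t by (cases "t \<ge> 0") (auto simp: \<T>_def max_def)
    have "\<bar>\<T> X s - \<T> X t\<bar> \<le> B * \<bar>max 0 s - max 0 t\<bar>"
    proof (cases "max 0 s \<le> max 0 t")
      case True
      then have "\<bar>\<T> X (max 0 t) - \<T> X (max 0 s)\<bar> \<le> B * (max 0 t - max 0 s)" by (intro pos) auto
      moreover have e: "\<bar>max 0 s - max 0 t\<bar> = max 0 t - max 0 s" using True by simp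
      ultimately show ?thesis unfolding e using neg[of s] neg[of t] by linarith
    next
      case False
      then have "\<bar>\<T> X (max 0 s) - \<T> X (max 0 t)\<bar> \<le> B * (max 0 s - max 0 t)" by (intro pos) auto
      moreover have e: "\<bar>max 0 s - max 0 t\<bar> = max 0 s - max 0 t" using False by simp
      ultimately show ?thesis unfolding e using neg[of s] neg[of t] by linarith
    qed
    also have "\<dots> \<le> B * \<bar>s - t\<bar>" using B by (intro mult_left_mono) auto
    finally show ?thesis .
  qed
  have contT: "continuous_on UNIV (\<T> X)" if "continuous_on UNIV X" for X
    by (rule lipschitz_on_continuous_on[of B], rule lipschitz_onI)
      (use lip[OF that] B in \<open>auto simp: dist_real_def\<close>)
  define Y where "Y k = (\<T> ^^ k) (\<lambda>_. x0)" for k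
  have Y0: "Y 0 = (\<lambda>_. x0)" and YS: "Y (Suc k) = \<T> (Y k)" for k by (auto simp: Y_def)
  have contY: "continuous_on UNIV (Y k)" for k
    by (induction k) (auto simp: Y0 YS contT)
  have fixp: "Y (Suc k) t = Y k t" if "t \<le> real k * h" for k t
    using that
  proof (induction k arbitrary: t)
    case 0
    then have "{0..t} = {} \<or> {0..t} = {0}" by auto
    then show ?case by (auto simp: Y0 YS \<T>_def)
  next
    case (Suc k)
    have "integral {0..t} (\<lambda>s. \<kappa> (Y (Suc k) (s - h), y0 + s)) = integral {0..t} (\<lambda>s. \<kappa> (Y k (s - h), y0 + s))"
    proof (rule Henstock_Kurzweil_Integration.integral_cong)
      fix s assume "s \<in> {0..t}"
      then have "s - h \<le> real k * h" using Suc.prems by (simp add: algebra_simps)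
      then show "\<kappa> (Y (Suc k) (s - h), y0 + s) = \<kappa> (Y k (s - h), y0 + s)" using Suc.IH by simp
    qed
    then show ?case by (simp add: YS[of "Suc k"] YS[of k] \<T>_def)
  qed
  show thesis
  proof (rule that[of "Y (Suc n)"])
    show "\<bar>Y (Suc n) s - Y (Suc n) t\<bar> \<le> B * \<bar>s - t\<bar>" for s t unfolding YS by (rule lip[OF contY])
    show "Y (Suc n) 0 = x0" by (simp add: YS \<T>_def)
    show "Y (Suc n) t = x0 + integral {0..t} (\<lambda>s. \<kappa> (Y (Suc n) (s - 1 / real (Suc n)), y0 + s))" if "t \<le> 1" for t
    proof -
      have "t \<le> real (Suc n) * h" using that by (simp add: h_def)
      then have "Y (Suc n) t = \<T> (Y (Suc n)) t" using fixp[of t "Suc n"] by (simp only: YS)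
      then show ?thesis by (simp only: \<T>_def h_def)
    qed
  qed
qed

text \<open>
  The solutions with delay are equi-Lipschitz; a uniform limit solves the equation without delay.
\<close>

lemma peano:
  fixes \<kappa> :: "real \<times> real \<Rightarrow> real"
  assumes cont: "continuous_on UNIV \<kappa>" and bnd: "\<And>z. \<bar>\<kappa> z\<bar> \<le> B"
  obtains X where "X 0 = x0" "\<And>t. t \<in> {0..1} \<Longrightarrow> (X has_real_derivative \<kappa> (X t, y0 + t)) (at t)"
proof -
  have B: "B \<ge> 0" using bnd[of "(0, 0)"] by linarith
  define Pr where "Pr n X \<longleftrightarrow> (\<forall>s t. \<bar>X s - X t\<bar> \<le> B * \<bar>s - t\<bar>) \<and> X 0 = x0 \<and>
    (\<forall>t. t \<le> 1 \<longrightarrow> X t = x0 + integral {0..t} (\<lambda>s. \<kappa> (X (s - 1 / real (Suc n)), y0 + s)))" for n X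
  have "\<exists>X. Pr n X" for n
    unfolding Pr_def
    by (rule delayed_solution[OF cont bnd, where n = n and ?x0.0 = x0 and ?y0.0 = y0]) blast
  then obtain X where "\<And>n. Pr n (X n)" by metis
  then have X: "\<And>n s t. \<bar>X n s - X n t\<bar> \<le> B * \<bar>s - t\<bar>" "\<And>n. X n 0 = x0"
    "\<And>n t. t \<le> 1 \<Longrightarrow> X n t = x0 + integral {0..t} (\<lambda>s. \<kappa> (X n (s - 1 / real (Suc n)), y0 + s))"
    unfolding Pr_def by blast+
  obtain g k where g: "continuous_on {0..1} g" "strict_mono (k :: nat \<Rightarrow> nat)"
    "\<And>e. 0 < e \<Longrightarrow> \<exists>N. \<forall>n x. n \<ge> N \<and> x \<in> {0..1} \<longrightarrow> norm (X (k n) x - g x) < e"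
  proof (rule Arzela_Ascoli[of "{0..1::real}" X "\<bar>x0\<bar> + B"])
    show "norm (X n x) \<le> \<bar>x0\<bar> + B" if "x \<in> {0..1}" for n x
    proof -
      have "\<bar>X n x - X n 0\<bar> \<le> B * 1" using X(1)[of n x 0] that B mult_left_mono[of x 1 B] by simp
      then show ?thesis using X(2)[of n] by simp
    qed
    fix x e :: real assume "0 < e"
    then have "B * d < e" if "0 \<le> d" "d < e / (B + 1)" for d
    proof -
      have "B * d \<le> (B + 1) * d" using that by (simp add: algebra_simps)
      also have "\<dots> < e" using that B by (simp add: field_simps)
      finally show ?thesis .
    qed
    then show "\<exists>d>0. \<forall>n y. y \<in> {0..1} \<and> norm (x - y) < d \<longrightarrow> norm (X n x - X n y) < e"
      using B \<open>0 < e\<close> by (intro exI[of _ "e / (B + 1)"]) (auto intro: le_less_trans[OF X(1)])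
  qed auto
  have lim: "(\<lambda>n. X (k n) x) \<longlonglongrightarrow> g x" if "x \<in> {0..1}" for x
    unfolding LIMSEQ_iff using g(3) that by blast
  have h0: "(\<lambda>n. 1 / real (Suc (k n))) \<longlonglongrightarrow> 0"
    using LIMSEQ_subseq_LIMSEQ[OF LIMSEQ_Suc[OF lim_1_over_n] g(2)] by (simp add: comp_def)
  have limd: "(\<lambda>n. X (k n) (x - 1 / real (Suc (k n)))) \<longlonglongrightarrow> g x" if "x \<in> {0..1}" for x
  proof -
    have "(\<lambda>n. X (k n) (x - 1 / real (Suc (k n))) - X (k n) x) \<longlonglongrightarrow> 0"
    proof (rule Lim_null_comparison)
      show "\<forall>\<^sub>F n in sequentially. norm (X (k n) (x - 1 / real (Suc (k n))) - X (k n) x) \<le> B * (1 / real (Suc (k n)))"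
        by (intro always_eventually allI) (use X(1)[of "k _" "x - 1 / real (Suc (k _))" x] in \<open>simp del: of_nat_Suc\<close>)
      show "(\<lambda>n. B * (1 / real (Suc (k n)))) \<longlonglongrightarrow> 0" using tendsto_mult_left[OF h0, of B] by simp
    qed
    from tendsto_add[OF this lim[OF that]] show ?thesis by simp
  qed
  have contk: "continuous_on {0..1} (\<lambda>s. \<kappa> (g s, y0 + s))"
    by (intro continuous_on_compose2[OF cont] continuous_intros g(1)) auto
  have contX: "continuous_on UNIV (X n)" for n
    by (rule lipschitz_on_continuous_on[of B], rule lipschitz_onI)
      (use X(1) B in \<open>auto simp: dist_real_def\<close>)
  have geq: "g t = x0 + integral {0..t} (\<lambda>s. \<kappa> (g s, y0 + s))" if t: "t \<in> {0..1}" for t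
  proof -
    have "(\<lambda>n. integral {0..t} (\<lambda>s. \<kappa> (X (k n) (s - 1 / real (Suc (k n))), y0 + s))) \<longlonglongrightarrow>
        integral {0..t} (\<lambda>s. \<kappa> (g s, y0 + s))"
    proof (rule dominated_convergence(2))
      show "(\<lambda>s. \<kappa> (X (k n) (s - 1 / real (Suc (k n))), y0 + s)) integrable_on {0..t}" for n
        by (intro integrable_continuous_interval continuous_on_compose2[OF cont] continuous_intros
            continuous_on_compose2[OF contX]) auto
      show "(\<lambda>s. B) integrable_on {0..t}" by (rule integrable_const_ivl)
      show "norm (\<kappa> (X (k n) (s - 1 / real (Suc (k n))), y0 + s)) \<le> B" for n s using bnd by simp
      show "(\<lambda>n. \<kappa> (X (k n) (s - 1 / real (Suc (k n))), y0 + s)) \<longlonglongrightarrow> \<kappa> (g s, y0 + s)" if "s \<in> {0..t}" for s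
        by (rule continuous_on_tendsto_compose[OF cont]) (use that t limd[of s] in \<open>auto intro!: tendsto_intros\<close>)
    qed
    then have "(\<lambda>n. x0 + integral {0..t} (\<lambda>s. \<kappa> (X (k n) (s - 1 / real (Suc (k n))), y0 + s))) \<longlonglongrightarrow>
        x0 + integral {0..t} (\<lambda>s. \<kappa> (g s, y0 + s))" by (rule tendsto_add[OF tendsto_const])
    moreover have "x0 + integral {0..t} (\<lambda>s. \<kappa> (X (k n) (s - 1 / real (Suc (k n))), y0 + s)) = X (k n) t" for n
      using X(3)[of t "k n"] t by simp
    ultimately show ?thesis using LIMSEQ_unique lim[OF t] by simp
  qed
  \<comment> \<open>Continuing the right-hand side by constants makes the solution differentiable from
    both sides at 0 and 1 as well.\<close>
  define cl where "cl s = max 0 (min 1 s)" for s :: real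
  define kk where "kk s = \<kappa> (g (cl s), y0 + cl s)" for s
  have contkk: "continuous_on A kk" for A
    unfolding kk_def[abs_def]
    by (rule continuous_on_compose2[OF contk]) (auto simp: cl_def intro!: continuous_intros)
  define Z where "Z t = x0 + (integral {-1..t} kk - integral {-1..0} kk)" for t
  have Zg: "Z t = g t" if "t \<in> {0..1}" for t
  proof -
    have "integral {-1..0} kk + integral {0..t} kk = integral {-1..t} kk"
      by (rule Henstock_Kurzweil_Integration.integral_combine)
        (use that contkk in \<open>auto intro: integrable_continuous_interval\<close>)
    moreover have "integral {0..t} kk = integral {0..t} (\<lambda>s. \<kappa> (g s, y0 + s))"
      by (rule Henstock_Kurzweil_Integration.integral_cong) (use that in \<open>auto simp: kk_def cl_def\<close>)
    ultimately show ?thesis using geq[OF that] by (simp add: Z_def)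
  qed
  show thesis
  proof (rule that[of Z])
    show "Z 0 = x0" by (simp add: Z_def)
    fix t :: real assume t: "t \<in> {0..1}"
    have "((\<lambda>t. integral {-1..t} kk) has_real_derivative kk t) (at t within {-1..2})"
      by (rule integral_has_real_derivative[OF contkk]) (use t in auto)
    moreover have "at t within {-1..2} = at t" using t by (intro at_within_interior) auto
    ultimately have "((\<lambda>t. integral {-1..t} kk) has_real_derivative kk t) (at t)" by simp
    then have "(Z has_real_derivative kk t) (at t)"
      unfolding Z_def[abs_def] by (auto intro!: derivative_eq_intros)
    moreover have "kk t = \<kappa> (Z t, y0 + t)" using t Zg[OF t] by (simp add: kk_def cl_def)
    ultimately show "(Z has_real_derivative \<kappa> (Z t, y0 + t)) (at t)" by simp
  qed
qed

section \<open>Convex integrands touching a line\<close>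

locale convex_integrand =
  fixes \<omega> :: "real \<Rightarrow> real"
  assumes \<omega>_smooth: "smooth_on UNIV \<omega>" and \<omega>_convex: "convex_on UNIV \<omega>"
    and \<omega>_superlinear: "superlinear \<omega>" and \<omega>_nonneg: "\<And>p. 0 \<le> \<omega> p" and \<omega>_0: "\<omega> 0 = 0"
begin

definition \<omega>' :: "real \<Rightarrow> real" where
  "\<omega>' p = frechet_derivative \<omega> (at p) 1"

lemma \<omega>'_smooth: "smooth_on UNIV \<omega>'"
  unfolding \<omega>'_def[abs_def] by (rule smooth_on_directional_derivative[OF \<omega>_smooth])

lemma \<omega>_tangent: "\<omega> p + \<omega>' p * (q - p) \<le> \<omega> q"
proof -
  have d: "(\<omega> has_derivative frechet_derivative \<omega> (at p)) (at p)"
    using smooth_on_has_derivative[OF \<omega>_smooth] by simp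
  have "frechet_derivative \<omega> (at p) t = \<omega>' p * t" for t
    using linear_scale[OF has_derivative_linear[OF d], of t 1] by (simp add: \<omega>'_def)
  then have "frechet_derivative \<omega> (at p) = (*) (\<omega>' p)" by (rule ext)
  then have "(\<omega> has_real_derivative \<omega>' p) (at p)"
    using d by (simp only: has_field_derivative_def)
  then show ?thesis
    using convex_on_imp_above_tangent[OF \<omega>_convex, of p q "\<omega>' p"] by (simp add: algebra_simps)
qed

lemma \<omega>'_mono: "p \<le> q \<Longrightarrow> \<omega>' p \<le> \<omega>' q"
proof (rule ccontr)
  assume "p \<le> q" "\<not> \<omega>' p \<le> \<omega>' q"
  then have "p < q" by (cases "p = q") auto
  then have "(\<omega>' q - \<omega>' p) * (q - p) < 0" using \<open>\<not> \<omega>' p \<le> \<omega>' q\<close> by (intro mult_neg_pos) auto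
  moreover have "(\<omega>' q - \<omega>' p) * (q - p) \<ge> 0"
    using \<omega>_tangent[of p q] \<omega>_tangent[of q p] by (simp add: algebra_simps)
  ultimately show False by simp
qed

lemma \<omega>_le_mult: "\<omega> p \<le> p * \<omega>' p"
  using \<omega>_tangent[of p 0] by (simp add: \<omega>_0 mult.commute)

lemma \<omega>'_nonneg: "0 < p \<Longrightarrow> 0 \<le> \<omega>' p"
  using \<omega>_le_mult[of p] \<omega>_nonneg[of p] by (metis mult_neg_pos mult.commute not_le order_trans)

lemma \<omega>_ge_linear: "\<exists>C\<ge>0. \<forall>p. M * \<bar>p\<bar> - C \<le> \<omega> p"
proof -
  have "\<forall>\<^sub>F p in at_infinity. M \<le> \<omega> p / \<bar>p\<bar>"
    using \<omega>_superlinear unfolding superlinear_def filterlim_at_top by blast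
  then obtain R where R: "\<And>p. R \<le> \<bar>p\<bar> \<Longrightarrow> M \<le> \<omega> p / \<bar>p\<bar>" unfolding eventually_at_infinity by auto
  have "M * \<bar>p\<bar> - \<bar>M\<bar> * \<bar>R\<bar> \<le> \<omega> p" for p
  proof (cases "R \<le> \<bar>p\<bar> \<and> p \<noteq> 0")
    case True
    then have "M * \<bar>p\<bar> \<le> \<omega> p" using R[of p] by (simp add: field_simps)
    moreover have "0 \<le> \<bar>M\<bar> * \<bar>R\<bar>" by simp
    ultimately show ?thesis by linarith
  next
    case False
    then have "\<bar>p\<bar> \<le> \<bar>R\<bar>" by auto
    then have "M * \<bar>p\<bar> \<le> \<bar>M\<bar> * \<bar>R\<bar>" by (intro mult_mono) auto
    then show ?thesis using \<omega>_nonneg[of p] by linarith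
  qed
  then show ?thesis by (intro exI[of _ "\<bar>M\<bar> * \<bar>R\<bar>"]) auto
qed

text \<open>
  The slope at which \<open>\<omega> + bend A B\<close> touches the line \<open>B p - A\<close>. The line has the value \<open>A / 2\<close>
  there, so \<open>height\<close> is the value that \<open>bend\<close> has to supply; the coefficient in \<open>bend\<close> gives it the slope
  \<open>B - \<omega>' p\<close> at this point, since \<open>ramp\<close> has value \<open>1\<close> and slope \<open>2\<close> at \<open>1\<close>.
\<close>

definition touch :: "real \<Rightarrow> real \<Rightarrow> real" where
  "touch A B = 3 * A / (2 * B)"

definition height :: "real \<Rightarrow> real \<Rightarrow> real" where
  "height A B = A / 2 - \<omega> (touch A B)"

definition bend :: "real \<Rightarrow> real \<Rightarrow> real \<Rightarrow> real" where
  "bend A B p = height A B * ramp ((B - \<omega>' (touch A B)) / (2 * height A B) * (p - touch A B) + 1)"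

text \<open>
  If \<open>\<omega>'\<close> is small compared with \<open>B\<close> at the touching slope, then \<open>height\<close> is positive and \<open>bend\<close> is so
  steep there that it vanishes for all slopes up to a fixed fraction of \<open>A / B\<close>.
\<close>

definition admissible :: "real \<Rightarrow> real \<Rightarrow> bool" where
  "admissible A B \<longleftrightarrow> 0 < A \<and> 0 < B \<and> \<omega>' (touch A B) \<le> B / 8"

lemma height_bounds:
  assumes "admissible A B"
  shows "0 < height A B" "2 * height A B \<le> A"
proof -
  have AB: "0 < A" "0 < B" "\<omega>' (touch A B) \<le> B / 8" using assms by (auto simp: admissible_def)
  have t: "0 < touch A B" "touch A B * B = 3 * A / 2" using AB by (auto simp: touch_def)
  have "\<omega> (touch A B) \<le> touch A B * (B / 8)"
    using \<omega>_le_mult[of "touch A B"] mult_left_mono[OF AB(3), of "touch A B"] t(1) by linarith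
  also have "\<dots> = 3 * A / 16" using t(2) by (simp add: mult.commute)
  finally show "0 < height A B" using AB by (simp add: height_def)
  show "2 * height A B \<le> A" using \<omega>_nonneg[of "touch A B"] by (simp add: height_def)
qed

lemma bend_nonneg: "admissible A B \<Longrightarrow> 0 \<le> bend A B p"
  using height_bounds(1)[of A B] ramp_nonneg by (simp add: bend_def)

lemma bend_convex:
  assumes "admissible A B"
  shows "convex_on UNIV (bend A B)"
proof -
  define m where "m = (B - \<omega>' (touch A B)) / (2 * height A B)"
  have "convex_on UNIV (\<lambda>p. ramp (m * (p - touch A B) + 1))"
  proof (rule convex_onI)
    fix t x y :: real assume "0 < t" "t < 1"
    have e: "m * (((1 - t) *\<^sub>R x + t *\<^sub>R y) - touch A B) + 1
        = (1 - t) *\<^sub>R (m * (x - touch A B) + 1) + t *\<^sub>R (m * (y - touch A B) + 1)"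
      by (simp add: algebra_simps)
    show "ramp (m * (((1 - t) *\<^sub>R x + t *\<^sub>R y) - touch A B) + 1)
        \<le> (1 - t) * ramp (m * (x - touch A B) + 1) + t * ramp (m * (y - touch A B) + 1)"
      unfolding e using convex_onD[OF convex_on_ramp, of t "m * (x - touch A B) + 1" "m * (y - touch A B) + 1"] \<open>0 < t\<close> \<open>t < 1\<close>
      by simp
  qed simp
  then have "convex_on UNIV (\<lambda>p. height A B * ramp (m * (p - touch A B) + 1))"
    using height_bounds(1)[OF assms] by (intro convex_on_cmul) auto
  then show ?thesis by (simp add: bend_def[abs_def] m_def)
qed

text \<open>
  The coefficient of \<open>p\<close> in the argument of \<open>ramp\<close> is at least \<open>7 B / (8 A)\<close>, so the argument is
  nonpositive as soon as \<open>touch A B - p \<ge> 8 A / (7 B)\<close>, which is the hypothesis on \<open>p\<close>.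
\<close>

lemma bend_eq_0:
  assumes ad: "admissible A B" and p: "14 * B * p \<le> 5 * A"
  shows "bend A B p = 0"
proof -
  have AB: "0 < A" "0 < B" "\<omega>' (touch A B) \<le> B / 8" using ad by (auto simp: admissible_def)
  define m where "m = (B - \<omega>' (touch A B)) / (2 * height A B)"
  have m: "7 * B / (8 * A) \<le> m"
  proof -
    have "7 * B / (8 * A) = (7 * B / 8) / A" by simp
    also have "\<dots> \<le> m" unfolding m_def
      by (rule frac_le) (use AB height_bounds[OF ad] in auto)
    finally show ?thesis .
  qed
  have d: "8 * A / (7 * B) \<le> touch A B - p"
    using p AB by (simp add: touch_def field_simps)
  have "1 = (7 * B / (8 * A)) * (8 * A / (7 * B))" using AB by simp
  also have "\<dots> \<le> m * (touch A B - p)"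
    by (rule mult_mono[OF m d]) (use AB m in \<open>auto intro: order_trans[rotated]\<close>)
  finally have "m * (p - touch A B) + 1 \<le> 0" by (simp add: algebra_simps)
  then show ?thesis by (simp add: bend_def m_def[symmetric] ramp_nonpos)
qed

lemma touch_mult: "0 < B \<Longrightarrow> B * touch A B = 3 * A / 2"
  by (simp add: touch_def)

text \<open>
  Add the tangent inequalities of \<open>\<omega>\<close> at \<open>touch A B\<close> and of \<open>ramp\<close> at \<open>1\<close>: the two slopes add up to \<open>B\<close>.
\<close>

lemma calibration_le:
  assumes ad: "admissible A B"
  shows "B * p - A \<le> \<omega> p + bend A B p"
proof -
  define h where "h = height A B"
  define u where "u = touch A B"
  have B: "0 < B" "h > 0" using ad height_bounds(1) by (auto simp: admissible_def h_def)
  have "h * (2 * ((B - \<omega>' u) / (2 * h) * (p - u) + 1) - 1) \<le> bend A B p"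
    unfolding bend_def h_def[symmetric] u_def[symmetric] by (intro mult_left_mono ramp_ge_tangent) (use B(2) in simp)
  moreover have "h * (2 * ((B - \<omega>' u) / (2 * h) * (p - u) + 1) - 1) = (B - \<omega>' u) * (p - u) + h"
    using B(2) by (simp add: field_simps)
  ultimately have "\<omega> u + \<omega>' u * (p - u) + (B - \<omega>' u) * (p - u) + h \<le> \<omega> p + bend A B p"
    using \<omega>_tangent[of u p] by linarith
  moreover have "\<omega> u + \<omega>' u * (p - u) + (B - \<omega>' u) * (p - u) + h = B * p - B * u + A / 2"
    by (simp add: h_def height_def u_def[symmetric] algebra_simps)
  ultimately show ?thesis using touch_mult[OF B(1), of A] by (simp add: u_def)
qed

lemma calibration_eq:
  assumes ad: "admissible A B"
  shows "\<omega> (touch A B) + bend A B (touch A B) = B * touch A B - A"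
  using touch_mult[of B A] ad by (simp add: bend_def height_def admissible_def)

lemma smooth_on_bend:
  fixes A B p :: "'a::euclidean_space \<Rightarrow> real"
  assumes "open U" "smooth_on U A" "smooth_on U B" "smooth_on U p" "\<And>z. z \<in> U \<Longrightarrow> admissible (A z) (B z)"
  shows "smooth_on U (\<lambda>z. bend (A z) (B z) (p z))"
proof -
  have pos: "0 < 2 * B z" "0 < 2 * height (A z) (B z)" if "z \<in> U" for z
    using assms(5)[OF that] height_bounds(1) by (auto simp: admissible_def)
  have t: "smooth_on U (\<lambda>z. touch (A z) (B z))"
    unfolding touch_def by (intro smooth_on_divide smooth_on_cmult assms(1-3)) (use pos in auto)
  have c: "smooth_on U (\<lambda>z. f (touch (A z) (B z)))" if "smooth_on UNIV f" for f
    using smooth_on_compose_real[OF assms(1) that t] by simp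
  have h: "smooth_on U (\<lambda>z. height (A z) (B z))"
    unfolding height_def using smooth_on_cmult[OF assms(1,2), of "1/2"]
    by (intro smooth_on_diff assms(1) c \<omega>_smooth) simp
  have "smooth_on U (\<lambda>z. (B z - \<omega>' (touch (A z) (B z))) / (2 * height (A z) (B z)) * (p z - touch (A z) (B z)) + 1)"
    by (intro smooth_on_add smooth_on_mult smooth_on_divide smooth_on_diff smooth_on_cmult smooth_on_const assms(1-4) c \<omega>'_smooth t h)
      (use pos in auto)
  then have "smooth_on U (\<lambda>z. ramp ((B z - \<omega>' (touch (A z) (B z))) / (2 * height (A z) (B z)) * (p z - touch (A z) (B z)) + 1))"
    using smooth_on_compose_real[OF assms(1) smooth_on_ramp] by simp
  then show ?thesis unfolding bend_def by (intro smooth_on_mult assms(1) h)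
qed

text \<open>
  After \<open>N\<close> bumps the gradient of the potential around the singular set will be \<open>(- \<alpha> N, \<beta> N)\<close>, up to an error
  of at most \<open>1\<close> in each coordinate. The ratio \<open>\<alpha> N / \<beta> N = N + 6\<close> tends to infinity, and \<open>\<beta> N\<close> dominates \<open>\<omega>'\<close> at every touching
  slope that occurs between the stages \<open>N\<close> and \<open>N + 1\<close>, all of which are at most \<open>3 (N + 8) / 2\<close>.
\<close>

definition \<beta> :: "nat \<Rightarrow> real" where
  "\<beta> N = real N + 20 + 8 * \<omega>' (3 * (real N + 8) / 2)"

definition \<alpha> :: "nat \<Rightarrow> real" where
  "\<alpha> N = (real N + 6) * \<beta> N"

lemma \<beta>_ge: "real N + 20 \<le> \<beta> N"
  using \<omega>'_nonneg[of "3 * (real N + 8) / 2"] by (simp add: \<beta>_def)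

lemma \<beta>_mono: "\<beta> N \<le> \<beta> (Suc N)"
  using \<omega>'_mono[of "3 * (real N + 8) / 2" "3 * (real (Suc N) + 8) / 2"] by (simp add: \<beta>_def)

lemma \<alpha>_less: "\<alpha> N < \<alpha> (Suc N)"
proof -
  have "(real N + 6) * \<beta> N < (real (Suc N) + 6) * \<beta> N" using \<beta>_ge[of N] by (intro mult_strict_right_mono) auto
  also have "\<dots> \<le> (real (Suc N) + 6) * \<beta> (Suc N)" using \<beta>_mono[of N] by (intro mult_left_mono) auto
  finally show ?thesis by (simp add: \<alpha>_def)
qed

lemma \<alpha>_ge: "120 \<le> \<alpha> N"
proof -
  have "6 * 20 \<le> (real N + 6) * \<beta> N" using \<beta>_ge[of N] by (intro mult_mono) auto
  then show ?thesis by (simp add: \<alpha>_def)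
qed

text \<open>
  During the transition from one stage to the next the gradient is nearly a convex combination of the two; the
  ratio \<open>A / B\<close> stays between \<open>N + 5\<close> and \<open>N + 8\<close> because errors of size \<open>1\<close> are small relative to \<open>\<beta> N \<ge> N + 20\<close>.
\<close>

lemma stage_bounds:
  assumes s: "0 \<le> s" "s \<le> 1"
    and A: "\<bar>A - ((1 - s) * \<alpha> N + s * \<alpha> (Suc N))\<bar> \<le> 1" and B: "\<bar>B - ((1 - s) * \<beta> N + s * \<beta> (Suc N))\<bar> \<le> 1"
  shows "admissible A B" "(real N + 5) * B \<le> A" "A \<le> (real N + 8) * B" "19 \<le> B"
proof -
  define A0 where "A0 = (1 - s) * \<alpha> N + s * \<alpha> (Suc N)"
  define B0 where "B0 = (1 - s) * \<beta> N + s * \<beta> (Suc N)"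
  have "\<beta> N \<le> B0"
  proof -
    have "(1 - s) * \<beta> N + s * \<beta> N \<le> B0" unfolding B0_def using s \<beta>_mono[of N] by (intro add_left_mono mult_left_mono) auto
    then show ?thesis by (simp add: algebra_simps)
  qed
  have AB: "\<bar>A - A0\<bar> \<le> 1" "\<bar>B - B0\<bar> \<le> 1" using A B by (auto simp: A0_def B0_def)
  have B1: "\<beta> N - 1 \<le> B" using AB(2) \<open>\<beta> N \<le> B0\<close> by linarith
  then have B2: "real N + 19 \<le> B" using \<beta>_ge[of N] by linarith
  have lo: "(real N + 6) * B0 \<le> A0"
  proof -
    have "(real N + 6) * ((1 - s) * \<beta> N) + (real N + 6) * (s * \<beta> (Suc N)) \<le> (1 - s) * \<alpha> N + s * \<alpha> (Suc N)"
    proof (rule add_mono)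
      show "(real N + 6) * ((1 - s) * \<beta> N) \<le> (1 - s) * \<alpha> N" by (simp add: \<alpha>_def)
      have "(real N + 6) * (s * \<beta> (Suc N)) \<le> (real (Suc N) + 6) * (s * \<beta> (Suc N))"
        using s \<beta>_ge[of "Suc N"] by (intro mult_right_mono) auto
      then show "(real N + 6) * (s * \<beta> (Suc N)) \<le> s * \<alpha> (Suc N)" by (simp add: \<alpha>_def mult.left_commute)
    qed
    then show ?thesis by (simp add: A0_def B0_def distrib_left)
  qed
  have hi: "A0 \<le> (real N + 7) * B0"
  proof -
    have "(1 - s) * \<alpha> N + s * \<alpha> (Suc N) \<le> (real N + 7) * ((1 - s) * \<beta> N) + (real N + 7) * (s * \<beta> (Suc N))"
    proof (rule add_mono)
      have "(real N + 6) * ((1 - s) * \<beta> N) \<le> (real N + 7) * ((1 - s) * \<beta> N)"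
        using s \<beta>_ge[of N] by (intro mult_right_mono) auto
      then show "(1 - s) * \<alpha> N \<le> (real N + 7) * ((1 - s) * \<beta> N)" by (simp add: \<alpha>_def mult.left_commute)
      show "s * \<alpha> (Suc N) \<le> (real N + 7) * (s * \<beta> (Suc N))" by (simp add: \<alpha>_def algebra_simps)
    qed
    then show ?thesis by (simp add: A0_def B0_def distrib_left)
  qed
  have "(real N + 6) * (B - 1) \<le> (real N + 6) * B0" using AB(2) by (intro mult_left_mono) auto
  then have "(real N + 6) * B - (real N + 6) \<le> A + 1" using lo AB(1) by (simp add: algebra_simps)
  then show 1: "(real N + 5) * B \<le> A" using B2 by (simp add: algebra_simps)
  have "(real N + 7) * B0 \<le> (real N + 7) * (B + 1)" using AB(2) by (intro mult_left_mono) auto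
  then have "A \<le> (real N + 7) * B + (real N + 7) + 1" using hi AB(1) by (simp add: algebra_simps)
  then show 2: "A \<le> (real N + 8) * B" using B2 by (simp add: algebra_simps)
  show 3: "19 \<le> B" using B2 by simp
  have "0 < (real N + 5) * B" using 3 by simp
  then have "0 < A" using 1 by linarith
  moreover have "touch A B \<le> 3 * (real N + 8) / 2"
    using 2 3 by (simp add: touch_def field_simps)
  then have "\<omega>' (touch A B) \<le> B / 8" using \<omega>'_mono[of "touch A B" "3 * (real N + 8) / 2"] B1 by (simp add: \<beta>_def)
  ultimately show "admissible A B" using 3 by (simp add: admissible_def)
qed

text \<open>
  A bump that lowers the \<open>x\<close>-derivative by \<open>guard N\<close> makes the derivative of stage \<open>N + 1\<close> along any slope at most
  \<open>\<omega>\<close>; superlinearity of \<open>\<omega>\<close> provides this number.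
\<close>

definition guard :: "nat \<Rightarrow> real" where
  "guard N = (SOME C. 0 \<le> C \<and> (\<forall>p. (\<beta> (Suc N) + 2) * \<bar>p\<bar> - C \<le> \<omega> p))"

lemma guard: "0 \<le> guard N" "(\<beta> (Suc N) + 2) * \<bar>p\<bar> - guard N \<le> \<omega> p"
  using someI_ex[OF \<omega>_ge_linear[of "\<beta> (Suc N) + 2", unfolded Bex_def, simplified]]
  unfolding guard_def by auto

end

section \<open>The calibrating field\<close>

text \<open>
  The neighbourhoods \<open>P k\<close> shrink to \<open>S\<close>. The bump \<open>g k\<close> is supported in \<open>K k \<subseteq> P k\<close> and adds nearly the
  multiple \<open>s k\<close> of the vector \<open>(- (\<alpha> (k + 1) - \<alpha> k), \<beta> (k + 1) - \<beta> k)\<close> to the gradient, and all of it on \<open>P (k + 1)\<close>.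
  The bump \<open>\<eta> k\<close> is the small correction that lowers the \<open>x\<close>-derivative by more than \<open>guard k\<close> on \<open>P (k + 1)\<close>. All
  errors at step \<open>k\<close> are at most \<open>(1/2) ^ (k + 1)\<close>, so that they sum to at most \<open>1\<close>.
\<close>

locale singular_layers = convex_integrand \<omega> for \<omega> +
  fixes S :: "(real \<times> real) set"
    and g \<eta> s \<sigma> :: "nat \<Rightarrow> real \<times> real \<Rightarrow> real" and P K :: "nat \<Rightarrow> (real \<times> real) set"
  assumes S_compact: "compact S"
    and P_0: "P 0 = UNIV" and P_open: "\<And>k. open (P k)" and S_sub_P: "\<And>k. S \<subseteq> P k"
    and P_Suc: "\<And>k. P (Suc k) \<subseteq> P k" and P_near: "\<And>k. P (Suc k) \<subseteq> (\<Union>x\<in>S. ball x (1 / real (Suc k)))"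
    and g_smooth: "\<And>k. smooth_on UNIV (g k)" and K_closed: "\<And>k. closed (K k)" and K_sub: "\<And>k. K k \<subseteq> P k"
    and g_outside: "\<And>k z. z \<notin> K k \<Longrightarrow> g k z = 0" and g_small: "\<And>k z. \<bar>g k z\<bar> \<le> (1/2) ^ Suc k"
    and s_range: "\<And>k z. 0 \<le> s k z \<and> s k z \<le> 1" and s_1: "\<And>k z. z \<in> P (Suc k) \<Longrightarrow> s k z = 1"
    and g_x: "\<And>k z. \<bar>frechet_derivative (g k) (at z) (1, 0) + (\<alpha> (Suc k) - \<alpha> k) * s k z\<bar> \<le> (1/2) ^ Suc k"
    and g_y: "\<And>k z. \<bar>frechet_derivative (g k) (at z) (0, 1) - (\<beta> (Suc k) - \<beta> k) * s k z\<bar> \<le> (1/2) ^ Suc k"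
    and \<eta>_smooth: "\<And>k. smooth_on UNIV (\<eta> k)" and \<eta>_small: "\<And>k z. \<bar>\<eta> k z\<bar> \<le> (1/2) ^ Suc k"
    and \<sigma>_range: "\<And>k z. 0 \<le> \<sigma> k z \<and> \<sigma> k z \<le> 1" and \<sigma>_1: "\<And>k z. z \<in> P (Suc k) \<Longrightarrow> \<sigma> k z = 1"
    and \<eta>_x: "\<And>k z. \<bar>frechet_derivative (\<eta> k) (at z) (1, 0) + (guard k + 1) * \<sigma> k z\<bar> \<le> (1/2) ^ Suc k"
    and \<eta>_y: "\<And>k z. \<bar>frechet_derivative (\<eta> k) (at z) (0, 1)\<bar> \<le> (1/2) ^ Suc k"
begin

definition gx :: "nat \<Rightarrow> real \<times> real \<Rightarrow> real" where
  "gx k z = frechet_derivative (g k) (at z) (1, 0)"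

definition gy :: "nat \<Rightarrow> real \<times> real \<Rightarrow> real" where
  "gy k z = frechet_derivative (g k) (at z) (0, 1)"

definition \<Phi> :: "nat \<Rightarrow> real \<times> real \<Rightarrow> real" where
  "\<Phi> N z = - \<alpha> 0 * fst z + \<beta> 0 * snd z + (\<Sum>k<N. g k z)"

text \<open>
  The gradient of \<open>\<Phi> N\<close> is \<open>(- A_upto N, B_upto N)\<close>.
\<close>

definition A_upto :: "nat \<Rightarrow> real \<times> real \<Rightarrow> real" where
  "A_upto N z = \<alpha> 0 - (\<Sum>k<N. gx k z)"

definition B_upto :: "nat \<Rightarrow> real \<times> real \<Rightarrow> real" where
  "B_upto N z = \<beta> 0 + (\<Sum>k<N. gy k z)"

lemma \<Phi>_derivative: "(\<Phi> N has_derivative (\<lambda>v. - A_upto N z * fst v + B_upto N z * snd v)) (at z)"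
proof -
  have "(\<Phi> N has_derivative (\<lambda>v. - \<alpha> 0 * fst v + \<beta> 0 * snd v + (\<Sum>k<N. gx k z * fst v + gy k z * snd v))) (at z)"
    unfolding \<Phi>_def[abs_def] gx_def gy_def
    by (intro has_derivative_add has_derivative_sum frechet_derivative_pair g_smooth has_derivative_mult_right
        has_derivative_fst has_derivative_snd has_derivative_ident)
  moreover have "- \<alpha> 0 * fst v + \<beta> 0 * snd v + (\<Sum>k<N. gx k z * fst v + gy k z * snd v) = - A_upto N z * fst v + B_upto N z * snd v" for v
  proof -
    have "(\<Sum>k<N. gx k z * fst v + gy k z * snd v) = (\<Sum>k<N. gx k z) * fst v + (\<Sum>k<N. gy k z) * snd v"
      by (simp add: sum.distrib sum_distrib_right)
    then show ?thesis by (simp add: A_upto_def B_upto_def algebra_simps)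
  qed
  ultimately show ?thesis by simp
qed

lemma sum_halves: "(\<Sum>k<N. (1/2::real) ^ Suc k) \<le> 1"
proof -
  have "(\<Sum>k<N. (1/2::real) ^ Suc k) = 1 - (1/2) ^ N" by (induction N) auto
  then show ?thesis by simp
qed

lemma P_antimono: "m \<le> n \<Longrightarrow> P n \<subseteq> P m"
  by (rule lift_Suc_antimono_le[of P]) (use P_Suc in auto)

lemma g_gradient: "\<bar>gx k z + (\<alpha> (Suc k) - \<alpha> k) * s k z\<bar> \<le> (1/2) ^ Suc k" "\<bar>gy k z - (\<beta> (Suc k) - \<beta> k) * s k z\<bar> \<le> (1/2) ^ Suc k"
  using g_x g_y by (auto simp: gx_def gy_def)

lemma A_upto_dev: "\<bar>A_upto N z - (\<alpha> 0 + (\<Sum>k<N. (\<alpha> (Suc k) - \<alpha> k) * s k z))\<bar> \<le> 1"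
proof -
  have "A_upto N z - (\<alpha> 0 + (\<Sum>k<N. (\<alpha> (Suc k) - \<alpha> k) * s k z)) = - (\<Sum>k<N. gx k z + (\<alpha> (Suc k) - \<alpha> k) * s k z)"
    by (simp add: A_upto_def sum.distrib)
  also have "\<bar>\<dots>\<bar> \<le> (\<Sum>k<N. (1/2) ^ Suc k)"
    unfolding abs_minus_cancel by (rule order_trans[OF sum_abs sum_mono]) (rule g_gradient)
  finally show ?thesis using sum_halves[of N] by linarith
qed

lemma B_upto_dev: "\<bar>B_upto N z - (\<beta> 0 + (\<Sum>k<N. (\<beta> (Suc k) - \<beta> k) * s k z))\<bar> \<le> 1"
proof -
  have "B_upto N z - (\<beta> 0 + (\<Sum>k<N. (\<beta> (Suc k) - \<beta> k) * s k z)) = (\<Sum>k<N. gy k z - (\<beta> (Suc k) - \<beta> k) * s k z)"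
    by (simp add: B_upto_def sum_subtractf)
  also have "\<bar>\<dots>\<bar> \<le> (\<Sum>k<N. (1/2) ^ Suc k)"
    by (rule order_trans[OF sum_abs sum_mono]) (rule g_gradient)
  finally show ?thesis using sum_halves[of N] by linarith
qed

lemma plateau_sum:
  assumes "z \<in> P N"
  shows "c 0 + (\<Sum>k<N. (c (Suc k) - c k) * s k z) = (c N :: real)"
proof -
  have "(\<Sum>k<N. (c (Suc k) - c k) * s k z) = (\<Sum>k<N. c (Suc k) - c k)"
  proof (rule sum.cong[OF refl])
    fix k assume "k \<in> {..<N}"
    then have "z \<in> P (Suc k)" using P_antimono[of "Suc k" N] assms by auto
    then show "(c (Suc k) - c k) * s k z = c (Suc k) - c k" using s_1 by simp
  qed
  then show ?thesis by (simp add: sum_lessThan_telescope)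
qed

text \<open>
  On \<open>P N\<close> the first \<open>N\<close> bumps act with full strength, and the sums telescope.
\<close>

lemma plateau: "z \<in> P N \<Longrightarrow> \<bar>A_upto N z - \<alpha> N\<bar> \<le> 1" "z \<in> P N \<Longrightarrow> \<bar>B_upto N z - \<beta> N\<bar> \<le> 1"
  using A_upto_dev[of N z] B_upto_dev[of N z] plateau_sum[of z N \<alpha>] plateau_sum[of z N \<beta>] by simp_all

lemma transition:
  assumes "z \<in> P N"
  shows "\<bar>A_upto (Suc N) z - ((1 - s N z) * \<alpha> N + s N z * \<alpha> (Suc N))\<bar> \<le> 1"
    "\<bar>B_upto (Suc N) z - ((1 - s N z) * \<beta> N + s N z * \<beta> (Suc N))\<bar> \<le> 1"
proof -
  have e: "c 0 + (\<Sum>k<Suc N. (c (Suc k) - c k) * s k z) = (1 - s N z) * c N + s N z * c (Suc N)" for c :: "nat \<Rightarrow> real"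
    using plateau_sum[OF assms, of c] by (simp add: algebra_simps)
  show "\<bar>A_upto (Suc N) z - ((1 - s N z) * \<alpha> N + s N z * \<alpha> (Suc N))\<bar> \<le> 1"
    using A_upto_dev[of "Suc N" z] unfolding e .
  show "\<bar>B_upto (Suc N) z - ((1 - s N z) * \<beta> N + s N z * \<beta> (Suc N))\<bar> \<le> 1"
    using B_upto_dev[of "Suc N" z] unfolding e .
qed

lemma g_zero:
  assumes "z \<notin> P k"
  shows "g k z = 0" "gx k z = 0" "gy k z = 0"
proof -
  have z: "z \<in> - K k" "open (- K k)" using assms K_sub K_closed by auto
  show "g k z = 0" using z g_outside by auto
  have "((\<lambda>z. 0) has_derivative (\<lambda>v. 0)) (at z)" by simp
  then have "(g k has_derivative (\<lambda>v. 0)) (at z)"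
    by (rule has_derivative_transform_within_open[OF _ z(2,1)]) (use g_outside in auto)
  then have "frechet_derivative (g k) (at z) = (\<lambda>v. 0)" using frechet_derivative_at by metis
  then show "gx k z = 0" "gy k z = 0" by (simp_all add: gx_def gy_def)
qed

lemma sum_stable:
  assumes "z \<notin> P N" "N \<le> M" "\<And>k. z \<notin> P k \<Longrightarrow> f k = (0::real)"
  shows "(\<Sum>k<M. f k) = (\<Sum>k<N. f k)"
proof (rule sum.mono_neutral_right)
  show "\<forall>k\<in>{..<M} - {..<N}. f k = 0"
  proof (intro ballI assms(3))
    fix k assume "k \<in> {..<M} - {..<N}"
    then have "P k \<subseteq> P N" by (intro P_antimono) simp
    then show "z \<notin> P k" using assms(1) by blast
  qed
qed (use assms in auto)

text \<open>
  Outside \<open>P N\<close> only the first \<open>N\<close> bumps are present. As every point off \<open>S\<close> has a neighbourhood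
  that misses some \<open>P N\<close>, the series are locally finite off \<open>S\<close>.
\<close>

lemma stable_outside:
  assumes "z \<notin> P N" "N \<le> M"
  shows "A_upto M z = A_upto N z" "B_upto M z = B_upto N z" "\<Phi> M z = \<Phi> N z"
  using sum_stable[OF assms, of "\<lambda>k. gx k z"] sum_stable[OF assms, of "\<lambda>k. gy k z"] sum_stable[OF assms, of "\<lambda>k. g k z"] g_zero
  by (simp_all add: A_upto_def B_upto_def \<Phi>_def)

lemma misses_some_layer:
  assumes "z \<notin> S"
  shows "\<exists>V N. open V \<and> z \<in> V \<and> V \<inter> P N = {}"
proof -
  have "open (- S)" using S_compact compact_imp_closed by auto
  then obtain e where e: "e > 0" "ball z e \<subseteq> - S" using assms by (meson ComplI open_contains_ball)
  obtain k where k: "1 / real (Suc k) < e / 2" using e(1) nat_approx_posE[of "e / 2"] by auto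
  have "ball z (e / 2) \<inter> P (Suc k) = {}"
  proof (rule ccontr)
    assume "\<not> ?thesis"
    then obtain w where w: "w \<in> ball z (e / 2)" "w \<in> P (Suc k)" by blast
    then obtain x where x: "x \<in> S" "dist x w < 1 / real (Suc k)" using P_near[of k] by auto
    have "dist z x < e" using w(1) x(2) k dist_triangle[of z x w] by (simp add: dist_commute)
    then show False using e(2) x(1) by auto
  qed
  then show ?thesis using e(1) by (intro exI[of _ "ball z (e / 2)"] exI[of _ "Suc k"]) auto
qed

text \<open>
  Off \<open>S\<close> this is the index of the last layer that contains \<open>z\<close>; only the bump with this index can be in
  transition at \<open>z\<close>, and the later ones vanish.
\<close>

definition stage :: "real \<times> real \<Rightarrow> nat" where
  "stage z = (LEAST N. z \<notin> P (Suc N))"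

lemma stage:
  assumes "z \<notin> S"
  shows "z \<notin> P (Suc (stage z))" "z \<in> P (stage z)"
proof -
  obtain N where N: "z \<notin> P N" using misses_some_layer[OF assms] by blast
  then obtain N' where "N = Suc N'" using P_0 by (cases N) auto
  then show 1: "z \<notin> P (Suc (stage z))" unfolding stage_def using N by (metis (mono_tags, lifting) LeastI)
  show "z \<in> P (stage z)"
  proof (cases "stage z")
    case 0
    then show ?thesis using P_0 by simp
  next
    case (Suc m)
    then have "\<not> (z \<notin> P (Suc m))" unfolding stage_def by (intro not_less_Least) simp
    then show ?thesis using Suc by simp
  qed
qed

lemma stage_ge: "z \<notin> S \<Longrightarrow> z \<in> P N \<Longrightarrow> N \<le> stage z"
  using stage(1)[of z] P_antimono[of "Suc (stage z)" N] by (meson not_less_eq_eq subsetD)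

definition A :: "real \<times> real \<Rightarrow> real" where "A z = A_upto (Suc (stage z)) z"
definition B :: "real \<times> real \<Rightarrow> real" where "B z = B_upto (Suc (stage z)) z"

lemma AB_eq:
  assumes "z \<notin> P N"
  shows "A_upto N z = A z" "B_upto N z = B z"
proof -
  have z: "z \<notin> S" using assms S_sub_P by auto
  show "A_upto N z = A z" unfolding A_def
    using stable_outside(1)[OF assms, of "Suc (stage z)"] stable_outside(1)[OF stage(1)[OF z], of N] by (metis linear)
  show "B_upto N z = B z" unfolding B_def
    using stable_outside(2)[OF assms, of "Suc (stage z)"] stable_outside(2)[OF stage(1)[OF z], of N] by (metis linear)
qed

lemma field_bounds:
  assumes "z \<notin> S"
  shows "admissible (A z) (B z)" "(real (stage z) + 5) * B z \<le> A z" "19 \<le> B z"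
  using stage_bounds[of "s (stage z) z" "A z" "stage z" "B z"] s_range transition[OF stage(2)[OF assms]]
  by (auto simp: A_def B_def)

lemma field_pos: "z \<notin> S \<Longrightarrow> 0 < A z" "z \<notin> S \<Longrightarrow> 0 < B z"
  using field_bounds(1) by (auto simp: admissible_def)

text \<open>
  The ratio \<open>A / B\<close> tends to infinity at \<open>S\<close>.
\<close>

lemma field_ratio:
  assumes "z \<notin> S" "z \<in> P N"
  shows "(real N + 5) * B z \<le> A z"
proof -
  have "(real N + 5) * B z \<le> (real (stage z) + 5) * B z"
    using stage_ge[OF assms] field_pos[OF assms(1)] by (intro mult_right_mono) auto
  then show ?thesis using field_bounds(2)[OF assms(1)] by linarith
qed

lemma A_upto_smooth: "smooth_on UNIV (A_upto N)" and B_upto_smooth: "smooth_on UNIV (B_upto N)"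
  unfolding A_upto_def[abs_def] B_upto_def[abs_def] gx_def gy_def
  by (intro smooth_on_diff smooth_on_add smooth_on_sum smooth_on_const smooth_on_directional_derivative g_smooth open_UNIV)+

definition F :: "real \<times> real \<times> real \<Rightarrow> real" where
  "F z = (if (fst z, fst (snd z)) \<in> S then 0
     else bend (A (fst z, fst (snd z))) (B (fst z, fst (snd z))) (snd (snd z)))"

lemma F_eq_0:
  assumes "(x, y) \<in> P N" "14 * p \<le> 5 * (real N + 5)"
  shows "F (x, y, p) = 0"
proof (cases "(x, y) \<in> S")
  case False
  have "14 * p * B (x, y) \<le> 5 * (real N + 5) * B (x, y)"
    using assms(2) field_pos[OF False] by (intro mult_right_mono) auto
  also have "\<dots> = 5 * ((real N + 5) * B (x, y))" by (simp only: mult.assoc)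
  also have "\<dots> \<le> 5 * A (x, y)" using field_ratio[OF False assms(1)] by (intro mult_left_mono) auto
  finally show ?thesis using bend_eq_0[OF field_bounds(1)[OF False], of p] False by (simp add: F_def mult_ac)
qed (simp add: F_def)

lemma F_nonneg: "0 \<le> F (x, y, p)"
  using bend_nonneg field_bounds(1) by (simp add: F_def)

lemma F_at_0: "F (x, y, 0) = 0"
  using F_eq_0[of x y 0 0] P_0 by simp

lemma F_convex: "convex_on UNIV (\<lambda>p. F (x, y, p))"
proof (cases "(x, y) \<in> S")
  case True
  then show ?thesis by (simp add: F_def convex_on_const)
next
  case False
  then show ?thesis using bend_convex[OF field_bounds(1)[OF False]] by (simp add: F_def)
qed

text \<open>
  Off \<open>S\<close> the functions \<open>A\<close> and \<open>B\<close> locally coincide with finite sums. At a point \<open>(x, y, p)\<close> with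
  \<open>(x, y) \<in> S\<close> the function \<open>F\<close> vanishes on a neighbourhood, because near \<open>(x, y)\<close> the ratio \<open>A / B\<close> is so large that the bend
  starts only beyond \<open>p + 1\<close>.
\<close>

lemma F_smooth: "smooth_on UNIV F"
proof (rule smooth_on_local)
  fix w :: "real \<times> real \<times> real"
  define b where "b = (\<lambda>w::real \<times> real \<times> real. (fst w, fst (snd w)))"
  have b: "bounded_linear b" unfolding b_def
    by (intro bounded_linear_Pair bounded_linear_fst bounded_linear_fst_comp bounded_linear_snd)
  then have cb: "continuous_on UNIV b" by (rule linear_continuous_on)
  have ob: "open (b -` V)" if "open V" for V
    using continuous_on_open_vimage[OF open_UNIV, of b] cb that by auto
  have bp: "bounded_linear (\<lambda>w::real \<times> real \<times> real. snd (snd w))"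
    by (intro bounded_linear_snd_comp bounded_linear_snd)
  show "\<exists>V. open V \<and> w \<in> V \<and> smooth_on V F"
  proof (cases "b w \<in> S")
    case True
    obtain N :: nat where N: "14 * (snd (snd w) + 1) \<le> 5 * (real N + 5)"
    proof -
      obtain N :: nat where "14 * (snd (snd w) + 1) \<le> real N" using real_arch_simple by blast
      also have "real N \<le> 5 * (real N + 5)" by simp
      finally have "14 * (snd (snd w) + 1) \<le> 5 * (real N + 5)" .
      then show thesis by (rule that)
    qed
    define V where "V = b -` P N \<inter> {v. snd (snd v) < snd (snd w) + 1}"
    have "open V" unfolding V_def
      by (intro open_Int ob P_open open_Collect_less continuous_intros)
    moreover have "w \<in> V" using True S_sub_P by (auto simp: V_def)
    moreover have "smooth_on V F"
    proof (rule smooth_on_cong[OF \<open>open V\<close> _ smooth_on_const[OF \<open>open V\<close>, of 0]])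
      fix v assume v: "v \<in> V"
      have "F (fst v, fst (snd v), snd (snd v)) = 0"
        by (rule F_eq_0[of _ _ N]) (use v N in \<open>auto simp: V_def b_def\<close>)
      then show "0 = F v" by simp
    qed
    ultimately show ?thesis by blast
  next
    case False
    obtain V N where V: "open V" "b w \<in> V" "V \<inter> P N = {}" using misses_some_layer[OF False] by blast
    define U where "U = b -` V"
    have oU: "open U" "w \<in> U" using ob V by (auto simp: U_def)
    have out: "b v \<notin> P N" "b v \<notin> S" if "v \<in> U" for v using that V(3) S_sub_P[of N] by (auto simp: U_def)
    have "smooth_on U (\<lambda>v. bend (A_upto N (b v)) (B_upto N (b v)) (snd (snd v)))"
    proof (rule smooth_on_bend[OF oU(1)])
      show "smooth_on U (\<lambda>v. A_upto N (b v))" "smooth_on U (\<lambda>v. B_upto N (b v))"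
        by (rule smooth_on_compose_linear[OF oU(1) b A_upto_smooth] smooth_on_compose_linear[OF oU(1) b B_upto_smooth]; simp)+
      show "smooth_on U (\<lambda>v. snd (snd v))" by (rule smooth_on_bounded_linear[OF oU(1) bp])
      show "admissible (A_upto N (b v)) (B_upto N (b v))" if "v \<in> U" for v
        unfolding AB_eq[OF out(1)[OF that]] by (rule field_bounds(1)[OF out(2)[OF that]])
    qed
    then have "smooth_on U F"
      by (rule smooth_on_cong[OF oU(1), rotated])
        (use out AB_eq in \<open>simp add: F_def b_def\<close>)
    then show ?thesis using oU by blast
  qed
qed

text \<open>
  The reciprocal of the touching slope. It extends continuously to \<open>S\<close> by zero, so trajectories are
  solutions of \<open>dx/dy = \<kappa>\<close>.
\<close>

definition \<kappa> :: "real \<times> real \<Rightarrow> real" where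
  "\<kappa> z = (if z \<in> S then 0 else 2 * B z / (3 * A z))"

lemma \<kappa>_bound:
  assumes "z \<in> P N"
  shows "\<kappa> z \<le> 2 / (3 * (real N + 5))"
proof (cases "z \<in> S")
  case False
  have "2 * B z / (3 * A z) \<le> 2 * B z / (3 * ((real N + 5) * B z))"
    using field_ratio[OF False assms] field_pos[OF False] by (intro divide_left_mono) auto
  also have "\<dots> = 2 / (3 * (real N + 5))" using field_pos(2)[OF False] by simp
  finally show ?thesis using False by (simp add: \<kappa>_def)
qed (simp add: \<kappa>_def)

lemma \<kappa>_nonneg: "0 \<le> \<kappa> z"
proof (cases "z \<in> S")
  case False
  then show ?thesis using field_pos[OF False] by (simp add: \<kappa>_def)
qed (simp add: \<kappa>_def)

lemma \<kappa>_pos: "z \<notin> S \<Longrightarrow> 0 < \<kappa> z"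
  using field_pos[of z] by (simp add: \<kappa>_def)

lemma \<kappa>_on_S: "z \<in> S \<Longrightarrow> \<kappa> z = 0"
  by (simp add: \<kappa>_def)

lemma \<kappa>_le_1: "\<kappa> z \<le> 1"
  using \<kappa>_bound[of z 0] P_0 by simp

lemma \<kappa>_continuous: "continuous_on UNIV \<kappa>"
proof (rule continuous_at_imp_continuous_on, rule ballI)
  fix z
  show "isCont \<kappa> z"
  proof (cases "z \<in> S")
    case True
    have "(\<kappa> \<longlongrightarrow> 0) (at z)"
    proof (rule tendstoI)
      fix e :: real assume "0 < e"
      then obtain N where N: "1 / real (Suc N) < e" using nat_approx_posE by blast
      have "2 / (3 * (real N + 5)) \<le> 1 / real (Suc N)" by (simp add: field_simps)
      then have "\<bar>\<kappa> w\<bar> < e" if "w \<in> P N" for w using \<kappa>_bound[OF that] \<kappa>_nonneg[of w] N by simp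
      moreover have "\<forall>\<^sub>F w in at z. w \<in> P N"
        using P_open[of N] S_sub_P[of N] True by (intro eventually_at_in_open') auto
      ultimately show "\<forall>\<^sub>F w in at z. dist (\<kappa> w) 0 < e" by (auto elim: eventually_mono)
    qed
    then show ?thesis using True by (simp add: isCont_def \<kappa>_def)
  next
    case False
    obtain V N where V: "open V" "z \<in> V" "V \<inter> P N = {}" using misses_some_layer[OF False] by blast
    have out: "v \<notin> P N" "v \<notin> S" if "v \<in> V" for v using that V(3) S_sub_P[of N] by auto
    have "continuous_on V (\<lambda>v. 2 * B_upto N v / (3 * A_upto N v))"
    proof (intro continuous_on_divide continuous_on_mult continuous_on_const ballI)
      show "continuous_on V (A_upto N)" "continuous_on V (B_upto N)"
        using smooth_on_imp_continuous_on[OF A_upto_smooth[of N]] smooth_on_imp_continuous_on[OF B_upto_smooth[of N]]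
        by (auto intro: continuous_on_subset)
      show "3 * A_upto N v \<noteq> 0" if "v \<in> V" for v
        using AB_eq(1)[OF out(1)[OF that]] field_pos(1)[OF out(2)[OF that]] by simp
    qed
    then have "continuous_on V \<kappa>"
    proof (rule continuous_on_eq)
      show "2 * B_upto N v / (3 * A_upto N v) = \<kappa> v" if "v \<in> V" for v
        using AB_eq[OF out(1)[OF that]] out(2)[OF that] by (simp add: \<kappa>_def)
    qed
    then show ?thesis using V continuous_on_eq_continuous_at by blast
  qed
qed

lemma field_calibrates:
  assumes "(x, y) \<notin> S"
  shows "B (x, y) * p - A (x, y) \<le> \<omega> p + F (x, y, p)"
  using calibration_le[OF field_bounds(1)[OF assms], of p] assms by (simp add: F_def)

text \<open>
  The calibration inequality is an equality along trajectories; multiplied by \<open>\<kappa> = dx/dy\<close>, the left-hand side is the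
  integrand with respect to \<open>y\<close>.
\<close>

lemma field_tight:
  assumes z: "(x, y) \<notin> S"
  shows "(\<omega> (1 / \<kappa> (x, y)) + F (x, y, 1 / \<kappa> (x, y))) * \<kappa> (x, y) = B (x, y) - A (x, y) * \<kappa> (x, y)"
proof -
  have k: "1 / \<kappa> (x, y) = touch (A (x, y)) (B (x, y))" using z by (simp add: \<kappa>_def touch_def)
  have "\<omega> (1 / \<kappa> (x, y)) + F (x, y, 1 / \<kappa> (x, y)) = B (x, y) * (1 / \<kappa> (x, y)) - A (x, y)"
    unfolding k using calibration_eq[OF field_bounds(1)[OF z]] z by (simp add: F_def)
  then show ?thesis using \<kappa>_pos[OF z] by (simp add: left_diff_distrib)
qed

text \<open>
  All partial sums \<open>\<Phi> N\<close> are nondecreasing along trajectories, also near \<open>S\<close>, where the partial sum does not have the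
  gradient \<open>(- A, B)\<close>. There \<open>A_upto N / B_upto N\<close> is about \<open>N + 6\<close>, while \<open>\<kappa>\<close> is at most \<open>2 / (3 (N + 5))\<close>.
\<close>

lemma slope_nonneg: "0 \<le> B_upto N z - A_upto N z * \<kappa> z"
proof (cases "z \<in> P N")
  case True
  have b: "20 \<le> \<beta> N" using \<beta>_ge[of N] by simp
  have "A_upto N z * \<kappa> z \<le> (\<alpha> N + 1) * (2 / (3 * (real N + 5)))"
    using plateau(1)[OF True] \<kappa>_bound[OF True] \<kappa>_nonneg[of z] \<alpha>_ge[of N] by (intro mult_mono) auto
  also have "\<dots> \<le> \<beta> N - 1"
  proof -
    have "2 * (\<alpha> N + 1) \<le> (\<beta> N - 1) * (3 * (real N + 5))"
    proof -
      have "real N * 20 \<le> real N * \<beta> N" using b by (intro mult_left_mono) auto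
      then show ?thesis using b by (simp add: \<alpha>_def algebra_simps)
    qed
    then show ?thesis by (simp add: field_simps)
  qed
  also have "\<dots> \<le> B_upto N z" using plateau(2)[OF True] by linarith
  finally show ?thesis by simp
next
  case False
  then have z: "z \<notin> S" using S_sub_P by auto
  have "A z * \<kappa> z = 2 * B z / 3" using field_pos[OF z] z by (simp add: \<kappa>_def)
  then show ?thesis using AB_eq[OF False] field_pos(2)[OF z] by simp
qed

definition \<Phi>_lim :: "real \<times> real \<Rightarrow> real" where
  "\<Phi>_lim z = - \<alpha> 0 * fst z + \<beta> 0 * snd z + (\<Sum>k. g k z)"

lemma \<Phi>_tendsto: "(\<lambda>N. \<Phi> N z) \<longlonglongrightarrow> \<Phi>_lim z"
proof -
  have "summable (\<lambda>k. (1/2::real) ^ Suc k)" by (simp add: summable_geometric)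
  then have "summable (\<lambda>k. g k z)"
    by (rule summable_comparison_test'[of _ 0]) (use g_small in simp)
  then have "(\<lambda>N. \<Sum>k<N. g k z) \<longlonglongrightarrow> (\<Sum>k. g k z)" by (rule summable_LIMSEQ)
  then show ?thesis unfolding \<Phi>_def \<Phi>_lim_def by (intro tendsto_intros)
qed

text \<open>
  The partial sum of stage \<open>N + 1\<close> together with its correction around \<open>S\<close>.
\<close>

definition \<Psi> :: "nat \<Rightarrow> real \<times> real \<Rightarrow> real" where
  "\<Psi> N z = \<Phi> (Suc N) z + \<eta> N z"

definition \<Psi>' :: "nat \<Rightarrow> real \<times> real \<Rightarrow> real \<times> real \<Rightarrow> real" where
  "\<Psi>' N z v = (- A_upto (Suc N) z + frechet_derivative (\<eta> N) (at z) (1, 0)) * fst v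
     + (B_upto (Suc N) z + frechet_derivative (\<eta> N) (at z) (0, 1)) * snd v"

lemma \<Psi>_derivative: "(\<Psi> N has_derivative \<Psi>' N z) (at z)"
proof -
  have "(\<Psi> N has_derivative (\<lambda>v. (- A_upto (Suc N) z * fst v + B_upto (Suc N) z * snd v)
     + (frechet_derivative (\<eta> N) (at z) (1, 0) * fst v + frechet_derivative (\<eta> N) (at z) (0, 1) * snd v))) (at z)"
    unfolding \<Psi>_def[abs_def] by (intro has_derivative_add \<Phi>_derivative frechet_derivative_pair \<eta>_smooth)
  then show ?thesis by (rule has_derivative_eq_rhs) (simp add: \<Psi>'_def fun_eq_iff algebra_simps)
qed

lemma \<Psi>_tendsto: "(\<lambda>N. \<Psi> N z) \<longlonglongrightarrow> \<Phi>_lim z"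
proof -
  have h: "(\<lambda>N. (1/2::real) ^ Suc N) \<longlonglongrightarrow> 0" by (intro LIMSEQ_Suc LIMSEQ_realpow_zero) auto
  have "(\<lambda>N. \<eta> N z) \<longlonglongrightarrow> 0"
    by (rule Lim_null_comparison[OF _ h]) (use \<eta>_small in auto)
  from tendsto_add[OF LIMSEQ_Suc[OF \<Phi>_tendsto] this] show ?thesis by (simp add: \<Psi>_def)
qed

lemma \<Psi>_lipschitz: "\<exists>C. C-lipschitz_on UNIV (\<Psi> N)"
proof -
  define C1 where "C1 = \<bar>\<alpha> 0\<bar> + (\<Sum>k<Suc N. \<bar>\<alpha> (Suc k) - \<alpha> k\<bar>) + 1 + (guard N + 2)"
  define C2 where "C2 = \<bar>\<beta> 0\<bar> + (\<Sum>k<Suc N. \<bar>\<beta> (Suc k) - \<beta> k\<bar>) + 1 + 1"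
  have half: "(1/2::real) ^ Suc N \<le> 1" using power_le_one[of "1/2::real" "Suc N"] by simp
  have sb: "\<bar>\<Sum>k<Suc N. (c (Suc k) - c k) * s k z\<bar> \<le> (\<Sum>k<Suc N. \<bar>c (Suc k) - c k\<bar>)" for c :: "nat \<Rightarrow> real" and z
  proof (rule order_trans[OF sum_abs sum_mono])
    show "\<bar>(c (Suc k) - c k) * s k z\<bar> \<le> \<bar>c (Suc k) - c k\<bar>" for k
      unfolding abs_mult using s_range[of k z] by (intro mult_left_le) auto
  qed
  have gs: "0 \<le> (guard N + 1) * \<sigma> N z \<and> (guard N + 1) * \<sigma> N z \<le> guard N + 1" for z
    using guard(1)[of N] \<sigma>_range[of N z] mult_left_le[of "\<sigma> N z" "guard N + 1"] by simp
  have p1: "\<bar>- A_upto (Suc N) z + frechet_derivative (\<eta> N) (at z) (1, 0)\<bar> \<le> C1" for z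
    using A_upto_dev[of "Suc N" z] sb[of \<alpha> z] \<eta>_x[of N z] gs[of z] half unfolding C1_def by linarith
  have p2: "\<bar>B_upto (Suc N) z + frechet_derivative (\<eta> N) (at z) (0, 1)\<bar> \<le> C2" for z
    using B_upto_dev[of "Suc N" z] sb[of \<beta> z] \<eta>_y[of N z] half unfolding C2_def by linarith
  have "C1 \<ge> 0" "C2 \<ge> 0" using p1[of "(0,0)"] p2[of "(0,0)"] by linarith+
  have "(C1 + C2)-lipschitz_on UNIV (\<Psi> N)"
  proof (rule lipschitz_onI)
    fix z w :: "real \<times> real"
    have "norm (\<Psi> N z - \<Psi> N w) \<le> (C1 + C2) * norm (z - w)"
    proof (rule differentiable_bound[OF convex_UNIV])
      show "(\<Psi> N has_derivative \<Psi>' N z) (at z within UNIV)" for z using \<Psi>_derivative by simp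
      show "onorm (\<Psi>' N z) \<le> C1 + C2" for z
      proof (rule onorm_le)
        fix v :: "real \<times> real"
        have "\<bar>\<Psi>' N z v\<bar> \<le> C1 * \<bar>fst v\<bar> + C2 * \<bar>snd v\<bar>"
          unfolding \<Psi>'_def
          by (rule order_trans[OF abs_triangle_ineq add_mono]; unfold abs_mult; intro mult_right_mono p1 p2 abs_ge_zero)
        also have "\<dots> \<le> C1 * norm v + C2 * norm v"
          using norm_fst_le[of "fst v" "snd v"] norm_snd_le[of "snd v" "fst v"] \<open>C1 \<ge> 0\<close> \<open>C2 \<ge> 0\<close>
          by (intro add_mono mult_left_mono) auto
        finally show "norm (\<Psi>' N z v) \<le> (C1 + C2) * norm v" by (simp add: distrib_right)
      qed
    qed auto
    then show "dist (\<Psi> N z) (\<Psi> N w) \<le> (C1 + C2) * dist z w" by (simp add: dist_norm)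
  qed (use \<open>C1 \<ge> 0\<close> \<open>C2 \<ge> 0\<close> in simp)
  then show ?thesis by blast
qed

text \<open>
  Off \<open>P (N + 1)\<close> the gradient of \<open>\<Phi> (N + 1)\<close> is that of the calibrating field, and the
  correction contributes at most an error of order \<open>(1/2) ^ (N + 1) (1 + \<bar>p\<bar>)\<close>. On \<open>P (N + 1)\<close> the field inequality is not available, but
  the \<open>x\<close>-derivative is below \<open>- guard N\<close>, and the rest is bounded by \<open>\<omega>\<close> alone.
\<close>

lemma \<Psi>_calibrates:
  assumes C: "\<And>p. \<bar>p\<bar> - C \<le> \<omega> p" "0 \<le> C"
  shows "\<Psi>' N (x, y) (1, p) \<le> (1 + (1/2) ^ Suc N) * (\<omega> p + F (x, y, p)) + (1/2) ^ Suc N * (1 + C)"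
proof -
  define \<delta> :: real where "\<delta> = (1/2) ^ Suc N"
  define L where "L = \<omega> p + F (x, y, p)"
  define ex where "ex = frechet_derivative (\<eta> N) (at (x, y)) (1, 0)"
  define ey where "ey = frechet_derivative (\<eta> N) (at (x, y)) (0, 1)"
  have \<delta>: "0 < \<delta>" "\<delta> \<le> 1" using power_le_one[of "1/2::real" "Suc N"] by (auto simp: \<delta>_def)
  have L: "0 \<le> L" "\<omega> p \<le> L" using \<omega>_nonneg F_nonneg by (auto simp: L_def)
  have D: "\<Psi>' N (x, y) (1, p) = - A_upto (Suc N) (x, y) + ex + (B_upto (Suc N) (x, y) + ey) * p"
    by (simp add: \<Psi>'_def ex_def ey_def)
  have ey: "\<bar>ey\<bar> \<le> \<delta>" using \<eta>_y[of N "(x, y)"] unfolding ey_def \<delta>_def .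
  have "\<Psi>' N (x, y) (1, p) \<le> L + \<delta> * L + \<delta> * (1 + C)"
  proof (cases "(x, y) \<in> P (Suc N)")
    case True
    have "\<bar>ex + (guard N + 1)\<bar> \<le> \<delta>"
      using \<eta>_x[of N "(x, y)"] unfolding \<sigma>_1[OF True] ex_def \<delta>_def by (simp only: mult_1_right)
    then have "ex \<le> - guard N" using \<delta> by linarith
    moreover have "0 \<le> A_upto (Suc N) (x, y)" using plateau(1)[OF True] \<alpha>_ge[of "Suc N"] by linarith
    moreover have "(B_upto (Suc N) (x, y) + ey) * p \<le> (\<beta> (Suc N) + 2) * \<bar>p\<bar>"
    proof -
      have "\<bar>B_upto (Suc N) (x, y) + ey\<bar> \<le> \<beta> (Suc N) + 2"
        using plateau(2)[OF True] ey \<delta> \<beta>_ge[of "Suc N"] by linarith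
      then have "\<bar>(B_upto (Suc N) (x, y) + ey) * p\<bar> \<le> (\<beta> (Suc N) + 2) * \<bar>p\<bar>"
        unfolding abs_mult by (rule mult_right_mono) simp
      then show ?thesis by linarith
    qed
    ultimately have "\<Psi>' N (x, y) (1, p) \<le> (\<beta> (Suc N) + 2) * \<bar>p\<bar> - guard N" unfolding D by linarith
    also have "\<dots> \<le> L" using guard(2)[of N p] L(2) by linarith
    finally have "\<Psi>' N (x, y) (1, p) \<le> L" .
    moreover have "0 \<le> \<delta> * L" "0 \<le> \<delta> * (1 + C)" using \<delta> L(1) C(2) by auto
    ultimately show ?thesis by linarith
  next
    case False
    then have z: "(x, y) \<notin> S" using S_sub_P by auto
    have "0 \<le> (guard N + 1) * \<sigma> N (x, y)" using guard(1)[of N] \<sigma>_range[of N "(x, y)"] by simp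
    moreover have "\<bar>ex + (guard N + 1) * \<sigma> N (x, y)\<bar> \<le> \<delta>" using \<eta>_x[of N "(x, y)"] unfolding ex_def \<delta>_def .
    ultimately have "ex \<le> \<delta>" by linarith
    moreover have "ey * p \<le> \<delta> * (L + C)"
    proof -
      have "\<bar>ey * p\<bar> \<le> \<delta> * (L + C)"
        unfolding abs_mult using ey C(1)[of p] L(2) by (intro mult_mono) auto
      then show ?thesis by linarith
    qed
    moreover have "B (x, y) * p - A (x, y) \<le> L" unfolding L_def by (rule field_calibrates[OF z])
    ultimately show ?thesis unfolding D AB_eq[OF False] by (simp add: algebra_simps)
  qed
  then show ?thesis by (simp add: \<delta>_def L_def algebra_simps)
qed

end

section \<open>Minimizers through the singular set\<close>

lemma action_nonneg_eq:
  assumes "\<And>z. 0 \<le> L z"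
  shows "action L u a b = enn2ereal (\<integral>\<^sup>+x\<in>{a..b}. ennreal (L (x, u x, deriv u x)) \<partial>lebesgue)"
proof -
  have "ennreal (- L z) = 0" for z using assms[of z] by (simp add: ennreal_neg)
  then show ?thesis by (simp add: action_def zero_ennreal.rep_eq)
qed

context singular_layers
begin

definition L :: "real \<times> real \<times> real \<Rightarrow> real" where
  "L z = \<omega> (snd (snd z)) + F z"

lemma L_eq: "L (x, y, p) = \<omega> p + F (x, y, p)"
  by (simp add: L_def)

lemma L_nonneg: "0 \<le> L z"
  using \<omega>_nonneg[of "snd (snd z)"] F_nonneg[of "fst z" "fst (snd z)" "snd (snd z)"] by (simp add: L_def)

lemma L_continuous: "continuous_on UNIV L"
  unfolding L_def[abs_def]
  by (intro continuous_on_add smooth_on_imp_continuous_on[OF F_smooth]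
      continuous_on_compose2[OF smooth_on_imp_continuous_on[OF \<omega>_smooth]] continuous_intros) auto

lemma L_borel: "L \<in> borel_measurable borel"
  by (rule borel_measurable_continuous_onI[OF L_continuous])

text \<open>
  The functions \<open>\<Psi> N\<close> are calibrations up to errors that vanish in the limit. They are differentiable
  across \<open>S\<close>, so it does not matter how long the graph of \<open>v\<close> stays in \<open>S\<close>.
\<close>

lemma action_ge:
  assumes ac: "abs_continuous_on a b v" and "a \<le> b"
  shows "ereal (\<Phi>_lim (b, v b) - \<Phi>_lim (a, v a)) \<le> action L v a b"
proof (cases "(\<integral>\<^sup>+x\<in>{a..b}. ennreal (L (x, v x, deriv v x)) \<partial>lebesgue)")
  case top
  then show ?thesis by (simp add: action_nonneg_eq[OF L_nonneg])
next
  case (real j)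
  obtain C where C: "0 \<le> C" "\<And>p. \<bar>p\<bar> - C \<le> \<omega> p" using \<omega>_ge_linear[of 1] by auto
  have le: "\<Psi> N (b, v b) - \<Psi> N (a, v a) \<le> (1 + (1/2) ^ Suc N) * j + (1/2) ^ Suc N * (1 + C) * (b - a)" for N
  proof -
    obtain M where M: "M-lipschitz_on UNIV (\<Psi> N)" using \<Psi>_lipschitz by blast
    show ?thesis
    proof (rule calibration_lower_bound[OF L_borel L_nonneg \<Psi>_derivative M _ ac \<open>a \<le> b\<close> real(2,1)])
      show "\<Psi>' N (x, y) (1, p) \<le> (1 + (1/2) ^ Suc N) * L (x, y, p) + (1/2) ^ Suc N * (1 + C)" for x y p
        unfolding L_eq by (rule \<Psi>_calibrates[OF C(2,1)])
    qed
  qed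
  have h: "(\<lambda>N. (1/2::real) ^ Suc N) \<longlonglongrightarrow> 0" by (intro LIMSEQ_Suc LIMSEQ_realpow_zero) auto
  have r: "(\<lambda>N. (1 + (1/2) ^ Suc N) * j + (1/2) ^ Suc N * (1 + C) * (b - a)) \<longlonglongrightarrow> (1 + 0) * j + 0 * (1 + C) * (b - a)"
    by (intro tendsto_add tendsto_mult tendsto_const h)
  have l: "(\<lambda>N. \<Psi> N (b, v b) - \<Psi> N (a, v a)) \<longlonglongrightarrow> \<Phi>_lim (b, v b) - \<Phi>_lim (a, v a)"
    by (intro tendsto_diff \<Psi>_tendsto)
  have "\<Phi>_lim (b, v b) - \<Phi>_lim (a, v a) \<le> (1 + 0) * j + 0 * (1 + C) * (b - a)"
    by (rule LIMSEQ_le[OF l r]) (use le in blast)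
  then show ?thesis using real by (simp add: action_nonneg_eq[OF L_nonneg] enn2ereal_ennreal)
qed

text \<open>
  The trajectory is a Lipschitz curve, so it meets \<open>S\<close> only at a null set of heights. If \<open>X\<close> were constant on an interval,
  then \<open>\<kappa> = 0\<close> there, that is, the trajectory would be in \<open>S\<close> at all heights of the interval.
\<close>

lemma trajectory:
  assumes pu: "purely_unrectifiable S"
  obtains X where "X 0 = x0" "\<And>t. t \<in> {0..1} \<Longrightarrow> (X has_real_derivative \<kappa> (X t, y0 + t)) (at t)"
    "\<And>t t'. 0 \<le> t \<Longrightarrow> t < t' \<Longrightarrow> t' \<le> 1 \<Longrightarrow> X t < X t'"
    "\<And>t t'. 0 \<le> t \<Longrightarrow> t \<le> t' \<Longrightarrow> t' \<le> 1 \<Longrightarrow> X t' - X t \<le> t' - t"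
    "compact {t\<in>{0..1}. (X t, y0 + t) \<in> S}" "negligible {t\<in>{0..1}. (X t, y0 + t) \<in> S}"
proof -
  have kb: "\<bar>\<kappa> z\<bar> \<le> 1" for z using \<kappa>_nonneg[of z] \<kappa>_le_1[of z] by simp
  obtain X where X: "X 0 = x0" "\<And>t. t \<in> {0..1} \<Longrightarrow> (X has_real_derivative \<kappa> (X t, y0 + t)) (at t)"
    by (rule peano[OF \<kappa>_continuous kb, where ?x0.0 = x0 and ?y0.0 = y0]) blast
  have mono: "X t \<le> X t'" if "0 \<le> t" "t \<le> t'" "t' \<le> 1" for t t'
  proof (rule DERIV_nonneg_imp_nondecreasing[OF that(2)])
    fix r assume "t \<le> r" "r \<le> t'"
    then have "(X has_real_derivative \<kappa> (X r, y0 + r)) (at r)" using that by (intro X(2)) auto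
    then show "\<exists>y. (X has_real_derivative y) (at r) \<and> 0 \<le> y" using \<kappa>_nonneg by blast
  qed
  have lip: "X t' - X t \<le> t' - t" if "0 \<le> t" "t \<le> t'" "t' \<le> 1" for t t'
  proof -
    have "t - X t \<le> t' - X t'"
    proof (rule DERIV_nonneg_imp_nondecreasing[OF that(2)])
      fix r assume "t \<le> r" "r \<le> t'"
      then have "((\<lambda>r. r - X r) has_real_derivative 1 - \<kappa> (X r, y0 + r)) (at r)"
        using that by (intro derivative_intros X(2)) auto
      then show "\<exists>y. ((\<lambda>r. r - X r) has_real_derivative y) (at r) \<and> 0 \<le> y"
        using \<kappa>_le_1[of "(X r, y0 + r)"] by (intro exI[of _ "1 - \<kappa> (X r, y0 + r)"]) simp
    qed
    then show ?thesis by simp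
  qed
  define T where "T = {t\<in>{0..1}. (X t, y0 + t) \<in> S}"
  have contX: "continuous_on {0..1} X"
    by (rule continuous_at_imp_continuous_on) (use X(2) DERIV_isCont in blast)
  have "closed ({0..1} \<inter> (\<lambda>t. (X t, y0 + t)) -` S)"
    by (intro continuous_closed_preimage continuous_on_Pair contX continuous_intros compact_imp_closed S_compact) auto
  moreover have "T = {0..1} \<inter> (\<lambda>t. (X t, y0 + t)) -` S" by (auto simp: T_def)
  ultimately have "closed T" by simp
  then have "compact ({0..1} \<inter> T)" by (rule compact_Int_closed[OF compact_Icc])
  moreover have "{0..1} \<inter> T = T" by (auto simp: T_def)
  ultimately have Tc: "compact T" by (simp only:)
  have Tn: "negligible T"
  proof -
    define cl where "cl s = max 0 (min 1 s)" for s :: real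
    define \<gamma> where "\<gamma> s = (X (cl s), y0 + cl s)" for s
    have cl: "0 \<le> cl s" "cl s \<le> 1" "\<bar>cl s - cl t\<bar> \<le> \<bar>s - t\<bar>" for s t by (auto simp: cl_def)
    have "\<bar>X (cl s) - X (cl t)\<bar> \<le> \<bar>cl s - cl t\<bar>" for s t
      using lip[of "cl s" "cl t"] lip[of "cl t" "cl s"] mono[of "cl s" "cl t"] mono[of "cl t" "cl s"] cl(1,2)[of s] cl(1,2)[of t]
      by linarith
    note lipX = this
    have "dist (\<gamma> s) (\<gamma> t) \<le> 2 * dist s t" for s t
    proof -
      have "dist (\<gamma> s) (\<gamma> t) = sqrt ((X (cl s) - X (cl t))\<^sup>2 + (cl s - cl t)\<^sup>2)"
        by (simp add: \<gamma>_def dist_prod_def dist_real_def)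
      also have "\<dots> \<le> \<bar>X (cl s) - X (cl t)\<bar> + \<bar>cl s - cl t\<bar>" by (rule sqrt_sum_squares_le_sum_abs)
      also have "\<dots> \<le> \<bar>s - t\<bar> + \<bar>s - t\<bar>"
        by (rule add_mono[OF order_trans[OF lipX cl(3)] cl(3)])
      finally show ?thesis by (simp add: dist_real_def)
    qed
    then have "2-lipschitz_on UNIV \<gamma>" by (intro lipschitz_onI) auto
    moreover have "1-lipschitz_on UNIV (\<lambda>z::real \<times> real. snd z - y0)"
      by (intro lipschitz_onI) (auto simp: dist_real_def intro: order_trans[OF _ dist_snd_le])
    ultimately have "negligible ((\<lambda>z. snd z - y0) ` (S \<inter> range \<gamma>))"
      by (rule negligible_lipschitz_image_of_unrectifiable[OF pu])
    moreover have "T \<subseteq> (\<lambda>z. snd z - y0) ` (S \<inter> range \<gamma>)"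
    proof
      fix t assume "t \<in> T"
      then have "\<gamma> t \<in> S" "cl t = t" by (auto simp: T_def \<gamma>_def cl_def)
      then have "\<gamma> t \<in> S \<inter> range \<gamma>" "snd (\<gamma> t) - y0 = t" by (blast, simp add: \<gamma>_def)
      then show "t \<in> (\<lambda>z. snd z - y0) ` (S \<inter> range \<gamma>)" by (metis (no_types, lifting) image_eqI)
    qed
    ultimately show ?thesis by (rule negligible_subset)
  qed
  have strict: "X t < X t'" if t: "0 \<le> t" "t < t'" "t' \<le> 1" for t t'
  proof (rule ccontr)
    assume "\<not> X t < X t'"
    then have e: "X r = X t" if "t \<le> r" "r \<le> t'" for r
      using mono[of t r] mono[of r t'] t that by linarith
    have "{t<..<t'} \<subseteq> T"
    proof
      fix r assume r: "r \<in> {t<..<t'}"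
      have "((\<lambda>_. X t) has_real_derivative 0) (at r)" by simp
      then have "(X has_real_derivative 0) (at r)"
      proof (rule has_field_derivative_transform_within_open)
        show "open {t<..<t'}" "r \<in> {t<..<t'}" using r by auto
        show "X t = X x" if "x \<in> {t<..<t'}" for x
          by (rule e[symmetric]) (use that in auto)
      qed
      moreover have r1: "r \<in> {0..1}" using r t by auto
      ultimately have "\<kappa> (X r, y0 + r) = 0" by (intro DERIV_unique[OF X(2)[OF r1]])
      then have "(X r, y0 + r) \<in> S" using \<kappa>_pos[of "(X r, y0 + r)"] by (metis less_irrefl)
      then show "r \<in> T" using r1 by (simp add: T_def)
    qed
    then have "negligible {t<..<t'}" using Tn negligible_subset by blast
    then show False using open_not_negligible[of "{t<..<t'}"] t by auto
  qed
  show thesis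
    by (rule that[of X]) (use X strict lip Tc Tn in \<open>auto simp: T_def\<close>)
qed

text \<open>
  The minimizer is the inverse \<open>u\<close> of a trajectory \<open>X\<close> that starts at the given point of \<open>S\<close>. As \<open>X\<close> has derivative
  \<open>\<kappa> = 0\<close> at its initial height, \<open>u\<close> has infinite derivative at \<open>x0\<close>. Changing variables to the height turns the action into the
  integral of \<open>B - A \<kappa>\<close>. Almost everywhere this is the limit of the nonnegative derivatives of \<open>\<Phi> N\<close> along the trajectory, so by
  Fatou's lemma the action is at most the limit of the increments of \<open>\<Phi> N\<close>, which is a lower bound for all competitors.
\<close>

lemma minimizer_through_singular_point:
  assumes pu: "purely_unrectifiable S" and z0: "(x0, y0) \<in> S"
  shows "\<exists>b u. x0 < b \<and> minimizer L x0 b u \<and> u x0 = y0 \<and> has_infinite_derivative u x0 b x0"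
proof -
  obtain X where X: "X 0 = x0" "\<And>t. t \<in> {0..1} \<Longrightarrow> (X has_real_derivative \<kappa> (X t, y0 + t)) (at t)"
    "\<And>t t'. 0 \<le> t \<Longrightarrow> t < t' \<Longrightarrow> t' \<le> 1 \<Longrightarrow> X t < X t'"
    "\<And>t t'. 0 \<le> t \<Longrightarrow> t \<le> t' \<Longrightarrow> t' \<le> 1 \<Longrightarrow> X t' - X t \<le> t' - t"
    "compact {t\<in>{0..1}. (X t, y0 + t) \<in> S}" "negligible {t\<in>{0..1}. (X t, y0 + t) \<in> S}"
    by (rule trajectory[OF pu, of x0 y0]) blast
  define T where "T = {t\<in>{0..1}. (X t, y0 + t) \<in> S}"
  have T: "compact T" "negligible T" "T \<subseteq> {0..1}" using X(5,6) by (auto simp: T_def)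
  define z where "z t = (X t, y0 + t)" for t
  define k where "k t = \<kappa> (z t)" for t
  have Xk: "(X has_real_derivative k t) (at t)" if "t \<in> {0..1}" for t using X(2)[OF that] by (simp add: k_def z_def)
  have contX: "continuous_on {0..1} X"
    by (rule continuous_at_imp_continuous_on) (use Xk DERIV_isCont in blast)
  have contz: "continuous_on {0..1} z" unfolding z_def[abs_def] by (intro continuous_intros contX)
  have contk: "continuous_on {0..1} k" unfolding k_def[abs_def]
    by (rule continuous_on_compose2[OF \<kappa>_continuous contz]) auto
  have k_nonneg: "0 \<le> k t" for t by (simp add: k_def \<kappa>_nonneg)
  have k_pos: "0 < k t" if "t \<in> {0..1} - T" for t using that \<kappa>_pos[of "z t"] by (auto simp: T_def k_def z_def)
  define b where "b = X 1"
  have "x0 < b" using X(3)[of 0 1] X(1) by (simp add: b_def)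
  have Xrange: "X t \<in> {x0..b}" if "t \<in> {0..1}" for t
    using X(3)[of 0 t] X(3)[of t 1] X(1) that by (cases "t = 0"; cases "t = 1") (auto simp: b_def less_imp_le)
  have Xinj: "inj_on X {0..1}"
    by (rule linorder_inj_onI) (use X(3) in \<open>force+\<close>)
  have Xonto: "\<exists>t\<in>{0..1}. X t = x" if "x \<in> {x0..b}" for x
    using IVT'[of X 0 x 1] contX that X(1) by (auto simp: b_def)
  define w where "w = the_inv_into {0..1} X"
  have wX: "w (X t) = t" if "t \<in> {0..1}" for t unfolding w_def using Xinj that by (rule the_inv_into_f_f)
  have w: "w x \<in> {0..1}" "X (w x) = x" if "x \<in> {x0..b}" for x
    using Xonto[OF that] wX by auto
  have Xless: "X s < X t \<longleftrightarrow> s < t" if "s \<in> {0..1}" "t \<in> {0..1}" for s t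
    using X(3)[of s t] X(3)[of t s] that by (cases s t rule: linorder_cases) (auto dest: order.asym)
  have w_less: "w x < w y \<longleftrightarrow> x < y" if "x \<in> {x0..b}" "y \<in> {x0..b}" for x y
    using Xless[OF w(1)[OF that(1)] w(1)[OF that(2)]] w(2) that by simp
  have w_le: "w x \<le> w y" if "x \<in> {x0..b}" "y \<in> {x0..b}" "x \<le> y" for x y
    using w_less[OF that(2,1)] that(3) by linarith
  define u where "u x = y0 + w x" for x
  have uX: "u (X t) = y0 + t" if "t \<in> {0..1}" for t using wX[OF that] by (simp add: u_def)
  have u0: "u x0 = y0" using uX[of 0] X(1) by simp
  have Xint: "(k has_integral (X t' - X t)) {t..t'}" if "0 \<le> t" "t \<le> t'" "t' \<le> 1" for t t'
  proof (rule fundamental_theorem_of_calculus[OF that(2)])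
    fix r assume "r \<in> {t..t'}"
    then have "(X has_real_derivative k r) (at r)" using Xk[of r] that by auto
    then show "(X has_vector_derivative k r) (at r within {t..t'})"
      by (metis has_real_derivative_iff_has_vector_derivative has_vector_derivative_at_within)
  qed
  have ac: "abs_continuous_on x0 b u"
    unfolding abs_continuous_on_def
  proof (intro allI impI)
    fix e :: real assume "0 < e"
    then have "0 < e / 2" by simp
    obtain U where U: "open U" "T \<subseteq> U" "U \<in> lmeasurable" "measure lebesgue U < e / 2"
      by (rule negligible_imp_small_open[OF T(2) \<open>0 < e / 2\<close>])
    \<comment> \<open>Off a small open set U that contains the singular heights, X increases at a rate of at
      least c. Hence the length of an interval of heights is at most the measure of its part in U plus 1/c times
      the length of the interval that X maps it to.\<close>
    obtain c where c: "0 < c" "\<And>t. t \<in> {0..1} - U \<Longrightarrow> c \<le> k t"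
    proof (cases "{0..1} - U = {}")
      case True
      show ?thesis by (rule that[of 1]) (use True in \<open>simp, blast\<close>)
    next
      case False
      have "compact ({0..1} - U)" using U(1) by (intro compact_diff) auto
      then obtain t where t: "t \<in> {0..1} - U" "\<And>t'. t' \<in> {0..1} - U \<Longrightarrow> k t \<le> k t'"
        using continuous_attains_inf[OF _ False continuous_on_subset[OF contk]] by blast
      then show ?thesis using that[of "k t"] k_pos[of t] U(2) by auto
    qed
    have one: "c * (q - p) \<le> c * measure lebesgue (U \<inter> {p<..<q}) + (X q - X p)" if pq: "0 \<le> p" "p \<le> q" "q \<le> 1" for p q
    proof -
      have lm: "U \<inter> {p<..<q} \<in> lmeasurable" using U(3) by (intro fmeasurable_Int_fmeasurable) auto
      have lm2: "{p<..<q} - U \<in> lmeasurable" using U(3) by (intro fmeasurable.Diff) auto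
      have "((\<lambda>t. indicat_real ({p<..<q} - U) t) has_integral measure lebesgue ({p<..<q} - U)) UNIV"
        using lm2 by (rule lmeasurable_iff_has_integral[THEN iffD1])
      then have "((\<lambda>t. c * indicat_real ({p<..<q} - U) t) has_integral c * measure lebesgue ({p<..<q} - U)) UNIV"
        by (rule has_integral_mult_right)
      moreover have "((\<lambda>t. if t \<in> {p..q} then k t else 0) has_integral (X q - X p)) UNIV"
        using Xint[OF pq] by (simp only: has_integral_restrict_UNIV)
      ultimately have "c * measure lebesgue ({p<..<q} - U) \<le> X q - X p"
        by (rule has_integral_le) (use c(2) k_nonneg pq in \<open>auto simp: indicator_def\<close>)
      moreover have "measure lebesgue {p<..<q} = measure lebesgue (U \<inter> {p<..<q}) + measure lebesgue ({p<..<q} - U)"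
      proof -
        have "measure lebesgue ((U \<inter> {p<..<q}) \<union> ({p<..<q} - U)) = measure lebesgue (U \<inter> {p<..<q}) + measure lebesgue ({p<..<q} - U)"
          by (rule measure_Union) (use fmeasurableD2[OF lm] fmeasurableD2[OF lm2] fmeasurableD[OF lm] fmeasurableD[OF lm2] in auto)
        moreover have "(U \<inter> {p<..<q}) \<union> ({p<..<q} - U) = {p<..<q}" by auto
        ultimately show ?thesis by (simp only:)
      qed
      moreover have "measure lebesgue {p<..<q} = q - p" using pq by simp
      ultimately have "q - p = measure lebesgue (U \<inter> {p<..<q}) + measure lebesgue ({p<..<q} - U)" by linarith
      then have "c * (q - p) = c * measure lebesgue (U \<inter> {p<..<q}) + c * measure lebesgue ({p<..<q} - U)"
        by (simp only: distrib_left)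
      then show ?thesis using \<open>c * measure lebesgue ({p<..<q} - U) \<le> X q - X p\<close> by linarith
    qed
    show "\<exists>\<delta>>0. \<forall>(n::nat) l r. (\<forall>i<n. x0 \<le> l i \<and> l i \<le> r i \<and> r i \<le> b) \<longrightarrow>
        disjoint_family_on (\<lambda>i. {l i<..<r i}) {..<n} \<longrightarrow>
        (\<Sum>i<n. r i - l i) < \<delta> \<longrightarrow> (\<Sum>i<n. \<bar>u (r i) - u (l i)\<bar>) < e"
    proof (intro exI[of _ "c * (e / 2)"] conjI allI impI)
      fix n :: nat and l r :: "nat \<Rightarrow> real"
      assume lr: "\<forall>i<n. x0 \<le> l i \<and> l i \<le> r i \<and> r i \<le> b"
        and dj: "disjoint_family_on (\<lambda>i. {l i<..<r i}) {..<n}"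
        and small: "(\<Sum>i<n. r i - l i) < c * (e / 2)"
      define J where "J i = U \<inter> {w (l i)<..<w (r i)}" for i
      have lri: "l i \<in> {x0..b}" "r i \<in> {x0..b}" "l i \<le> r i" if "i < n" for i using lr that by fastforce+
      have wi: "0 \<le> w (l i)" "w (l i) \<le> w (r i)" "w (r i) \<le> 1" if "i < n" for i
        using w(1)[OF lri(1)[OF that]] w(1)[OF lri(2)[OF that]] w_le[OF lri[OF that]] by auto
      have sub: "X t \<in> {l i<..<r i}" if "i < n" "t \<in> {w (l i)<..<w (r i)}" for i t
      proof -
        have "t \<in> {0..1}" using wi[OF that(1)] that(2) by auto
        then show ?thesis using Xless[OF w(1)[OF lri(1)[OF that(1)]], of t] Xless[OF _ w(1)[OF lri(2)[OF that(1)]], of t]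
          w(2)[OF lri(1)[OF that(1)]] w(2)[OF lri(2)[OF that(1)]] that(2) by auto
      qed
      have djJ: "disjoint_family_on J {..<n}"
        unfolding disjoint_family_on_def
      proof (intro ballI impI)
        fix i j assume ij: "i \<in> {..<n}" "j \<in> {..<n}" "i \<noteq> j"
        then have "{l i<..<r i} \<inter> {l j<..<r j} = {}" using dj by (auto simp: disjoint_family_on_def)
        then show "J i \<inter> J j = {}" using sub[of i] sub[of j] ij unfolding J_def by blast
      qed
      have Jm: "J i \<in> lmeasurable" for i unfolding J_def using U(3) by (intro fmeasurable_Int_fmeasurable) auto
      have "(\<Sum>i<n. measure lebesgue (J i)) = measure lebesgue (\<Union>i<n. J i)"
      proof (rule measure_finite_Union[symmetric])
        show "J ` {..<n} \<subseteq> sets lebesgue" using fmeasurableD[OF Jm] by blast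
        show "emeasure lebesgue (J i) \<noteq> \<infinity>" for i
          unfolding infinity_ennreal_def by (rule fmeasurableD2[OF Jm])
      qed (use djJ in simp_all)
      also have "\<dots> \<le> measure lebesgue U"
        by (rule measure_mono_fmeasurable) (use Jm U(3) in \<open>auto simp: J_def\<close>)
      finally have mJ: "(\<Sum>i<n. measure lebesgue (J i)) < e / 2" using U(4) by simp
      have "c * (\<Sum>i<n. w (r i) - w (l i)) \<le> c * (\<Sum>i<n. measure lebesgue (J i)) + (\<Sum>i<n. r i - l i)"
        unfolding sum_distrib_left sum.distrib[symmetric]
      proof (rule sum_mono)
        fix i assume "i \<in> {..<n}"
        then have i: "i < n" by simp
        show "c * (w (r i) - w (l i)) \<le> c * measure lebesgue (J i) + (r i - l i)"
          using one[OF wi[OF i]] w(2)[OF lri(1)[OF i]] w(2)[OF lri(2)[OF i]] by (simp add: J_def)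
      qed
      also have "\<dots> < c * (e / 2) + c * (e / 2)" using mJ small c(1) by (intro add_strict_mono mult_strict_left_mono) auto
      also have "\<dots> = c * e" by simp
      finally have "(\<Sum>i<n. w (r i) - w (l i)) < e" using c(1) by simp
      moreover have "(\<Sum>i<n. \<bar>u (r i) - u (l i)\<bar>) = (\<Sum>i<n. w (r i) - w (l i))"
        by (rule sum.cong[OF refl]) (use wi in \<open>auto simp: u_def\<close>)
      ultimately show "(\<Sum>i<n. \<bar>u (r i) - u (l i)\<bar>) < e" by simp
    qed (use c \<open>0 < e\<close> in auto)
  qed

  have du: "deriv u (X t) = 1 / k t" if t: "t \<in> {0<..<1} - T" for t
  proof -
    have Xt: "X t \<in> {x0<..<b}" using X(3)[of 0 t] X(3)[of t 1] X(1) t by (auto simp: b_def)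
    have "isCont w (X t)"
    proof -
      have "continuous_on {x0..b} u" by (rule abs_continuous_on_imp_continuous_on[OF ac])
      then have "continuous_on {x0..b} (\<lambda>x. u x - y0)" by (intro continuous_intros)
      moreover have "(\<lambda>x. u x - y0) = w" by (simp add: u_def[abs_def])
      ultimately have "continuous_on {x0..b} w" by (simp only:)
      then have "continuous_on {x0<..<b} w" by (rule continuous_on_subset) auto
      then show ?thesis using Xt by (simp add: continuous_on_eq_continuous_at)
    qed
    then have "(w has_real_derivative inverse (k t)) (at (X t))"
      using Xk[of t] wX[of t] w(2) t k_pos[of t] Xt
      by (intro DERIV_inverse_function[where f = X and a = x0 and b = b]) auto
    then have "(u has_real_derivative inverse (k t)) (at (X t))"
      unfolding u_def[abs_def] by (auto intro!: derivative_eq_intros)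
    then show ?thesis by (simp add: DERIV_imp_deriv divide_inverse)
  qed

  define D where "D = \<Phi>_lim (b, u b) - \<Phi>_lim (x0, u x0)"
  have zD: "z 0 = (x0, u x0)" "z 1 = (b, u b)" using X(1) u0 uX[of 1] by (auto simp: z_def b_def)
  define q where "q N t = B_upto N (z t) - A_upto N (z t) * k t" for N t
  have q_nonneg: "0 \<le> q N t" for N t unfolding q_def k_def by (rule slope_nonneg)
  have contq: "continuous_on {0..1} (q N)" for N
    unfolding q_def[abs_def]
    by (intro continuous_intros contk continuous_on_compose2[OF smooth_on_imp_continuous_on[OF A_upto_smooth] contz]
        continuous_on_compose2[OF smooth_on_imp_continuous_on[OF B_upto_smooth] contz]) auto
  have qhas: "(q N has_integral \<Phi> N (z 1) - \<Phi> N (z 0)) {0..1}" for N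
  proof (rule fundamental_theorem_of_calculus)
    fix t :: real assume t: "t \<in> {0..1}"
    have "(X has_derivative (\<lambda>h. k t * h)) (at t)"
      using Xk[OF t] by (simp add: has_field_derivative_def)
    then have "(z has_derivative (\<lambda>h. (k t * h, h))) (at t)"
      unfolding z_def[abs_def] by (auto intro!: derivative_eq_intros)
    then have "((\<lambda>t. \<Phi> N (z t)) has_derivative (\<lambda>h. - A_upto N (z t) * fst (k t * h, h) + B_upto N (z t) * snd (k t * h, h))) (at t)"
      by (rule has_derivative_compose[OF _ \<Phi>_derivative])
    then have "((\<lambda>t. \<Phi> N (z t)) has_real_derivative q N t) (at t)"
      unfolding has_field_derivative_def by (rule has_derivative_eq_rhs) (auto simp: q_def fun_eq_iff algebra_simps)
    then show "((\<lambda>t. \<Phi> N (z t)) has_vector_derivative q N t) (at t within {0..1})"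
      by (metis has_real_derivative_iff_has_vector_derivative has_vector_derivative_at_within)
  qed simp
  have qint: "(\<integral>\<^sup>+t. ennreal (q N t) * indicator {0..1} t \<partial>lborel) = ennreal (\<Phi> N (z 1) - \<Phi> N (z 0))" for N
    by (rule nn_integral_has_integral_lebesgue'[OF q_nonneg qhas])
  \<comment> \<open>The value 0 on the null set T of singular heights is a convention that matches the integrand f below.\<close>
  define h where "h t = (if t \<in> T then 0 else B (z t) - A (z t) * k t)" for t
  have zT: "z t \<notin> S" if "t \<in> {0..1} - T" for t using that by (auto simp: T_def z_def)
  have hq: "\<forall>\<^sub>F N in sequentially. q N t = h t" if t: "t \<in> {0..1} - T" for t
  proof -
    obtain N where N: "z t \<notin> P N" using misses_some_layer[OF zT[OF t]] by blast
    show ?thesis unfolding eventually_sequentially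
    proof (intro exI[of _ N] allI impI)
      fix M assume "N \<le> M"
      then show "q M t = h t" using stable_outside(1,2)[OF N] AB_eq[OF N] t by (simp add: q_def h_def)
    qed
  qed
  have hint: "(\<integral>\<^sup>+t. ennreal (h t) * indicator {0..1} t \<partial>lborel) \<le> ennreal D"
  proof -
    have m: "(\<lambda>t. ennreal (q N t) * indicator {0..1} t) \<in> borel_measurable lborel" for N
    proof -
      have "(\<lambda>t. indicator {0..1} t *\<^sub>R q N t) \<in> borel_measurable borel"
        by (rule borel_measurable_continuous_on_indicator[OF _ contq]) simp
      then have "(\<lambda>t. ennreal (indicator {0..1} t *\<^sub>R q N t)) \<in> borel_measurable borel" by simp
      moreover have "ennreal (indicator {0..1} t *\<^sub>R q N t) = ennreal (q N t) * indicator {0..1} t" for t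
        by (simp add: indicator_def)
      ultimately show ?thesis by simp
    qed
    have "(\<integral>\<^sup>+t. ennreal (h t) * indicator {0..1} t \<partial>lborel)
        \<le> (\<integral>\<^sup>+t. liminf (\<lambda>N. ennreal (q N t) * indicator {0..1} t) \<partial>lborel)"
    proof (rule nn_integral_mono)
      fix t :: real
      show "ennreal (h t) * indicator {0..1} t \<le> liminf (\<lambda>N. ennreal (q N t) * indicator {0..1} t)"
      proof (cases "t \<in> {0..1} - T")
        case True
        have "(\<lambda>N. ennreal (q N t) * indicator {0..1} t) \<longlonglongrightarrow> ennreal (h t) * indicator {0..1} t"
          by (rule tendsto_eventually) (use hq[OF True] in \<open>auto elim: eventually_mono\<close>)
        from lim_imp_Liminf[OF sequentially_bot this] show ?thesis by simp
      next
        case False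
        then have "ennreal (h t) * indicator {0..1} t = 0" by (auto simp: h_def indicator_def)
        then show ?thesis by (simp only: zero_le)
      qed
    qed
    also have "\<dots> \<le> liminf (\<lambda>N. \<integral>\<^sup>+t. ennreal (q N t) * indicator {0..1} t \<partial>lborel)"
      by (rule nn_integral_liminf[OF m])
    also have "\<dots> = ennreal D"
    proof -
      have "(\<lambda>N. ennreal (\<Phi> N (z 1) - \<Phi> N (z 0))) \<longlonglongrightarrow> ennreal D"
        unfolding D_def zD by (intro tendsto_ennrealI tendsto_diff \<Phi>_tendsto)
      then show ?thesis unfolding qint by (rule lim_imp_Liminf[OF sequentially_bot])
    qed
    finally show ?thesis .
  qed

  define cl where "cl x = max x0 (min b x)" for x
  have cl: "cl x = x" if "x \<in> {x0..b}" for x using that by (auto simp: cl_def)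
  define uc where "uc x = u (cl x)" for x
  have contuc: "continuous_on UNIV uc"
    unfolding uc_def[abs_def] cl_def
    by (rule continuous_on_compose2[OF abs_continuous_on_imp_continuous_on[OF ac]])
      (use \<open>x0 < b\<close> in \<open>auto intro!: continuous_intros\<close>)
  \<comment> \<open>A Borel version of the integrand of u, as the substitution rule needs one.\<close>
  define f where "f x = (if (x, uc x) \<in> S then 0 else L (x, uc x, 1 / \<kappa> (x, uc x)))" for x
  have fm: "f \<in> borel_measurable borel"
  proof -
    have c2: "continuous_on UNIV (\<lambda>x. (x, uc x))" by (intro continuous_intros contuc)
    have [measurable]: "uc \<in> borel_measurable borel" by (rule borel_measurable_continuous_onI[OF contuc])
    have [measurable]: "(\<lambda>x. \<kappa> (x, uc x)) \<in> borel_measurable borel"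
      by (rule borel_measurable_continuous_onI, rule continuous_on_compose2[OF \<kappa>_continuous c2]) auto
    have [measurable]: "(\<lambda>x. L (x, uc x, 1 / \<kappa> (x, uc x))) \<in> borel_measurable borel"
      by (rule measurable_compose[OF _ L_borel]) (auto simp: borel_prod[symmetric])
    have "closed ((\<lambda>x. (x, uc x)) -` S)"
      using continuous_on_closed_vimage[of UNIV "\<lambda>x. (x, uc x)"] c2 compact_imp_closed[OF S_compact] by auto
    then have [measurable]: "{x. (x, uc x) \<in> S} \<in> sets borel" by (simp add: vimage_def)
    have "(\<lambda>x. if x \<in> {x. (x, uc x) \<in> S} then 0 else L (x, uc x, 1 / \<kappa> (x, uc x))) \<in> borel_measurable borel"
      by measurable
    then show ?thesis by (simp add: f_def[abs_def])
  qed
  have fX: "f (X t) = (if t \<in> T then 0 else L (X t, y0 + t, 1 / k t))" if t: "t \<in> {0..1}" for t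
    using cl[OF Xrange[OF t]] uX[OF t] t by (simp add: f_def uc_def T_def k_def z_def)
  have fh: "f (X t) * k t = h t" if t: "t \<in> {0..1}" for t
  proof (cases "t \<in> T")
    case False
    then have "z t \<notin> S" using zT t by blast
    from field_tight[OF this[unfolded z_def]] show ?thesis
      using False by (simp add: fX[OF t] h_def k_def L_eq z_def)
  qed (simp add: fX[OF t] h_def)
  \<comment> \<open>X does not increase distances, so it maps the null set T to a null set.\<close>
  define N where "N = X ` T \<union> {x0, b}"
  have Nn: "negligible N"
  proof -
    have "negligible (X ` T)"
    proof (rule negligible_locally_Lipschitz_image[OF _ T(2)])
      fix t assume t: "t \<in> T"
      have "norm (X r - X t) \<le> 1 * norm (r - t)" if "r \<in> T" for r
        using X(4)[of r t] X(4)[of t r] X(3)[of r t] X(3)[of t r] t that T(3)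
        by (cases r t rule: linorder_cases) (auto simp: subset_eq)
      then show "\<exists>V B. open V \<and> t \<in> V \<and> (\<forall>r\<in>T \<inter> V. norm (X r - X t) \<le> B * norm (r - t))"
        by (intro exI[of _ UNIV] exI[of _ 1]) auto
    qed simp
    then show ?thesis by (simp add: N_def)
  qed
  have I: "(\<integral>\<^sup>+x\<in>{x0..b}. ennreal (L (x, u x, deriv u x)) \<partial>lebesgue) \<le> ennreal D"
  proof -
    have "(\<integral>\<^sup>+x\<in>{x0..b}. ennreal (L (x, u x, deriv u x)) \<partial>lebesgue) = (\<integral>\<^sup>+x. ennreal (f x) * indicator {x0..b} x \<partial>lebesgue)"
    proof (rule nn_integral_cong_AE)
      have "N \<in> null_sets lebesgue" using Nn by (simp add: negligible_iff_null_sets)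
      then have aeN: "AE x in lebesgue. x \<notin> N" by (rule AE_not_in)
      have Lf: "L (x, u x, deriv u x) = f x" if x: "x \<in> {x0..b}" "x \<notin> N" for x
      proof -
        define t where "t = w x"
        have t: "t \<in> {0..1}" "X t = x" using w[OF x(1)] by (auto simp: t_def)
        then have "t \<notin> T" "t \<noteq> 0" "t \<noteq> 1" using x(2) X(1) by (auto simp: N_def b_def)
        then have "deriv u (X t) = 1 / k t" using t(1) by (intro du) auto
        then show ?thesis using fX[OF t(1)] \<open>t \<notin> T\<close> uX[OF t(1)] t(2) by simp
      qed
      show "AE x in lebesgue. ennreal (L (x, u x, deriv u x)) * indicator {x0..b} x = ennreal (f x) * indicator {x0..b} x"
        using aeN
      proof (rule eventually_mono)
        show "ennreal (L (x, u x, deriv u x)) * indicator {x0..b} x = ennreal (f x) * indicator {x0..b} x"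
          if "x \<notin> N" for x
          using Lf[OF _ that] by (cases "x \<in> {x0..b}") simp_all
      qed
    qed
    also have "\<dots> = (\<integral>\<^sup>+x. ennreal (f x) * indicator {X 0..X 1} x \<partial>lborel)"
      unfolding X(1) b_def[symmetric] by (rule nn_integral_completion)
    also have "\<dots> = (\<integral>\<^sup>+x. ennreal (f x * indicator {X 0..X 1} x) \<partial>lborel)"
      by (intro nn_integral_cong) (simp add: indicator_def)
    also have "\<dots> = (\<integral>\<^sup>+t. ennreal (f (X t) * k t * indicator {0..1} t) \<partial>lborel)"
      by (rule nn_integral_substitution) (use fm Xk contk k_nonneg in \<open>auto simp: set_borel_measurable_def\<close>)
    also have "\<dots> = (\<integral>\<^sup>+t. ennreal (h t) * indicator {0..1} t \<partial>lborel)"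
      by (intro nn_integral_cong) (auto simp: indicator_def fh)
    also have "\<dots> \<le> ennreal D" by (rule hint)
    finally show ?thesis .
  qed
  have D0: "0 \<le> D"
  proof -
    have "\<Phi> N (z 0) \<le> \<Phi> N (z 1)" for N
      using has_integral_nonneg[OF qhas q_nonneg, of N] by simp
    then have "\<Phi>_lim (z 0) \<le> \<Phi>_lim (z 1)" by (intro LIMSEQ_le[OF \<Phi>_tendsto \<Phi>_tendsto]) blast
    then show ?thesis by (simp add: D_def zD)
  qed
  have au: "action L u x0 b \<le> ereal D"
    using I D0 by (simp add: action_nonneg_eq[OF L_nonneg] less_eq_ennreal.rep_eq enn2ereal_ennreal)
  have min: "minimizer L x0 b u"
    unfolding minimizer_def
  proof (intro conjI ac antisym)
    show "action L u x0 b \<le> min_action L x0 (u x0) b (u b)"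
      unfolding min_action_def
    proof (rule INF_greatest)
      fix v assume "v \<in> {v. abs_continuous_on x0 b v \<and> v x0 = u x0 \<and> v b = u b}"
      then have v: "abs_continuous_on x0 b v" "v x0 = u x0" "v b = u b" by auto
      show "action L u x0 b \<le> action L v x0 b"
        using action_ge[OF v(1)] au v(2,3) \<open>x0 < b\<close> by (simp add: D_def order_trans)
    qed
    show "min_action L x0 (u x0) b (u b) \<le> action L u x0 b"
      unfolding min_action_def by (rule INF_lower) (use ac in auto)
  qed
  have inf: "has_infinite_derivative u x0 b x0"
    unfolding has_infinite_derivative_def filterlim_at_top_gt[where c = "0::real"]
  proof (intro disjI1 allI impI)
    fix Z :: real assume "0 < Z"
    have "k 0 = 0" using \<kappa>_on_S[OF z0] X(1) by (simp add: k_def z_def)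
    then have "((\<lambda>t. (X (0 + t) - X 0) / t) \<longlongrightarrow> 0) (at 0)" using Xk[of 0] by (simp add: DERIV_def)
    note lim0 = this[unfolded LIM_eq, rule_format, of "1 / Z"]
    have "0 < 1 / Z" using \<open>0 < Z\<close> by simp
    from lim0[OF this] obtain d where d0: "d > 0" "\<forall>t. t \<noteq> 0 \<and> norm (t - 0) < d \<longrightarrow> norm ((X (0 + t) - X 0) / t - 0) < 1 / Z"
      by auto
    have d: "d > 0" "t \<noteq> 0 \<Longrightarrow> \<bar>t\<bar> < d \<Longrightarrow> \<bar>(X t - X 0) / t\<bar> < 1 / Z" for t
      using d0(1) d0(2)[rule_format, of t] by simp_all
    define t1 where "t1 = min (d / 2) 1"
    have t1: "0 < t1" "t1 \<le> 1" "t1 < d" using d(1) by (auto simp: t1_def)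
    have "X 0 < X t1" using X(3)[of 0 t1] t1 by simp
    show "\<forall>\<^sub>F x in at x0 within {x0..b}. Z \<le> (u x - u x0) / (x - x0)"
      unfolding eventually_at
    proof (intro exI[of _ "X t1 - X 0"] conjI ballI impI)
      show "0 < X t1 - X 0" using \<open>X 0 < X t1\<close> by simp
      fix x assume x: "x \<in> {x0..b}" and dx: "x \<noteq> x0 \<and> dist x x0 < X t1 - X 0"
      define t where "t = w x"
      have t: "t \<in> {0..1}" "X t = x" using w[OF x] by (auto simp: t_def)
      have "x < X t1" "x0 < x" using x dx X(1) by (auto simp: dist_real_def)
      then have "t < t1" "0 < t" using Xless[OF t(1), of t1] Xless[OF _ t(1), of 0] t(2) t1 X(1) by auto
      then have "\<bar>(X t - X 0) / t\<bar> < 1 / Z" using d(2)[of t] t1 by simp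
      then have "(x - x0) / t < 1 / Z" using t(2) X(1) \<open>0 < t\<close> \<open>x0 < x\<close> by simp
      then have "Z * (x - x0) \<le> t" using \<open>0 < Z\<close> \<open>0 < t\<close> by (simp add: field_simps)
      moreover have "u x - u x0 = t" using u0 by (simp add: u_def t_def)
      ultimately show "Z \<le> (u x - u x0) / (x - x0)" using \<open>x0 < x\<close> by (simp add: field_simps)
    qed
  qed
  show ?thesis using \<open>x0 < b\<close> min u0 inf by blast
qed

end

text \<open>
  The layers are chosen one after the other: two directed bumps are supported in the current neighbourhood, and the next neighbourhood
  is contained in the region where both have full strength.
\<close>

lemma (in convex_integrand) singular_layers_exist:
  assumes "compact S" "purely_unrectifiable S"
  shows "\<exists>g \<eta> s \<sigma> P K. singular_layers \<omega> S g \<eta> s \<sigma> P K"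
proof -
  define good where "good k Q Q' g s K \<eta> \<sigma> \<longleftrightarrow> Q' \<subseteq> Q \<and> Q' \<subseteq> (\<Union>x\<in>S. ball x (1 / real (Suc k))) \<and>
     smooth_on UNIV g \<and> closed K \<and> K \<subseteq> Q \<and> (\<forall>z. z \<notin> K \<longrightarrow> g z = 0) \<and> (\<forall>z. \<bar>g z\<bar> \<le> (1/2) ^ Suc k) \<and>
     (\<forall>z. 0 \<le> s z \<and> s z \<le> 1 \<and> \<bar>frechet_derivative g (at z) (1, 0) + (\<alpha> (Suc k) - \<alpha> k) * s z\<bar> \<le> (1/2) ^ Suc k \<and>
        \<bar>frechet_derivative g (at z) (0, 1) - (\<beta> (Suc k) - \<beta> k) * s z\<bar> \<le> (1/2) ^ Suc k) \<and> (\<forall>z\<in>Q'. s z = 1) \<and>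
     smooth_on UNIV \<eta> \<and> (\<forall>z. \<bar>\<eta> z\<bar> \<le> (1/2) ^ Suc k) \<and>
     (\<forall>z. 0 \<le> \<sigma> z \<and> \<sigma> z \<le> 1 \<and> \<bar>frechet_derivative \<eta> (at z) (1, 0) + (guard k + 1) * \<sigma> z\<bar> \<le> (1/2) ^ Suc k \<and>
        \<bar>frechet_derivative \<eta> (at z) (0, 1)\<bar> \<le> (1/2) ^ Suc k) \<and> (\<forall>z\<in>Q'. \<sigma> z = 1)"
    for k :: nat and Q Q' K :: "(real \<times> real) set" and g s \<eta> \<sigma> :: "real \<times> real \<Rightarrow> real"
  define next_layer where "next_layer k Q Q' \<longleftrightarrow> (\<exists>g s K \<eta> \<sigma>. good k Q Q' g s K \<eta> \<sigma>)" for k Q Q'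
  define nbhd where "nbhd k Q \<longleftrightarrow> open Q \<and> S \<subseteq> Q \<and> (k = 0 \<longrightarrow> Q = UNIV)" for k :: nat and Q
  have "\<exists>P. \<forall>k. nbhd k (P k) \<and> next_layer k (P k) (P (Suc k))"
  proof (rule dependent_nat_choice)
    show "\<exists>Q. nbhd 0 Q" by (auto simp: nbhd_def)
    fix Q k assume "nbhd k Q"
    then have Q: "open Q" "S \<subseteq> Q" by (auto simp: nbhd_def)
    define e :: real where "e = (1/2) ^ Suc k"
    have "0 < e" by (simp add: e_def)
    have a: "0 < \<alpha> (Suc k) - \<alpha> k" "0 < guard k + 1" using \<alpha>_less[of k] guard(1)[of k] by auto
    obtain g s W K where g: "smooth_on UNIV g" "open W" "S \<subseteq> W" "closed K" "K \<subseteq> Q" "\<forall>z. z \<notin> K \<longrightarrow> g z = 0"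
      "\<forall>z. \<bar>g z\<bar> \<le> e"
      "\<forall>z. 0 \<le> s z \<and> s z \<le> 1 \<and> \<bar>frechet_derivative g (at z) (1, 0) + (\<alpha> (Suc k) - \<alpha> k) * s z\<bar> \<le> e \<and>
        \<bar>frechet_derivative g (at z) (0, 1) - (\<beta> (Suc k) - \<beta> k) * s z\<bar> \<le> e" "\<forall>z\<in>W. s z = (1::real)"
      using directed_bump[OF assms a(1) \<open>0 < e\<close> \<open>0 < e\<close> Q, of "\<beta> (Suc k) - \<beta> k"] by blast
    obtain \<eta> \<sigma> W2 K2 where \<eta>: "smooth_on UNIV \<eta>" "open W2" "S \<subseteq> W2" "closed K2" "K2 \<subseteq> Q" "\<forall>z. z \<notin> K2 \<longrightarrow> \<eta> z = 0"
      "\<forall>z. \<bar>\<eta> z\<bar> \<le> e"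
      "\<forall>z. 0 \<le> \<sigma> z \<and> \<sigma> z \<le> 1 \<and> \<bar>frechet_derivative \<eta> (at z) (1, 0) + (guard k + 1) * \<sigma> z\<bar> \<le> e \<and>
        \<bar>frechet_derivative \<eta> (at z) (0, 1) - 0 * \<sigma> z\<bar> \<le> e" "\<forall>z\<in>W2. \<sigma> z = (1::real)"
      using directed_bump[OF assms a(2) \<open>0 < e\<close> \<open>0 < e\<close> Q, of 0] by blast
    define Q' where "Q' = W \<inter> W2 \<inter> Q \<inter> (\<Union>x\<in>S. ball x (1 / real (Suc k)))"
    have "good k Q Q' g s K \<eta> \<sigma>"
      unfolding good_def e_def[symmetric] by (intro conjI) (use g \<eta> in \<open>auto simp: Q'_def\<close>)
    moreover have "open Q'" unfolding Q'_def using g(2) \<eta>(2) Q(1) by (intro open_Int open_UN) auto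
    moreover have "S \<subseteq> Q'" unfolding Q'_def using g(3) \<eta>(3) Q(2) by auto
    ultimately have "nbhd (Suc k) Q'" "next_layer k Q Q'" unfolding nbhd_def next_layer_def by (simp, blast)
    then show "\<exists>Q'. nbhd (Suc k) Q' \<and> next_layer k Q Q'" by blast
  qed
  then obtain P where P: "\<And>k. nbhd k (P k)" "\<And>k. next_layer k (P k) (P (Suc k))" by blast
  from P(2) obtain g s K \<eta> \<sigma> where G: "\<And>k. good k (P k) (P (Suc k)) (g k) (s k) (K k) (\<eta> k) (\<sigma> k)"
    unfolding next_layer_def by metis
  have "singular_layers \<omega> S g \<eta> s \<sigma> P K"
  proof (unfold_locales)
    show "compact S" by fact
    show "P 0 = UNIV" "\<And>k. open (P k)" "\<And>k. S \<subseteq> P k" using P(1) by (auto simp: nbhd_def)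
  qed (use G in \<open>auto simp: good_def\<close>)
  then show ?thesis by blast
qed

lemma strictly_convex_imp_convex_on:
  assumes "strictly_convex f"
  shows "convex_on UNIV f"
proof (rule convex_onI)
  fix t x y :: real assume "0 < t" "t < 1"
  then show "f ((1 - t) *\<^sub>R x + t *\<^sub>R y) \<le> (1 - t) * f x + t * f y"
  proof (cases "x = y")
    case True
    then show ?thesis by (simp add: algebra_simps)
  next
    case False
    then have "f ((1 - t) * x + t * y) < (1 - t) * f x + t * f y"
      using assms \<open>0 < t\<close> \<open>t < 1\<close> unfolding strictly_convex_def by blast
    then show ?thesis by simp
  qed
qed simp

theorem theorem4p1:
  fixes \<omega> :: "real \<Rightarrow> real" and S :: "(real \<times> real) set"
  assumes "C_infinity \<omega>"
    and "strictly_convex \<omega>"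
    and "superlinear \<omega>"
    and "\<omega> 0 = 0"
    and "\<And>p. \<omega> p \<ge> \<omega> 0"
    and "purely_unrectifiable S"
    and "compact S"
  shows "\<exists>(L :: real \<times> real \<times> real \<Rightarrow> real) (F :: real \<times> real \<times> real \<Rightarrow> real).
    lagrangian L \<and>
    (\<forall>x y p. L (x, y, p) = \<omega> p + F (x, y, p)) \<and>
    C_infinity F \<and>
    (\<forall>x y p. F (x, y, p) \<ge> 0) \<and>
    (\<forall>x y. F (x, y, 0) = 0) \<and>
    (\<forall>x y. convex_on UNIV (\<lambda>p. F (x, y, p))) \<and>
    S \<subseteq> universal_singular_set L"
proof -
  interpret convex_integrand \<omega>
    by unfold_locales
      (use assms strictly_convex_imp_convex_on in \<open>auto simp: C_infinity_iff_smooth_on\<close>)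
  obtain g \<eta> s \<sigma> P K where "singular_layers \<omega> S g \<eta> s \<sigma> P K"
    using singular_layers_exist[OF assms(7,6)] by blast
  then interpret singular_layers \<omega> S g \<eta> s \<sigma> P K .
  show ?thesis
  proof (rule exI[of _ L], rule exI[of _ F], intro conjI allI)
    show "lagrangian L"
      unfolding lagrangian_def
    proof (intro conjI allI exI[of _ \<omega>])
      show "L \<in> borel_measurable borel" by (rule L_borel)
      show "bdd_below (range L)" using L_nonneg by (intro bdd_belowI[of _ 0]) auto
      show "\<exists>U. open U \<and> z \<in> U \<and> bdd_above (L ` U)" for z
      proof (intro exI[of _ "{v. L v < L z + 1}"] conjI)
        show "open {v. L v < L z + 1}" by (intro open_Collect_less L_continuous continuous_intros)
        show "bdd_above (L ` {v. L v < L z + 1})" by (intro bdd_aboveI[of _ "L z + 1"]) auto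
      qed simp
      show "\<omega> p \<le> L (x, y, p)" for x y p using F_nonneg by (simp add: L_eq)
    qed (rule assms)
    show "C_infinity F" using F_smooth by (simp add: C_infinity_iff_smooth_on)
    show "S \<subseteq> universal_singular_set L"
    proof (rule subrelI)
      fix x0 y0 assume "(x0, y0) \<in> S"
      then obtain b u where "x0 < b" "minimizer L x0 b u" "u x0 = y0" "has_infinite_derivative u x0 b x0"
        using minimizer_through_singular_point[OF assms(6)] by blast
      then show "(x0, y0) \<in> universal_singular_set L"
        unfolding universal_singular_set_def by (intro CollectI case_prodI exI[of _ x0] exI[of _ b] exI[of _ u]) simp
    qed
  qed (rule L_eq F_nonneg F_at_0 F_convex)+
qed

end
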